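(* Let $\mathbf R$ be an algebra of one of the types specified below generated by $\{v_0,v_1\}$ over a field $K$, let $\mathbf R=\bigoplus_{n=1}^\infty\mathbf R_n$ be its $\mathbb N$-gradation by degree in the generators $\{v_0,v_1\}$, $(\mathbf R^n\mid n\ge 1)$ its lower central series, and $a_n=\dim\mathbf R_n=\dim\mathbf R^n/\mathbf R^{n+1}$, $n\ge 1$. Then: (i) if $\operatorname{char}K\ne 2$ and $\mathbf R=\operatorname{Lie}(v_0,v_1)$ is the Lie superalgebra, then $a_n\in\{2,3,4\}$ for all $n\ge 1$, and $\mathbf R$ is of width $4$; (ii) if $\operatorname{char}K=2$ and $\mathbf R$ is the Lie algebra generated by $v_0,v_1$, then $a_n\in\{1,2\}$ for all $n\ge 1$, and $\mathbf R$ is of width $2$; (iii) if $\operatorname{char}K=2$ and $\mathbf R$ is the Lie superalgebra (or the restricted Lie (super)algebra) generated by $v_0,v_1$, then $a_n\in\{1,2,3\}$ for all $n\ge 1$, and $\mathbf R$ is of width $3$.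
   Context: Let $\Lambda=\Lambda(x_i\mid i\ge 0)$ be the Grassmann (exterior) algebra over $K$ on odd generators $x_0,x_1,\dots$, a $\mathbb Z_2$-graded algebra. In $\operatorname{End}\Lambda$ identify $x_i$ with left multiplication by $x_i$, and let $\partial_i$ be the odd superderivation of $\Lambda$ with $\partial_i(x_j)=\delta_{ij}$. The supercommutator is $[a,b]=ab-(-1)^{\deg a\deg b}ba$. The pivot elements are the odd superderivations $v_i=\partial_i+x_ix_{i+1}(\partial_{i+2}+x_{i+2}x_{i+3}(\partial_{i+4}+\cdots))$, $i\ge 0$, that is, $v_i=\partial_i+x_ix_{i+1}v_{i+2}$ (well defined on $\Lambda$, since each element involves finitely many letters). The algebras generated by $v_0,v_1$ inside $\operatorname{End}\Lambda$ are the smallest ($\mathbb Z_2$-graded) subspaces containing $v_0,v_1$ and closed under: the supercommutator (Lie superalgebra if $\operatorname{char}K\neq2$; Lie algebra if $\operatorname{char}K=2$); the supercommutator and squares $a\mapsto a^2$ of odd elements (Lie superalgebra, $\operatorname{char}K=2$); the supercommutator and squares of all elements (restricted Lie algebra, $\operatorname{char}K=2$, which is the same object as the restricted Lie superalgebra). $\mathbf R_n$ is the span of the monomials formed from $v_0,v_1$ by these operations with total degree $n$ in $v_0,v_1$ (a square doubles the degree). The lower central series is $L^1=L$, $L^n=[L,L^{n-1}]$ for $n\ge 2$; for Lie superalgebras in characteristic $2$ one adds to $L^n$ the span of squares of odd elements of $L^{\lceil n/2\rceil}$, and in the restricted case ($p=2$) also the span of squares of even elements of $L^{\lceil n/2\rceil}$.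 An $\mathbb N$-graded algebra $L=\bigoplus_{n\ge1}L_n$ is of width $d$ if $\dim L_n\le d$ for all $n\ge 1$ and $d$ is minimal with this property. *)

theory Defs
  imports Complex_Main
begin

section \<open>The Grassmann algebra on \<open>x\<^sub>0, x\<^sub>1, \<dots>\<close>\<close>

text \<open>An element is given by its coefficients with respect to the basis of monomials
  \<open>x\<^sub>A = x\<^bsub>a1\<^esub> \<dots> x\<^bsub>ar\<^esub>\<close>, \<open>a1 < \<dots> < ar\<close>, indexed by the finite sets \<open>A = {a1, \<dots>, ar}\<close>.\<close>

typedef (overloaded) ('k::field) grassmann =
  "{f :: nat set \<Rightarrow> 'k. finite {A. f A \<noteq> 0} \<and> (\<forall>A. infinite A \<longrightarrow> f A = 0)}"
  morphisms gcoeff Grassmann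
  by (rule exI[of _ "\<lambda>_. 0"]) simp

setup_lifting type_definition_grassmann

lemma grassmann_eqI: "(\<And>A. finite A \<Longrightarrow> gcoeff f A = gcoeff g A) \<Longrightarrow> f = g"
  by transfer (metis ext)

lemma gcoeff_infinite: "infinite A \<Longrightarrow> gcoeff f A = 0"
  by transfer auto

lemma finite_gcoeff: "finite {A. gcoeff f A \<noteq> 0}"
  by transfer auto

text \<open>For disjoint \<open>A\<close>, \<open>B\<close>: \<open>x\<^sub>A x\<^sub>B = (-1)\<^bsup>inversions A B\<^esup> x\<^bsub>A \<union> B\<^esub>\<close>.\<close>

definition inversions :: "nat set \<Rightarrow> nat set \<Rightarrow> nat" where
  "inversions A B = card {(a, b). a \<in> A \<and> b \<in> B \<and> b < a}"

lemma finite_inversions: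
  "finite A \<Longrightarrow> finite B \<Longrightarrow> finite {(a, b). a \<in> A \<and> b \<in> B \<and> b < a}"
  for A B :: "nat set"
  by (rule finite_subset[of _ "A \<times> B"]) auto

lemma inversions_empty [simp]: "inversions {} B = 0" "inversions A {} = 0"
  by (auto simp: inversions_def)

lemma inversions_Un_left:
  assumes "finite A" "finite B" "finite D" "A \<inter> B = {}"
  shows "inversions (A \<union> B) D = inversions A D + inversions B D"
proof -
  have "{(a, b). a \<in> A \<union> B \<and> b \<in> D \<and> b < a} =
        {(a, b). a \<in> A \<and> b \<in> D \<and> b < a} \<union> {(a, b). a \<in> B \<and> b \<in> D \<and> b < a}"
    by auto
  then show ?thesis unfolding inversions_def
    using assms by (simp add: card_Un_disjoint finite_inversions disjoint_iff)
qed

lemma inversions_Un_right: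
  assumes "finite A" "finite B" "finite D" "A \<inter> B = {}"
  shows "inversions D (A \<union> B) = inversions D A + inversions D B"
proof -
  have "{(a, b). a \<in> D \<and> b \<in> A \<union> B \<and> b < a} =
        {(a, b). a \<in> D \<and> b \<in> A \<and> b < a} \<union> {(a, b). a \<in> D \<and> b \<in> B \<and> b < a}"
    by auto
  then show ?thesis unfolding inversions_def
    using assms by (simp add: card_Un_disjoint finite_inversions disjoint_iff)
qed

lemma inversions_singleton_left: "inversions {i} B = card {b \<in> B. b < i}"
proof -
  have "{(a, b). a \<in> {i} \<and> b \<in> B \<and> b < a} = Pair i ` {b \<in> B. b < i}" by auto
  then show ?thesis unfolding inversions_def by (simp add: card_image inj_on_def)
qed

lemma inversions_singleton_right: "inversions A {i} = card {a \<in> A. i < a}"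
proof -
  have "{(a, b). a \<in> A \<and> b \<in> {i} \<and> b < a} = (\<lambda>a. (a, i)) ` {a \<in> A. i < a}" by auto
  then show ?thesis unfolding inversions_def by (simp add: card_image inj_on_def)
qed

lemma inversions_insert_left:
  assumes "finite A" "finite D" "i \<notin> A"
  shows "inversions (insert i A) D = card {b \<in> D. b < i} + inversions A D"
  using inversions_Un_left[of "{i}" A D] assms by (simp add: inversions_singleton_left)

lemma inversions_insert_right:
  assumes "finite A" "finite D" "i \<notin> A"
  shows "inversions D (insert i A) = card {a \<in> D. i < a} + inversions D A"
  using inversions_Un_right[of "{i}" A D] assms by (simp add: inversions_singleton_right)

instantiation grassmann :: (field) ring_1
begin

lift_definition zero_grassmann :: "'a grassmann" is "\<lambda>_. 0" by simp

lift_definition one_grassmann :: "'a grassmann" is "\<lambda>A. if A = {} then 1 else 0" by auto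

lift_definition plus_grassmann :: "'a grassmann \<Rightarrow> 'a grassmann \<Rightarrow> 'a grassmann"
  is "\<lambda>f g A. f A + g A"
proof (intro conjI allI impI)
  fix f g :: "nat set \<Rightarrow> 'a"
  assume f: "finite {A. f A \<noteq> 0} \<and> (\<forall>A. infinite A \<longrightarrow> f A = 0)"
    and g: "finite {A. g A \<noteq> 0} \<and> (\<forall>A. infinite A \<longrightarrow> g A = 0)"
  have "{A. f A + g A \<noteq> 0} \<subseteq> {A. f A \<noteq> 0} \<union> {A. g A \<noteq> 0}" by auto
  then show "finite {A. f A + g A \<noteq> 0}"
    using f g finite_UnI finite_subset by meson
  show "f A + g A = 0" if "infinite A" for A
    using f g that by simp
qed

lift_definition minus_grassmann :: "'a grassmann \<Rightarrow> 'a grassmann \<Rightarrow> 'a grassmann"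
  is "\<lambda>f g A. f A - g A"
proof (intro conjI allI impI)
  fix f g :: "nat set \<Rightarrow> 'a"
  assume f: "finite {A. f A \<noteq> 0} \<and> (\<forall>A. infinite A \<longrightarrow> f A = 0)"
    and g: "finite {A. g A \<noteq> 0} \<and> (\<forall>A. infinite A \<longrightarrow> g A = 0)"
  have "{A. f A - g A \<noteq> 0} \<subseteq> {A. f A \<noteq> 0} \<union> {A. g A \<noteq> 0}" by auto
  then show "finite {A. f A - g A \<noteq> 0}"
    using f g finite_UnI finite_subset by meson
  show "f A - g A = 0" if "infinite A" for A
    using f g that by simp
qed

lift_definition uminus_grassmann :: "'a grassmann \<Rightarrow> 'a grassmann" is "\<lambda>f A. - f A" by auto

lift_definition times_grassmann :: "'a grassmann \<Rightarrow> 'a grassmann \<Rightarrow> 'a grassmann"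
  is "\<lambda>f g C. \<Sum>A\<in>Pow C. (-1) ^ inversions A (C - A) * f A * g (C - A)"
proof (intro conjI allI impI)
  fix f g :: "nat set \<Rightarrow> 'a"
  assume f: "finite {A. f A \<noteq> 0} \<and> (\<forall>A. infinite A \<longrightarrow> f A = 0)"
    and g: "finite {A. g A \<noteq> 0} \<and> (\<forall>A. infinite A \<longrightarrow> g A = 0)"
  let ?h = "\<lambda>C. \<Sum>A\<in>Pow C. (-1) ^ inversions A (C - A) * f A * g (C - A)"
  have "{C. ?h C \<noteq> 0} \<subseteq> (\<lambda>(A, B). A \<union> B) ` ({A. f A \<noteq> 0} \<times> {A. g A \<noteq> 0})"
  proof
    fix C assume "C \<in> {C. ?h C \<noteq> 0}"
    then have "?h C \<noteq> 0" by simp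
    then obtain A where A: "A \<in> Pow C" "(-1) ^ inversions A (C - A) * f A * g (C - A) \<noteq> 0"
      by (rule sum.not_neutral_contains_not_neutral)
    have "f A \<noteq> 0" "g (C - A) \<noteq> 0"
      using A(2) by (metis mult_zero_left mult_zero_right)+
    moreover have "C = A \<union> (C - A)" using A(1) by blast
    ultimately show "C \<in> (\<lambda>(A, B). A \<union> B) ` ({A. f A \<noteq> 0} \<times> {A. g A \<noteq> 0})"
      by (intro image_eqI[of _ _ "(A, C - A)"]) simp_all
  qed
  moreover have "finite ((\<lambda>(A, B). A \<union> B) ` ({A. f A \<noteq> 0} \<times> {A. g A \<noteq> 0}))"
    using f g by (intro finite_imageI finite_cartesian_product) simp_all
  ultimately show "finite {C. ?h C \<noteq> 0}" by (rule finite_subset)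
  show "?h C = 0" if "infinite C" for C
    using that by (intro sum.infinite) (simp add: finite_Pow_iff)
qed

lemma gcoeff_simps [simp]:
  "gcoeff 0 A = 0"
  "gcoeff (f + g) A = gcoeff f A + gcoeff g A"
  "gcoeff (f - g) A = gcoeff f A - gcoeff g A"
  "gcoeff (- f) A = - gcoeff f A"
  by (simp_all add: zero_grassmann.rep_eq plus_grassmann.rep_eq minus_grassmann.rep_eq
      uminus_grassmann.rep_eq)

instance
proof
  fix f g h :: "'a grassmann"
  show "f * g * h = f * (g * h)"
  proof (rule grassmann_eqI)
    fix C :: "nat set" assume C: "finite C"
    have fin: "finite E" if "E \<subseteq> C" for E using C that by (rule finite_subset[rotated])
    define s :: "nat set \<Rightarrow> nat set \<Rightarrow> 'a" where "s A B = (-1) ^ inversions A B" for A B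
    have cocycle: "s E (C - E) * s A (E - A) = s A (C - A) * s (E - A) (C - A - (E - A))"
      if "E \<subseteq> C" "A \<subseteq> E" for E A
    proof -
      have "inversions E (C - E) = inversions A (C - E) + inversions (E - A) (C - E)"
        using inversions_Un_left[of A "E - A" "C - E"] that
        by (metis Diff_disjoint Diff_subset Un_Diff_cancel Un_absorb1 dual_order.trans fin)
      moreover have "inversions A (C - A) = inversions A (E - A) + inversions A (C - E)"
      proof -
        have "C - A = (E - A) \<union> (C - E)" using that by auto
        moreover have "finite (E - A)" "finite (C - E)" "finite A" "(E - A) \<inter> (C - E) = {}"
          using that fin by (auto intro: fin)
        ultimately show ?thesis using inversions_Un_right[of "E - A" "C - E" A] by metis
      qed
      moreover have "C - A - (E - A) = C - E" using that by auto
      ultimately have "inversions E (C - E) + inversions A (E - A) =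
          inversions A (C - A) + inversions (E - A) (C - A - (E - A))"
        by (simp only: add_ac)
      then show ?thesis unfolding s_def power_add[symmetric] by (rule arg_cong)
    qed
    have "gcoeff (f * g * h) C =
      (\<Sum>E\<in>Pow C. \<Sum>A\<in>Pow E. s E (C - E) * s A (E - A) * gcoeff f A * gcoeff g (E - A) * gcoeff h (C - E))"
      by (simp add: times_grassmann.rep_eq s_def sum_distrib_left sum_distrib_right mult_ac)
    also have "\<dots> = (\<Sum>(E, A)\<in>Sigma (Pow C) Pow.
        s E (C - E) * s A (E - A) * gcoeff f A * gcoeff g (E - A) * gcoeff h (C - E))"
      using C fin by (subst sum.Sigma) auto
    also have "\<dots> = (\<Sum>(A, B)\<in>Sigma (Pow C) (\<lambda>A. Pow (C - A)).
        s A (C - A) * s B (C - A - B) * gcoeff f A * gcoeff g B * gcoeff h (C - A - B))"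
    proof (rule sum.reindex_bij_witness[where j = "\<lambda>(E, A). (A, E - A)" and i = "\<lambda>(A, B). (A \<union> B, A)"],
        goal_cases)
      case (5 p)
      then obtain E A where p: "p = (E, A)" "E \<subseteq> C" "A \<subseteq> E" by auto
      then have "C - A - (E - A) = C - E" by auto
      then show ?case using cocycle[of E A] p by simp
    qed auto
    also have "\<dots> = (\<Sum>A\<in>Pow C. \<Sum>B\<in>Pow (C - A).
        s A (C - A) * s B (C - A - B) * gcoeff f A * gcoeff g B * gcoeff h (C - A - B))"
      using C fin by (subst sum.Sigma) auto
    also have "\<dots> = gcoeff (f * (g * h)) C"
      by (simp add: times_grassmann.rep_eq s_def sum_distrib_left sum_distrib_right mult_ac)
    finally show "gcoeff (f * g * h) C = gcoeff (f * (g * h)) C" .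
  qed
  show "1 * f = f"
  proof (rule grassmann_eqI)
    fix C :: "nat set" assume "finite C"
    then have "(\<Sum>A\<in>Pow C. (-1) ^ inversions A (C - A) * gcoeff 1 A * gcoeff f (C - A)) =
      (\<Sum>A\<in>{{}}. (-1) ^ inversions A (C - A) * gcoeff 1 A * gcoeff f (C - A))"
      by (intro sum.mono_neutral_right) (auto simp: one_grassmann.rep_eq)
    then show "gcoeff (1 * f) C = gcoeff f C"
      by (simp add: times_grassmann.rep_eq one_grassmann.rep_eq)
  qed
  show "f * 1 = f"
  proof (rule grassmann_eqI)
    fix C :: "nat set" assume "finite C"
    then have "(\<Sum>A\<in>Pow C. (-1) ^ inversions A (C - A) * gcoeff f A * gcoeff 1 (C - A)) =
      (\<Sum>A\<in>{C}. (-1) ^ inversions A (C - A) * gcoeff f A * gcoeff 1 (C - A))"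
      by (intro sum.mono_neutral_right) (auto simp: one_grassmann.rep_eq)
    then show "gcoeff (f * 1) C = gcoeff f C"
      by (simp add: times_grassmann.rep_eq one_grassmann.rep_eq)
  qed
  show "(f + g) * h = f * h + g * h" "f * (g + h) = f * g + f * h"
    by (rule grassmann_eqI, simp add: times_grassmann.rep_eq distrib_left distrib_right sum.distrib)+
  show "f + g + h = f + (g + h)" "f + g = g + f" "0 + f = f" "- f + f = 0" "f - g = f + - g"
    by (rule grassmann_eqI, simp)+
  have "gcoeff (0 :: 'a grassmann) {} \<noteq> gcoeff 1 {}"
    by (simp add: zero_grassmann.rep_eq one_grassmann.rep_eq)
  then show "(0 :: 'a grassmann) \<noteq> 1" by metis
qed

end

lift_definition gscale :: "'k::field \<Rightarrow> 'k grassmann \<Rightarrow> 'k grassmann" is "\<lambda>c f A. c * f A"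
  by (auto elim!: finite_subset[rotated])

global_interpretation grassmann: vector_space gscale
  by unfold_locales (transfer, simp add: algebra_simps)+

lemma gcoeff_gscale [simp]: "gcoeff (gscale c f) A = c * gcoeff f A"
  by (simp add: gscale.rep_eq)

lemma gscale_mult: "gscale c f * g = gscale c (f * g)" "f * gscale c g = gscale c (f * g)"
  by (transfer, simp add: sum_distrib_left mult_ac)+

lift_definition gvar :: "nat \<Rightarrow> 'k::field grassmann" is "\<lambda>i A. if A = {i} then 1 else 0"
  by auto

text \<open>The \<open>\<int>\<^sub>2\<close>-grading; the degree \<open>d :: nat\<close> is read modulo 2.\<close>

definition gr_space :: "nat \<Rightarrow> 'k::field grassmann set" where
  "gr_space d = {f. \<forall>A. gcoeff f A \<noteq> 0 \<longrightarrow> (even (card A) \<longleftrightarrow> even d)}"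

lift_definition gr_part :: "nat \<Rightarrow> 'k::field grassmann \<Rightarrow> 'k grassmann" is
  "\<lambda>d f A. if even (card A) \<longleftrightarrow> even d then f A else 0"
proof (intro conjI allI impI)
  fix d and f :: "nat set \<Rightarrow> 'k"
  assume f: "finite {A. f A \<noteq> 0} \<and> (\<forall>A. infinite A \<longrightarrow> f A = 0)"
  have "{A. (if even (card A) \<longleftrightarrow> even d then f A else 0) \<noteq> 0} \<subseteq> {A. f A \<noteq> 0}"
    by (simp add: subset_iff)
  then show "finite {A. (if even (card A) \<longleftrightarrow> even d then f A else 0) \<noteq> 0}"
    using f finite_subset by meson
  show "(if even (card A) \<longleftrightarrow> even d then f A else 0) = 0" if "infinite A" for A
    using f that by simp
qed

lemma gvar_anticommute: "gvar i * gvar j = - (gvar j * gvar i :: 'k::field grassmann)" if "i \<noteq> j"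
proof (rule grassmann_eqI)
  fix C :: "nat set" assume C: "finite C"
  have *: "gcoeff (gvar i * gvar j :: 'k grassmann) C =
      (if C = {i, j} then (-1) ^ inversions {i} {j} else 0)" if "i \<noteq> j" for i j
  proof -
    have "gcoeff (gvar i * gvar j :: 'k grassmann) C =
       (\<Sum>A\<in>Pow C. if A = {i} then (if C - {i} = {j} then (-1) ^ inversions {i} (C - {i}) else 0) else 0)"
      unfolding times_grassmann.rep_eq gvar.rep_eq by (intro sum.cong) auto
    also have "\<dots> = (if i \<in> C \<and> C - {i} = {j} then (-1) ^ inversions {i} (C - {i}) else 0)"
      using C by (subst sum.delta) auto
    also have "\<dots> = (if C = {i, j} then (-1) ^ inversions {i} {j} else 0)"
      using that by (auto simp: insert_Diff_if)
    finally show ?thesis .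
  qed
  have "{b. b = j \<and> b < i} = (if j < i then {j} else {})" for i j :: nat by auto
  then show "gcoeff (gvar i * gvar j) C = gcoeff (- (gvar j * gvar i) :: 'k grassmann) C"
    using that by (auto simp: *[OF that] *[OF that[symmetric]] insert_commute inversions_singleton_left)
qed

lemma gvar_square: "gvar i * gvar i = (0 :: 'k::field grassmann)"
  by (rule grassmann_eqI) (auto simp: times_grassmann.rep_eq gvar.rep_eq intro!: sum.neutral)


section \<open>The algebra \<open>End \<Lambda>\<close>\<close>

typedef (overloaded) ('k::field) endo =
  "{T :: 'k grassmann \<Rightarrow> 'k grassmann. Vector_Spaces.linear gscale gscale T}"
  morphisms app Endo
  using grassmann.linear_id by blast

setup_lifting type_definition_endo

lemma linear_gscaleI:
  assumes "\<And>f g. T (f + g) = T f + T g" "\<And>c f. T (gscale c f) = gscale c (T f)"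
  shows "Vector_Spaces.linear gscale gscale T"
  by unfold_locales (use assms in auto)

lemma linear_gscaleD:
  assumes "Vector_Spaces.linear gscale gscale T"
  shows "T (f + g) = T f + T g" "T (gscale c f) = gscale c (T f)"
proof -
  interpret Vector_Spaces.linear gscale gscale T by fact
  show "T (f + g) = T f + T g" "T (gscale c f) = gscale c (T f)" by (simp_all add: add scale)
qed

lemma endo_eqI: "(\<And>f. app S f = app T f) \<Longrightarrow> S = T"
  by transfer auto

lemma app_linear: "app T (f + g) = app T f + app T g" "app T (gscale c f) = gscale c (app T f)"
  by (transfer, simp add: linear_gscaleD)+

lemma app_zero_right [simp]: "app T 0 = 0"
  using app_linear(1)[of T 0 0] by simp

lemma app_minus: "app T (f - g) = app T f - app T g"
  using app_linear(1)[of T "f - g" g] by simp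

instantiation endo :: (field) ring_1
begin

lift_definition zero_endo :: "'a endo" is "\<lambda>_. 0"
  by (rule linear_gscaleI) auto

lift_definition one_endo :: "'a endo" is "\<lambda>f. f"
  by (rule linear_gscaleI) auto

lift_definition plus_endo :: "'a endo \<Rightarrow> 'a endo \<Rightarrow> 'a endo" is "\<lambda>S T f. S f + T f"
  by (rule linear_gscaleI) (simp_all add: linear_gscaleD grassmann.scale_right_distrib)

lift_definition minus_endo :: "'a endo \<Rightarrow> 'a endo \<Rightarrow> 'a endo" is "\<lambda>S T f. S f - T f"
  by (rule linear_gscaleI) (simp_all add: linear_gscaleD grassmann.scale_right_diff_distrib)

lift_definition uminus_endo :: "'a endo \<Rightarrow> 'a endo" is "\<lambda>T f. - T f"
  by (rule linear_gscaleI) (simp_all add: linear_gscaleD)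

lift_definition times_endo :: "'a endo \<Rightarrow> 'a endo \<Rightarrow> 'a endo" is "\<lambda>S T f. S (T f)"
  by (rule linear_gscaleI) (simp_all add: linear_gscaleD)

instance
proof
  have "app (0 :: 'a endo) 1 \<noteq> app 1 1" by (simp add: zero_endo.rep_eq one_endo.rep_eq)
  then show "(0 :: 'a endo) \<noteq> 1" by metis
qed (transfer; simp add: linear_gscaleD fun_eq_iff)+

end

lemma app_simps [simp]:
  "app 0 f = 0" "app 1 f = f" "app (S + T) f = app S f + app T f" "app (S - T) f = app S f - app T f"
  "app (- T) f = - app T f" "app (S * T) f = app S (app T f)"
  by (simp_all add: zero_endo.rep_eq one_endo.rep_eq plus_endo.rep_eq minus_endo.rep_eq
      uminus_endo.rep_eq times_endo.rep_eq)

lift_definition endo_scale :: "'k::field \<Rightarrow> 'k endo \<Rightarrow> 'k endo" is "\<lambda>c T f. gscale c (T f)"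
  by (rule linear_gscaleI) (simp_all add: linear_gscaleD grassmann.scale_right_distrib mult.commute)

lemma app_endo_scale [simp]: "app (endo_scale c T) f = gscale c (app T f)"
  by (simp add: endo_scale.rep_eq)

global_interpretation endo: vector_space endo_scale
  by unfold_locales (auto intro!: endo_eqI simp: grassmann.scale_right_distrib grassmann.scale_left_distrib)

definition lmul :: "'k::field grassmann \<Rightarrow> 'k endo" where
  "lmul g = Endo (\<lambda>f. g * f)"

abbreviation xop :: "nat \<Rightarrow> 'k::field endo" where "xop i \<equiv> lmul (gvar i)"

lemma app_lmul [simp]: "app (lmul g) f = g * f"
proof -
  have "Vector_Spaces.linear gscale gscale (\<lambda>f. g * f)"
    by (rule linear_gscaleI) (simp_all add: distrib_left gscale_mult)
  then show ?thesis by (simp add: lmul_def Endo_inverse)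
qed

definition op_space :: "nat \<Rightarrow> 'k::field endo set" where
  "op_space d = {T. \<forall>e. \<forall>f\<in>gr_space e. app T f \<in> gr_space (d + e)}"

lift_definition gproj :: "nat \<Rightarrow> 'k::field endo" is gr_part
  by (rule linear_gscaleI; rule grassmann_eqI) (simp_all add: gr_part.rep_eq)

lemma gcoeff_gproj [simp]:
  "gcoeff (app (gproj d) f) A = (if even (card A) \<longleftrightarrow> even d then gcoeff f A else 0)"
  by (simp add: gproj.rep_eq gr_part.rep_eq)

text \<open>The homogeneous component of degree \<open>d\<close> modulo 2.\<close>

definition op_part :: "nat \<Rightarrow> 'k::field endo \<Rightarrow> 'k endo" where
  "op_part d T = gproj d * T * gproj 0 + gproj (d + 1) * T * gproj 1"

lemma gproj_mem: "app (gproj d) f \<in> gr_space d"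
  by (auto simp: gr_space_def)

lemma gproj_id: "f \<in> gr_space d \<Longrightarrow> even d = even e \<Longrightarrow> app (gproj e) f = f"
  by (rule grassmann_eqI) (auto simp: gr_space_def)

lemma gproj_other: "f \<in> gr_space d \<Longrightarrow> even d \<noteq> even e \<Longrightarrow> app (gproj e) f = 0"
proof (rule grassmann_eqI)
  fix A assume f: "f \<in> gr_space d" and "even d \<noteq> even e"
  show "gcoeff (app (gproj e) f) A = gcoeff 0 A"
  proof (cases "gcoeff f A = 0")
    case False
    then have "even (card A) = even d" using f unfolding gr_space_def by blast
    then have "(even (card A) = even e) = False" using \<open>even d \<noteq> even e\<close> by argo
    then show ?thesis by (simp only: gcoeff_gproj if_False gcoeff_simps)
  qed simp
qed

lemma gproj_sum: "app (gproj 0) f + app (gproj 1) f = f"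
  by (rule grassmann_eqI) simp

lemma gr_space_cong: "even d = even e \<Longrightarrow> gr_space d = gr_space e"
  by (simp add: gr_space_def)

lemma gr_space_zero [simp]: "0 \<in> gr_space d"
  by (auto simp: gr_space_def)

lemma gr_space_add: "f \<in> gr_space d \<Longrightarrow> g \<in> gr_space d \<Longrightarrow> f + g \<in> gr_space d"
proof -
  assume f: "f \<in> gr_space d" and g: "g \<in> gr_space d"
  have "even (card A) = even d" if "gcoeff (f + g) A \<noteq> 0" for A
  proof -
    have "gcoeff f A \<noteq> 0 \<or> gcoeff g A \<noteq> 0" using that by (metis add.right_neutral gcoeff_simps(2))
    then show ?thesis using f g unfolding gr_space_def by blast
  qed
  then show ?thesis unfolding gr_space_def by blast
qed

lemma op_space_cong: "even d = even e \<Longrightarrow> op_space d = (op_space e :: 'k::field endo set)"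
proof -
  assume "even d = even e"
  then have "gr_space (d + i) = (gr_space (e + i) :: 'k grassmann set)" for i
    by (intro gr_space_cong) simp
  then show ?thesis by (simp add: op_space_def)
qed

lemma op_part_mem: "op_part d T \<in> op_space d"
proof -
  have "app (op_part d T) f \<in> gr_space (d + e)" if f: "f \<in> gr_space e" for e f
  proof (cases "even e")
    case True
    then have "app (op_part d T) f = app (gproj d) (app T f)"
      using gproj_id[OF f, of 0] gproj_other[OF f, of 1] by (simp add: op_part_def)
    then show ?thesis using gproj_mem gr_space_cong[of d "d + e"] True by auto
  next
    case False
    then have "app (op_part d T) f = app (gproj (d + 1)) (app T f)"
      using gproj_id[OF f, of 1] gproj_other[OF f, of 0] by (simp add: op_part_def)
    then show ?thesis using gproj_mem gr_space_cong[of "d + 1" "d + e"] False by auto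
  qed
  then show ?thesis by (auto simp: op_space_def)
qed

lemma op_part_sum: "op_part 0 T + op_part 1 T = T"
proof (rule endo_eqI)
  fix f
  have gproj2: "gproj (1 + 1) = (gproj 0 :: 'a endo)"
    by (rule endo_eqI, rule grassmann_eqI) simp
  have "app (op_part 0 T + op_part 1 T) f =
      (app (gproj 0) (app T (app (gproj 0) f)) + app (gproj 1) (app T (app (gproj 0) f))) +
      (app (gproj 0) (app T (app (gproj 1) f)) + app (gproj 1) (app T (app (gproj 1) f)))"
    unfolding op_part_def gproj2 by (simp add: algebra_simps)
  also have "\<dots> = app T f" by (simp only: gproj_sum app_linear[symmetric])
  finally show "app (op_part 0 T + op_part 1 T) f = app T f" .
qed

lemma op_part_hom:
  assumes "T \<in> op_space d"
  shows "op_part e T = (if even d = even e then T else 0)"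
proof (rule endo_eqI)
  fix f
  have T: "app T (app (gproj i) f) \<in> gr_space (d + i)" for i
    using assms gproj_mem[of i f] by (auto simp: op_space_def)
  show "app (op_part e T) f = app (if even d = even e then T else 0) f"
  proof (cases "even d = even e")
    case True
    then have "app (op_part e T) f = app T (app (gproj 0) f) + app T (app (gproj 1) f)"
      by (simp add: op_part_def gproj_id[OF T])
    then have "app (op_part e T) f = app T f"
      by (simp only: gproj_sum app_linear[symmetric])
    then show ?thesis using True by simp
  next
    case False
    then have "app (op_part e T) f = 0"
      by (simp add: op_part_def gproj_other[OF T])
    then show ?thesis using False by simp
  qed
qed

text \<open>The supercommutator: \<open>a b - (-1)\<^bsup>d e\<^esup> b a\<close> for \<open>a\<close>, \<open>b\<close> of degrees \<open>d\<close>, \<open>e\<close>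
  (lemma \<open>scomm_hom\<close>), extended bilinearly.\<close>

definition scomm :: "'k::field endo \<Rightarrow> 'k endo \<Rightarrow> 'k endo" where
  "scomm a b = (\<Sum>d\<in>{0, 1}. \<Sum>e\<in>{0, 1}.
     op_part d a * op_part e b - (-1) ^ (d * e) * (op_part e b * op_part d a))"

lemma scomm_hom:
  assumes "a \<in> op_space d" "b \<in> op_space e"
  shows "scomm a b = a * b - (-1) ^ (d * e) * (b * a)"
  using op_part_hom[OF assms(1)] op_part_hom[OF assms(2)]
  by (cases "even d"; cases "even e") (simp_all add: scomm_def)


section \<open>Superderivations and the pivot elements\<close>

definition odd_superderivation :: "'k::field endo \<Rightarrow> bool" where
  "odd_superderivation D \<longleftrightarrow> D \<in> op_space 1 \<and>
     (\<forall>d. \<forall>f\<in>gr_space d. \<forall>g. app D (f * g) = app D f * g + (-1) ^ d * f * app D g)"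

text \<open>The sign is the one from moving \<open>x\<^sub>i\<close> to the front of the monomial; see
  \<open>odd_superderivation_pd\<close> and \<open>pd_gvar\<close> for the defining properties.\<close>

lift_definition pd_raw :: "nat \<Rightarrow> 'k::field grassmann \<Rightarrow> 'k grassmann" is
  "\<lambda>i f A. if i \<in> A then 0 else (-1) ^ card {j \<in> A. j < i} * f (insert i A)"
proof (intro conjI allI impI)
  fix i and f :: "nat set \<Rightarrow> 'k"
  assume f: "finite {A. f A \<noteq> 0} \<and> (\<forall>A. infinite A \<longrightarrow> f A = 0)"
  let ?h = "\<lambda>A. if i \<in> A then 0 else (-1) ^ card {j \<in> A. j < i} * f (insert i A)"
  have "{A. ?h A \<noteq> 0} \<subseteq> (\<lambda>A. A - {i}) ` {A. f A \<noteq> 0}"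
  proof
    fix A assume "A \<in> {A. ?h A \<noteq> 0}"
    then have A: "i \<notin> A" "f (insert i A) \<noteq> 0" by (simp_all split: if_split_asm)
    then show "A \<in> (\<lambda>A. A - {i}) ` {A. f A \<noteq> 0}"
      by (intro image_eqI[of _ _ "insert i A"]) simp_all
  qed
  moreover have "finite ((\<lambda>A. A - {i}) ` {A. f A \<noteq> 0})" using f by simp
  ultimately show "finite {A. ?h A \<noteq> 0}" by (rule finite_subset)
  show "?h A = 0" if "infinite A" for A using f that by simp
qed

lift_definition pd :: "nat \<Rightarrow> 'k::field endo" is pd_raw
  by (rule linear_gscaleI; transfer) (auto simp: algebra_simps)

lemma gcoeff_pd:
  "gcoeff (app (pd i) f) A =
     (if i \<in> A then 0 else (-1) ^ card {j \<in> A. j < i} * gcoeff f (insert i A))"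
  by (simp add: pd.rep_eq pd_raw.rep_eq)

lemma pd_gvar: "app (pd i) (gvar j) = (if i = j then 1 else 0 :: 'k::field grassmann)"
  by (rule grassmann_eqI) (auto simp: gcoeff_pd gvar.rep_eq one_grassmann.rep_eq)

lemma pd_op_space: "pd i \<in> op_space 1"
proof -
  have "even (card A) = even (1 + e)"
    if f: "f \<in> gr_space e" and nz: "gcoeff (app (pd i) f) A \<noteq> 0"
    for e A and f :: "'a grassmann"
  proof -
    have A: "i \<notin> A" "gcoeff f (insert i A) \<noteq> 0"
      using nz by (simp_all add: gcoeff_pd split: if_split_asm)
    then have "finite A" using gcoeff_infinite finite_insert by metis
    then have "card (insert i A) = Suc (card A)" using A by simp
    moreover have "even (card (insert i A)) = even e"
      using f A(2) unfolding gr_space_def by blast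
    ultimately show ?thesis by simp argo
  qed
  then show ?thesis unfolding op_space_def gr_space_def[of "1 + _"] by blast
qed

lemma card_less_plus_greater:
  fixes i :: nat
  assumes "finite A" "i \<notin> A"
  shows "card {j \<in> A. j < i} + card {j \<in> A. i < j} = card A"
proof -
  have "card ({j \<in> A. j < i} \<union> {j \<in> A. i < j}) = card {j \<in> A. j < i} + card {j \<in> A. i < j}"
    using assms by (intro card_Un_disjoint) auto
  moreover have "j < i \<or> i < j" if "j \<in> A" for j
    using assms that by (cases i j rule: linorder_cases) simp_all
  then have "{j \<in> A. j < i} \<union> {j \<in> A. i < j} = A" by blast
  ultimately show ?thesis by simp
qed

lemma minus_one_power_cong: "even m = even n \<Longrightarrow> (-1) ^ m = ((-1) ^ n :: 'a::ring_1)"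
  unfolding minus_one_power_iff by (rule if_cong) simp_all

lemma pd_mult:
  assumes f: "f \<in> gr_space d"
  shows "app (pd i) (f * g) = app (pd i) f * g + (-1) ^ d * f * app (pd i) g"
proof (rule grassmann_eqI)
  fix C :: "nat set" assume C: "finite C"
  let ?n = "\<lambda>A. card {j \<in> A. j < i}"
  define s :: "nat set \<Rightarrow> nat set \<Rightarrow> 'a" where "s A B = (-1) ^ inversions A B" for A B
  define F G F' G' where FG: "F = gcoeff f" "G = gcoeff g"
    "F' = gcoeff (app (pd i) f)" "G' = gcoeff (app (pd i) g)"
  have fd: "even (card A) = even d" if "F A \<noteq> 0" for A
    using f that by (auto simp: gr_space_def FG)
  have F': "F' A = (if i \<in> A then 0 else (-1) ^ ?n A * F (insert i A))" for A
    by (simp add: FG gcoeff_pd)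
  have G': "G' A = (if i \<in> A then 0 else (-1) ^ ?n A * G (insert i A))" for A
    by (simp add: FG gcoeff_pd)
  have rhs: "gcoeff (app (pd i) f * g + (-1) ^ d * f * app (pd i) g) C =
     (\<Sum>A\<in>Pow C. s A (C - A) * F' A * G (C - A)) + (\<Sum>A\<in>Pow C. (-1) ^ d * (s A (C - A) * F A * G' (C - A)))"
    by (cases "even d") (simp_all add: times_grassmann.rep_eq s_def FG sum_negf)
  have fin: "finite A" if "A \<subseteq> C" for A using C that by (rule finite_subset[rotated])
  show "gcoeff (app (pd i) (f * g)) C = gcoeff (app (pd i) f * g + (-1) ^ d * f * app (pd i) g) C"
  proof (cases "i \<in> C")
    case False
    have inj: "inj_on (insert i) (Pow C)" using False by (auto simp: inj_on_def insert_ident)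
    have "gcoeff (app (pd i) (f * g)) C =
        (-1) ^ ?n C * (\<Sum>A\<in>Pow (insert i C). s A (insert i C - A) * F A * G (insert i C - A))"
      using False by (simp add: gcoeff_pd times_grassmann.rep_eq s_def FG)
    also have "(\<Sum>A\<in>Pow (insert i C). s A (insert i C - A) * F A * G (insert i C - A)) =
        (\<Sum>A\<in>Pow C. s A (insert i C - A) * F A * G (insert i C - A)) +
        (\<Sum>A\<in>Pow C. s (insert i A) (insert i C - insert i A) * F (insert i A) * G (insert i C - insert i A))"
      using C False by (subst Pow_insert, subst sum.union_disjoint) (auto simp: sum.reindex[OF inj])
    also have "(-1) ^ ?n C * \<dots> =
       (\<Sum>A\<in>Pow C. (-1) ^ ?n C * (s (insert i A) (insert i C - insert i A) * F (insert i A) * G (insert i C - insert i A))) +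
       (\<Sum>A\<in>Pow C. (-1) ^ ?n C * (s A (insert i C - A) * F A * G (insert i C - A)))"
      by (simp add: distrib_left sum_distrib_left add.commute)
    also have "(\<Sum>A\<in>Pow C. (-1) ^ ?n C * (s (insert i A) (insert i C - insert i A) * F (insert i A) * G (insert i C - insert i A)))
       = (\<Sum>A\<in>Pow C. s A (C - A) * F' A * G (C - A))"
    proof (rule sum.cong[OF refl])
      fix A assume A: "A \<in> Pow C"
      have "insert i C - insert i A = C - A" "i \<notin> A" using A False by auto
      moreover have "?n C = ?n A + ?n (C - A)"
      proof -
        have "{j \<in> C. j < i} = {j \<in> A. j < i} \<union> {j \<in> C - A. j < i}" using A by auto
        then show ?thesis using C A fin by (simp add: card_Un_disjoint disjoint_iff)
      qed
      moreover have "inversions (insert i A) (C - A) = ?n (C - A) + inversions A (C - A)"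
        using A C fin \<open>i \<notin> A\<close> by (intro inversions_insert_left) auto
      ultimately show "(-1) ^ ?n C * (s (insert i A) (insert i C - insert i A) * F (insert i A) * G (insert i C - insert i A))
         = s A (C - A) * F' A * G (C - A)"
        by (simp add: s_def F' power_add)
    qed
    also have "(\<Sum>A\<in>Pow C. (-1) ^ ?n C * (s A (insert i C - A) * F A * G (insert i C - A)))
       = (\<Sum>A\<in>Pow C. (-1) ^ d * (s A (C - A) * F A * G' (C - A)))"
    proof (rule sum.cong[OF refl])
      fix A assume A: "A \<in> Pow C"
      have eq: "insert i C - A = insert i (C - A)" "i \<notin> A" "i \<notin> C - A" using A False by auto
      have n: "?n C = ?n A + ?n (C - A)"
      proof -
        have "{j \<in> C. j < i} = {j \<in> A. j < i} \<union> {j \<in> C - A. j < i}" using A by auto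
        then show ?thesis using C A fin by (simp add: card_Un_disjoint disjoint_iff)
      qed
      have inv: "inversions A (insert i (C - A)) = card {a \<in> A. i < a} + inversions A (C - A)"
        using A C fin eq(2,3) by (intro inversions_insert_right) auto
      show "(-1) ^ ?n C * (s A (insert i C - A) * F A * G (insert i C - A))
         = (-1) ^ d * (s A (C - A) * F A * G' (C - A))"
      proof (cases "F A = 0")
        case False
        have "?n C + inversions A (insert i (C - A)) = card A + ?n (C - A) + inversions A (C - A)"
          using card_less_plus_greater[OF fin[of A] eq(2)] A n inv by simp
        then have "(-1) ^ (?n C + inversions A (insert i (C - A))) =
            ((-1) ^ (d + inversions A (C - A) + ?n (C - A)) :: 'a)"
          using fd[OF False] by (intro minus_one_power_cong) auto
        then show ?thesis using eq
          by (simp add: s_def G' power_add mult.assoc[symmetric])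
      qed simp
    qed
    finally show ?thesis unfolding rhs .
  next
    case True
    define D where "D = C - {i}"
    have D: "C = insert i D" "i \<notin> D" "finite D" using True C by (auto simp: D_def)
    have inj: "inj_on (insert i) (Pow D)" using D by (auto simp: inj_on_def insert_ident)
    have "(\<Sum>A\<in>Pow C. s A (C - A) * F' A * G (C - A)) =
        (\<Sum>A\<in>Pow D. s A (C - A) * F' A * G (C - A))"
      using C D by (intro sum.mono_neutral_right) (auto simp: F')
    moreover have "(\<Sum>A\<in>Pow C. (-1) ^ d * (s A (C - A) * F A * G' (C - A))) =
        (\<Sum>A\<in>insert i ` Pow D. (-1) ^ d * (s A (C - A) * F A * G' (C - A)))"
      unfolding D(1) Pow_insert using D by (intro sum.mono_neutral_right) (auto simp: G')
    moreover have "\<dots> = (\<Sum>A\<in>Pow D. (-1) ^ d * (s (insert i A) (C - insert i A) * F (insert i A) * G' (C - insert i A)))"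
      by (simp add: sum.reindex[OF inj])
    moreover have "s A (C - A) * F' A * G (C - A) +
        (-1) ^ d * (s (insert i A) (C - insert i A) * F (insert i A) * G' (C - insert i A)) = 0"
      if A: "A \<in> Pow D" for A
    proof (cases "F (insert i A) = 0")
      case True
      then show ?thesis by (simp add: F')
    next
      case False
      have eq: "C - A = insert i (D - A)" "C - insert i A = D - A" "i \<notin> A" "i \<notin> D - A"
        "finite A" "finite (D - A)"
        using A D by (auto intro: finite_subset)
      have "inversions A (C - A) + ?n A = card A + inversions A (D - A)"
        unfolding eq(1) using card_less_plus_greater[OF eq(5,3)]
          inversions_insert_right[OF eq(6,5,4)] by simp
      moreover have "inversions (insert i A) (D - A) = ?n (D - A) + inversions A (D - A)"
        by (rule inversions_insert_left[OF eq(5,6,3)])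
      moreover have "even d = odd (card A)" using fd[OF False] eq(3,5) by simp
      ultimately have "(-1) ^ (d + inversions (insert i A) (D - A) + ?n (D - A)) =
          ((-1) ^ (Suc (inversions A (C - A) + ?n A)) :: 'a)"
        by (intro minus_one_power_cong) auto
      then have "(-1) ^ d * ((-1) ^ inversions (insert i A) (D - A) * (-1) ^ ?n (D - A)) =
          - ((-1) ^ inversions A (C - A) * (-1) ^ ?n A :: 'a)"
        by (simp add: power_add mult.assoc)
      then have "(-1) ^ d * ((-1) ^ inversions (insert i A) (D - A) * (-1) ^ ?n (D - A)) *
            (F (insert i A) * G (C - A)) =
          - ((-1) ^ inversions A (C - A) * (-1) ^ ?n A :: 'a) * (F (insert i A) * G (C - A))"
        by simp
      moreover have "G' (D - A) = (-1) ^ ?n (D - A) * G (C - A)"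
        by (simp only: G' eq(1,4) if_False)
      moreover have "F' A = (-1) ^ ?n A * F (insert i A)" using eq(3) by (simp add: F')
      ultimately show ?thesis unfolding s_def eq(2)
        by (simp add: mult_ac)
    qed
    ultimately show ?thesis unfolding rhs using True
      by (simp add: gcoeff_pd sum.distrib[symmetric])
  qed
qed

lemma odd_superderivation_pd: "odd_superderivation (pd i)"
  unfolding odd_superderivation_def using pd_op_space pd_mult by blast

text \<open>The nested expression for \<open>v\<^sub>i\<close>, cut off at depth \<open>N\<close>.  On any given element the
  cut-off expressions are eventually constant in \<open>N\<close> (\<open>eventually_vtrunc\<close>), and \<open>v\<^sub>i\<close> is
  their eventual value.\<close>

primrec vtrunc :: "nat \<Rightarrow> nat \<Rightarrow> 'k::field endo" where
  "vtrunc 0 i = 0"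
| "vtrunc (Suc N) i = pd i + xop i * xop (i + 1) * vtrunc N (i + 2)"

lemma vtrunc_stable:
  "(\<And>A j. gcoeff f A \<noteq> 0 \<Longrightarrow> j \<in> A \<Longrightarrow> j < i + 2 * N) \<Longrightarrow> app (vtrunc (Suc N) i) f = app (vtrunc N i) f"
proof (induction N arbitrary: i)
  case 0
  have "app (pd i) f = 0"
  proof (rule grassmann_eqI)
    fix A
    show "gcoeff (app (pd i) f) A = gcoeff 0 A"
      using 0[of "insert i A" i] by (auto simp: gcoeff_pd)
  qed
  then show ?case by simp
next
  case (Suc N)
  have "app (vtrunc (Suc N) (i + 2)) f = app (vtrunc N (i + 2)) f"
    by (rule Suc.IH) (use Suc.prems in force)
  then show ?case by (simp del: vtrunc.simps(2) add: vtrunc.simps(2)[of _ i])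
qed

lemma eventually_vtrunc: "\<exists>g. \<forall>\<^sub>F N in sequentially. app (vtrunc N i) f = g"
proof -
  have "finite (\<Union> {A. gcoeff f A \<noteq> 0})"
    using finite_gcoeff[of f] gcoeff_infinite[of _ f] by auto
  then obtain M where M: "\<And>j. j \<in> \<Union> {A. gcoeff f A \<noteq> 0} \<Longrightarrow> j < M"
    unfolding finite_nat_set_iff_bounded by blast
  have "app (vtrunc N i) f = app (vtrunc M i) f" if "N \<ge> M" for N
    using that
  proof (induction rule: dec_induct)
    case (step N)
    have "app (vtrunc (Suc N) i) f = app (vtrunc N i) f"
      by (rule vtrunc_stable) (use M step.hyps in force)
    then show ?case using step.IH by simp
  qed simp
  then show ?thesis unfolding eventually_sequentially by blast
qed

lemma the_eventually:
  assumes "\<forall>\<^sub>F N in sequentially. h N = g"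
  shows "(THE g. \<forall>\<^sub>F N in sequentially. h N = g) = g"
proof (rule the_equality)
  fix g' assume "\<forall>\<^sub>F N in sequentially. h N = g'"
  with assms have "\<forall>\<^sub>F N in sequentially. g' = g" by eventually_elim simp
  then show "g' = g" by simp
qed (fact assms)

lift_definition v :: "nat \<Rightarrow> 'k::field endo" is
  "\<lambda>i f. THE g. \<forall>\<^sub>F N in sequentially. app (vtrunc N i) f = g"
proof (rule linear_gscaleI)
  fix i c and f g :: "'k grassmann"
  obtain f' g' where f: "\<forall>\<^sub>F N in sequentially. app (vtrunc N i) f = f'"
    and g: "\<forall>\<^sub>F N in sequentially. app (vtrunc N i) g = g'"
    using eventually_vtrunc by metis
  have "\<forall>\<^sub>F N in sequentially. app (vtrunc N i) (f + g) = f' + g'"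
    using f g by eventually_elim (simp add: app_linear)
  then show "(THE h. \<forall>\<^sub>F N in sequentially. app (vtrunc N i) (f + g) = h) =
      (THE h. \<forall>\<^sub>F N in sequentially. app (vtrunc N i) f = h) +
      (THE h. \<forall>\<^sub>F N in sequentially. app (vtrunc N i) g = h)"
    using f g by (simp add: the_eventually)
  have "\<forall>\<^sub>F N in sequentially. app (vtrunc N i) (gscale c f) = gscale c f'"
    using f by eventually_elim (simp add: app_linear)
  then show "(THE h. \<forall>\<^sub>F N in sequentially. app (vtrunc N i) (gscale c f) = h) =
      gscale c (THE h. \<forall>\<^sub>F N in sequentially. app (vtrunc N i) f = h)"
    using f by (simp add: the_eventually)
qed

lemma v_eventually: "\<forall>\<^sub>F N in sequentially. app (vtrunc N i) f = app (v i) f"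
proof -
  obtain g where g: "\<forall>\<^sub>F N in sequentially. app (vtrunc N i) f = g"
    using eventually_vtrunc by metis
  then show ?thesis by (simp add: v.rep_eq the_eventually[OF g])
qed

lemma v_rec: "v i = pd i + xop i * xop (i + 1) * v (i + 2)"
proof (rule endo_eqI)
  fix f
  have "\<forall>\<^sub>F N in sequentially. app (vtrunc (Suc N) i) f = app (v i) f"
    by (subst eventually_sequentially_Suc) (rule v_eventually)
  with v_eventually[of "i + 2" f] 
  have "\<forall>\<^sub>F N in sequentially. app (v i) f = app (pd i + xop i * xop (i + 1) * v (i + 2)) f"
    by eventually_elim simp
  then show "app (v i) f = app (pd i + xop i * xop (i + 1) * v (i + 2)) f"
    by simp
qed


section \<open>The algebras generated by \<open>v\<^sub>0, v\<^sub>1\<close>\<close>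

text \<open>\<open>Bracket\<close>: the only operation is the supercommutator (Lie superalgebra for
  \<open>char K \<noteq> 2\<close>, Lie algebra for \<open>char K = 2\<close>); \<open>Bracket_Odd_Squares\<close>: also squares of odd
  elements (Lie superalgebra for \<open>char K = 2\<close>); \<open>Bracket_Squares\<close>: also squares of all
  elements (restricted Lie (super)algebra for \<open>char K = 2\<close>).\<close>

datatype alg_type = Bracket | Bracket_Odd_Squares | Bracket_Squares

definition squarable :: "alg_type \<Rightarrow> 'k::field endo \<Rightarrow> bool" where
  "squarable t a = (case t of
     Bracket \<Rightarrow> False
   | Bracket_Odd_Squares \<Rightarrow> a \<in> op_space 1
   | Bracket_Squares \<Rightarrow> True)"

definition graded_subspace :: "'k::field endo set \<Rightarrow> bool" where
  "graded_subspace S \<longleftrightarrow> endo.subspace S \<and> (\<forall>a\<in>S. \<forall>d. op_part d a \<in> S)"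

definition closed_under :: "alg_type \<Rightarrow> 'k::field endo set \<Rightarrow> bool" where
  "closed_under t S \<longleftrightarrow> (\<forall>a\<in>S. \<forall>b\<in>S. scomm a b \<in> S) \<and> (\<forall>a\<in>S. squarable t a \<longrightarrow> a\<^sup>2 \<in> S)"

definition generated :: "alg_type \<Rightarrow> 'k::field endo set" where
  "generated t = \<Inter>{S. graded_subspace S \<and> v 0 \<in> S \<and> v 1 \<in> S \<and> closed_under t S}"

inductive monomial :: "alg_type \<Rightarrow> nat \<Rightarrow> 'k::field endo \<Rightarrow> bool" for t where
  "monomial t 1 (v 0)"
| "monomial t 1 (v 1)"
| "monomial t m a \<Longrightarrow> monomial t n b \<Longrightarrow> monomial t (m + n) (scomm a b)"
| "monomial t m a \<Longrightarrow> squarable t a \<Longrightarrow> monomial t (2 * m) (a\<^sup>2)"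

definition component :: "alg_type \<Rightarrow> nat \<Rightarrow> 'k::field endo set" where
  "component t n = endo.span {a. monomial t n a}"

text \<open>The term \<open>L\<^sup>n\<close> of the lower central series, \<open>n \<ge> 1\<close>; note \<open>\<lceil>n/2\<rceil> = (n + 1) div 2\<close>.
  The value at \<open>n = 0\<close> is irrelevant.\<close>

function lower_central :: "alg_type \<Rightarrow> nat \<Rightarrow> 'k::field endo set" where
  "lower_central t n = (if n \<le> 1 then generated t else
     endo.span
      ({scomm a b | a b. a \<in> generated t \<and> b \<in> lower_central t (n - 1)} \<union>
       (if t = Bracket then {}
        else {a\<^sup>2 | a. a \<in> lower_central t ((n + 1) div 2) \<and> a \<in> op_space 1}) \<union>
       (if t = Bracket_Squares
        then {a\<^sup>2 | a. a \<in> lower_central t ((n + 1) div 2) \<and> a \<in> op_space 0} else {})))"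
  by pat_completeness auto
termination by (relation "measure snd") auto

declare lower_central.simps [simp del]


section \<open>Gradations, width and dimensions of quotients\<close>

text \<open>\<open>L = \<Oplus>\<^bsub>n \<ge> 1\<^esub> L\<^sub>n\<close> as vector spaces, and the operations respect the degree.\<close>

definition gradation :: "alg_type \<Rightarrow> 'k::field endo set \<Rightarrow> (nat \<Rightarrow> 'k endo set) \<Rightarrow> bool" where
  "gradation t L Ln \<longleftrightarrow>
     (\<forall>n\<ge>1. endo.subspace (Ln n)) \<and>
     L = endo.span (\<Union>n\<in>{1..}. Ln n) \<and>
     (\<forall>n\<ge>1. Ln n \<inter> endo.span (\<Union>m\<in>{1..} - {n}. Ln m) = {0}) \<and>
     (\<forall>m\<ge>1. \<forall>n\<ge>1. \<forall>a\<in>Ln m. \<forall>b\<in>Ln n. scomm a b \<in> Ln (m + n)) \<and>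
     (\<forall>m\<ge>1. \<forall>a\<in>Ln m. squarable t a \<longrightarrow> a\<^sup>2 \<in> Ln (2 * m))"

text \<open>\<^const>\<open>endo.dim\<close> is \<open>0\<close> on infinite-dimensional spaces, so finite dimension is
  required separately.\<close>

definition width_at_most :: "nat \<Rightarrow> (nat \<Rightarrow> 'k::field endo set) \<Rightarrow> bool" where
  "width_at_most d Ln \<longleftrightarrow>
     (\<forall>n\<ge>1. (\<exists>B. finite B \<and> Ln n \<subseteq> endo.span B) \<and> endo.dim (Ln n) \<le> d)"

definition of_width :: "nat \<Rightarrow> (nat \<Rightarrow> 'k::field endo set) \<Rightarrow> bool" where
  "of_width d Ln \<longleftrightarrow> width_at_most d Ln \<and> (\<forall>d'. width_at_most d' Ln \<longrightarrow> d \<le> d')"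

text \<open>\<open>B\<close> consists of representatives of a basis of \<open>U / W\<close>, one for each basis vector.
  In particular \<open>W \<subseteq> U\<close>.\<close>

definition quotient_basis :: "'k::field endo set \<Rightarrow> 'k endo set \<Rightarrow> 'k endo set \<Rightarrow> bool" where
  "quotient_basis U W B \<longleftrightarrow>
     \<not> endo.dependent B \<and> endo.span B \<inter> W = {0} \<and> endo.span (B \<union> W) = U"

text \<open>As for \<^const>\<open>endo.dim\<close>, the value is \<open>0\<close> if the quotient has infinite dimension.\<close>

definition quotient_dim :: "'k::field endo set \<Rightarrow> 'k endo set \<Rightarrow> nat" where
  "quotient_dim U W =
     (if \<exists>B. quotient_basis U W B then card (SOME B. quotient_basis U W B) else 0)"

end

theory Submission
  imports Defs
begin

text \<open>Write \<open>x\<^sub>T\<close> for the ordered product of the \<open>x\<^sub>i\<close>, \<open>i \<in> T\<close>.  The supercommutators of \<open>v\<^sub>0\<close> and \<open>v\<^sub>1\<close>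
  with a monomial \<open>x\<^sub>T v\<^sub>m\<close>, \<open>T \<subseteq> {0, \<dots>, m - 1}\<close>, are again monomials up to a factor \<open>0, \<plusminus>1, \<plusminus>2\<close>:
  \<open>v\<^sub>0\<close> acts like a counter, deleting \<open>k = min T\<close> and inserting \<open>0, \<dots>, k - 1\<close> if \<open>k\<close> is even and
  vanishing if \<open>k\<close> is odd, while \<open>T = {}\<close> carries over into a monomial with \<open>v\<^bsub>m+1\<^esub>\<close> or \<open>v\<^bsub>m+2\<^esub>\<close>; similarly for
  \<open>v\<^sub>1\<close> with odd \<open>k\<close>.  Hence the algebra has a basis of such monomials.  Giving
  \<open>v\<^sub>m\<close> the Jacobsthal number \<open>a\<^sub>m\<close> (\<open>a\<^sub>0 = a\<^sub>1 = 1\<close>, \<open>a\<^bsub>m+2\<^esub> = a\<^bsub>m+1\<^esub> + 2 a\<^sub>m\<close>) as degree and \<open>x\<^sub>i\<close> the degree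
  \<open>- a\<^sub>i\<close>, the dimensions of the components count subsets of \<open>{0, \<dots>, m - 1}\<close> with prescribed
  Jacobsthal sum.  Every number between \<open>0\<close> and the maximal sum is represented once or twice, and
  the degree ranges belonging to different \<open>m\<close> overlap in at most two degrees.\<close>

section \<open>Operators on the Grassmann algebra\<close>

text \<open>The recursion for a_m is forced by v_m = pd_m + x_m x_{m+1} v_{m+2}: if pd_m has degree
  a_m and x_m degree - a_m, it says that both summands have the same degree. Brackets of two
  arbitrary monomials are never computed. It is enough that, for n at least 1, ad v_0 and ad v_1
  together send the basis monomials of degree n to a spanning set of degree n + 1. Closure under all
  brackets then follows by induction with the super Jacobi identity, and the same spanning property
  identifies the components and the lower central series. The gap x_0 x_2 v_3 is unavoidable: it has
  degree 1, where only v_0 and v_1 live. Squares add little: a monomial with T nonempty squares to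
  zero, so only the v_p^2 are new, and ad(v_p^2) = (ad v_p)^2. Since every v_p is odd, squares of
  even elements give nothing beyond the squares of odd ones.\<close>

lemma gcoeff_gvar_mult:
  assumes "finite C"
  shows "gcoeff (gvar i * f) C =
    (if i \<in> C then (-1) ^ card {b \<in> C. b < i} * gcoeff f (C - {i}) else 0)"
proof -
  have "gcoeff (gvar i * f) C =
      (\<Sum>A\<in>Pow C. if A = {i} then (-1) ^ inversions {i} (C - {i}) * gcoeff f (C - {i}) else 0)"
    unfolding times_grassmann.rep_eq gvar.rep_eq by (intro sum.cong) auto
  also have "\<dots> = (if i \<in> C then (-1) ^ inversions {i} (C - {i}) * gcoeff f (C - {i}) else 0)"
    using assms by (subst sum.delta) auto
  also have "inversions {i} (C - {i}) = card {b \<in> C. b < i}"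
    unfolding inversions_singleton_left by (rule arg_cong[of _ _ card]) auto
  finally show ?thesis .
qed

lemma xop_sq: "xop i * xop i = 0"
proof (rule endo_eqI)
  fix f :: "'a grassmann"
  have "gvar i * gvar i = (0 :: 'a grassmann)"
    by (rule grassmann_eqI) (auto simp: gcoeff_gvar_mult gvar.rep_eq)
  then show "app (xop i * xop i) f = app 0 f"
    by (simp add: mult.assoc[symmetric])
qed

lemma xop_anticommute: "xop i * xop j = - (xop j * xop i)" if "i \<noteq> j"
proof (rule endo_eqI)
  fix f :: "'a grassmann"
  show "app (xop i * xop j) f = app (- (xop j * xop i)) f"
    using gvar_anticommute[OF that, where ?'k = 'a] by (simp add: mult.assoc[symmetric])
qed

lemma gvar_gr_space: "gvar i \<in> gr_space 1"
  by (auto simp: gr_space_def gvar.rep_eq)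

lemma pd_xop: "pd i * xop j = (if i = j then 1 else 0) - xop j * pd i"
  by (rule endo_eqI) (simp add: pd_mult[OF gvar_gr_space] pd_gvar)

lemma pd_anticommute: "pd i * pd j = - (pd j * pd i)" if "i < j"
proof (rule endo_eqI, rule grassmann_eqI)
  fix f :: "'a grassmann" and A :: "nat set"
  assume A: "finite A"
  have "{k \<in> insert i A. k < j} = insert i {k \<in> A. k < j}"
    "{k \<in> insert j A. k < i} = {k \<in> A. k < i}"
    using that by auto
  then show "gcoeff (app (pd i * pd j) f) A = gcoeff (app (- (pd j * pd i)) f) A"
    using A that by (auto simp: gcoeff_pd insert_commute card_insert_if)
qed

text \<open>On a fixed element one depth \<open>N\<close> serves both \<open>f\<close> and
  \<open>app e f\<close>, so identities of truncations pass to the limit. The factors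
  \<open>d\<close> and \<open>e\<close> make room for anticommutation, with
  \<open>d = - 1\<close>.\<close>

lemma v_eqI:
  assumes "\<And>N. c * vtrunc N i = d * vtrunc N i * e"
    shows "c * v i = d * v i * e"
proof (rule endo_eqI)
  fix f
  obtain N where "app (vtrunc N i) f = app (v i) f" "app (vtrunc N i) (app e f) = app (v i) (app e f)"
    using eventually_conj[OF v_eventually[of i f] v_eventually[of i "app e f"]]
    by (auto simp: eventually_sequentially)
  then show "app (c * v i) f = app (d * v i * e) f"
    using arg_cong[OF assms[of N], of "\<lambda>T. app T f"] by simp
qed

lemma anticommute_triple:
  fixes a b c z :: "'a::ring_1"
  assumes "z * a = - (a * z)" "z * b = - (b * z)" "z * c = - (c * z)"
  shows "z * (a * b * c) = - (a * b * c * z)"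
proof -
  have "z * (a * b * c) = (z * a) * b * c" by (simp only: mult.assoc)
  also have "\<dots> = - (a * (z * b) * c)" by (simp add: assms(1) mult.assoc)
  also have "\<dots> = a * b * (z * c)" by (simp add: assms(2) mult.assoc)
  also have "\<dots> = - (a * b * c * z)" by (simp add: assms(3) mult.assoc)
  finally show ?thesis .
qed

text \<open>All letters and derivatives in \<open>vtrunc N i\<close> have index at least
  \<open>i\<close>, and every summand has an odd number of odd factors, so moving x_j across costs
  one sign.\<close>

lemma vtrunc_xop: "j < i \<Longrightarrow> xop j * vtrunc N i = - 1 * vtrunc N i * (xop j :: 'k::field endo)"
proof (induction N arbitrary: i)
  case (Suc N)
  have "xop j * vtrunc N (i + 2) = - (vtrunc N (i + 2) * (xop j :: 'k endo))"
    using Suc.IH[of "i + 2"] Suc.prems by simp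
  then have "xop j * (xop i * xop (i + 1) * vtrunc N (i + 2)) =
      - (xop i * xop (i + 1) * vtrunc N (i + 2) * (xop j :: 'k endo))"
    using Suc.prems by (intro anticommute_triple) (simp_all add: xop_anticommute[of j])
  moreover have "xop j * pd i = - (pd i * (xop j :: 'k endo))"
    using Suc.prems by (simp add: pd_xop)
  ultimately show ?case
    by (simp add: distrib_left distrib_right left_diff_distrib)
qed simp

lemma vtrunc_pd: "j < i \<Longrightarrow> pd j * vtrunc N i = - 1 * vtrunc N i * (pd j :: 'k::field endo)"
proof (induction N arbitrary: i)
  case (Suc N)
  have "pd j * vtrunc N (i + 2) = - (vtrunc N (i + 2) * (pd j :: 'k endo))"
    using Suc.IH[of "i + 2"] Suc.prems by simp
  then have "pd j * (xop i * xop (i + 1) * vtrunc N (i + 2)) =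
      - (xop i * xop (i + 1) * vtrunc N (i + 2) * (pd j :: 'k endo))"
    using Suc.prems by (intro anticommute_triple) (simp_all add: pd_xop)
  moreover have "pd j * pd i = - (pd i * (pd j :: 'k endo))"
    using Suc.prems by (simp add: pd_anticommute[of j])
  ultimately show ?case
    by (simp add: distrib_left distrib_right left_diff_distrib)
qed simp

lemma v_xop: "j < i \<Longrightarrow> xop j * v i = - (v i * xop j)"
  using v_eqI[OF vtrunc_xop, of j i] by simp

lemma v_pd: "j < i \<Longrightarrow> pd j * v i = - (v i * pd j)"
  using v_eqI[OF vtrunc_pd, of j i] by simp

section \<open>Parity of the operators\<close>

lemma op_space_cong': "a \<in> op_space d \<Longrightarrow> even d = even e \<Longrightarrow> a \<in> op_space e"
  using op_space_cong by blast

lemma subspace_op_space: "endo.subspace (op_space d)"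
proof (rule endo.subspaceI)
  show "0 \<in> op_space d" by (simp add: op_space_def)
  show "x + y \<in> op_space d" if "x \<in> op_space d" "y \<in> op_space d" for x y
    using that by (auto simp: op_space_def intro: gr_space_add)
  show "endo_scale c x \<in> op_space d" if "x \<in> op_space d" for c x
    using that by (fastforce simp: op_space_def gr_space_def)
qed

lemma op_space_mult: "a \<in> op_space d \<Longrightarrow> b \<in> op_space e \<Longrightarrow> a * b \<in> op_space (d + e)"
  by (auto simp: op_space_def add.assoc)

lemma xop_op_space: "xop i \<in> op_space 1"
proof -
  have "gvar i * f \<in> gr_space (1 + e)" if f: "f \<in> gr_space e" for e and f :: "'a grassmann"
    unfolding gr_space_def
  proof (intro CollectI allI impI)
    fix A assume nz: "gcoeff (gvar i * f) A \<noteq> 0"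
    then have fin: "finite A" using gcoeff_infinite by blast
    then have "i \<in> A" "gcoeff f (A - {i}) \<noteq> 0"
      using nz by (simp_all add: gcoeff_gvar_mult split: if_split_asm)
    moreover have "even (card (A - {i})) = even e"
      using f calculation(2) unfolding gr_space_def by blast
    ultimately show "even (card A) = even (1 + e)"
      using fin card_Suc_Diff1[of A i] by (metis even_Suc plus_1_eq_Suc)
  qed
  then show ?thesis by (auto simp: op_space_def)
qed

lemma vtrunc_op_space: "vtrunc N i \<in> (op_space 1 :: 'k::field endo set)"
proof (induction N arbitrary: i)
  case 0
  show ?case by (simp add: op_space_def)
next
  case (Suc N)
  have "xop i * xop (i + 1) * vtrunc N (i + 2) \<in> (op_space (1 + 1 + 1) :: 'k endo set)"
    by (intro op_space_mult xop_op_space Suc.IH)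
  then have "xop i * xop (i + 1) * vtrunc N (i + 2) \<in> (op_space 1 :: 'k endo set)"
    by (rule op_space_cong') simp
  then show ?case
    by (simp add: endo.subspace_add[OF subspace_op_space] pd_op_space[simplified])
qed

lemma v_op_space: "v i \<in> op_space 1"
  unfolding op_space_def
proof (intro CollectI allI ballI)
  fix e and f :: "'a grassmann"
  assume f: "f \<in> gr_space e"
  obtain N where "app (vtrunc N i) f = app (v i) f"
    using v_eventually[of i f] by (auto simp: eventually_sequentially)
  moreover have "app (vtrunc N i) f \<in> gr_space (1 + e)"
    using vtrunc_op_space[of N i] f unfolding op_space_def by blast
  ultimately show "app (v i) f \<in> gr_space (1 + e)"
    by simp
qed

text \<open>Each summand of v_i acts first by a derivative pd_k with k at least i, so among x_0,
  ..., x_i only x_i survives. This triangularity later gives linear independence.\<close>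

lemma v_gvar: "j \<le> i \<Longrightarrow> app (v i) (gvar j) = (if i = j then 1 else 0 :: 'k::field grassmann)"
proof -
  assume j: "j \<le> i"
  have "app (v k) (gvar j) = (0 :: 'k grassmann)" if "j < k" for k
  proof -
    have "app (vtrunc N k) (gvar j) = (0 :: 'k grassmann)" for N
      using that by (induction N arbitrary: k) (simp_all add: pd_gvar)
    then show ?thesis
      using v_eventually[of k "gvar j :: 'k grassmann"] by simp
  qed
  then show ?thesis
    using j by (subst v_rec) (simp add: pd_gvar)
qed

section \<open>Supercommutators of pivot elements with monomials\<close>

definition xmon :: "nat set \<Rightarrow> 'k::field endo" where
  "xmon T = prod_list (map xop (sorted_list_of_set T))"

definition mon :: "nat set \<Rightarrow> nat \<Rightarrow> 'k::field endo" where
  "mon T n = xmon T * v n"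

lemma xmon_empty [simp]: "xmon {} = 1"
  by (simp add: xmon_def)

lemma xmon_insert:
  assumes "finite T" "\<And>j. j \<in> T \<Longrightarrow> i < j"
  shows "xmon (insert i T) = xop i * xmon T"
proof -
  have "T - {i} = T" using assms(2) by blast
  moreover have "insort i (sorted_list_of_set T) = i # sorted_list_of_set T"
    by (rule insort_is_Cons) (use assms in \<open>auto intro: less_imp_le\<close>)
  ultimately show ?thesis
    using assms(1) by (simp add: xmon_def sorted_list_of_set_insert_remove)
qed

lemma mon_empty [simp]: "mon {} n = v n"
  by (simp add: mon_def)

lemma mon_insert:
  "finite T \<Longrightarrow> (\<And>j. j \<in> T \<Longrightarrow> i < j) \<Longrightarrow> mon (insert i T) n = xop i * mon T n"
  by (simp add: mon_def xmon_insert mult.assoc)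

lemma mon_insert_Suc:
  assumes "finite T" "\<And>j. j \<in> T \<Longrightarrow> i + 2 \<le> j"
  shows "mon (insert i (insert (i + 1) T)) n = xop i * xop (i + 1) * mon T n"
proof -
  have "mon (insert i (insert (i + 1) T)) n = xop i * mon (insert (i + 1) T) n"
    by (rule mon_insert) (use assms(1) in simp, use assms(2) in fastforce)
  also have "mon (insert (i + 1) T) n = xop (i + 1) * mon T n"
    by (rule mon_insert) (use assms(1) in simp, use assms(2) in fastforce)
  finally show ?thesis by (simp only: mult.assoc)
qed

lemma mon_op_space: "finite T \<Longrightarrow> mon T n \<in> (op_space (Suc (card T)) :: 'k::field endo set)"
proof (induction T rule: finite_linorder_min_induct)
  case (insert i T)
  have "xop i * mon T n \<in> (op_space (1 + Suc (card T)) :: 'k endo set)"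
    by (rule op_space_mult[OF xop_op_space insert.IH])
  moreover have "i \<notin> T" using insert.hyps(2) by blast
  ultimately show ?case using insert.hyps by (simp add: mon_insert)
qed (simp add: v_op_space[simplified])

text \<open>The operator \<open>c\<close> passes the \<open>card T\<close> letters and then v_n,
  each at the cost of one sign.\<close>

lemma mon_supercommute:
  fixes c :: "'k::field endo"
  assumes "finite T" "\<And>j. j \<in> T \<Longrightarrow> c * xop j = - (xop j * c)" "c * v n = - (v n * c)"
  shows "c * mon T n = (-1) ^ Suc (card T) * (mon T n * c)"
  using assms(1,2)
proof (induction T rule: finite_linorder_min_induct)
  case (insert i T)
  have "i \<notin> T" using insert.hyps(2) by blast
  have "c * (xop i * mon T n) = - (xop i * (c * mon T n))"
    using insert.prems[of i] by (simp add: mult.assoc[symmetric])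
  also have "c * mon T n = (-1) ^ Suc (card T) * (mon T n * c)"
    by (rule insert.IH) (simp add: insert.prems)
  finally have "c * (xop i * mon T n) = (-1) ^ Suc (Suc (card T)) * (xop i * mon T n * c)"
    by (cases "even (card T)") (simp_all add: mult.assoc)
  then show ?case using insert.hyps \<open>i \<notin> T\<close> by (simp add: mon_insert)
qed (use assms(3) in simp)

lemma xop_mon:
  assumes "finite T" "i \<notin> T" "i < n"
  shows "xop i * mon T n = (-1) ^ Suc (card T) * (mon T n * xop i)"
proof (rule mon_supercommute)
  show "xop i * xop j = - (xop j * xop i)" if "j \<in> T" for j
    using assms that by (intro xop_anticommute) blast
qed (use assms v_xop in auto)

lemma pd_mon:
  assumes "finite T" "i \<notin> T" "i < n"
  shows "pd i * mon T n = (-1) ^ Suc (card T) * (mon T n * pd i)"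
proof (rule mon_supercommute)
  show "pd i * xop j = - (xop j * pd i)" if "j \<in> T" for j
    using assms that by (auto simp: pd_xop)
qed (use assms v_pd in auto)

section \<open>Three ring identities behind the counter\<close>

lemma scomm_v_mon:
  "finite T \<Longrightarrow> scomm (v i) (mon T n) = v i * mon T n - (-1) ^ Suc (card T) * (mon T n * v i)"
  by (subst scomm_hom[OF v_op_space mon_op_space]) simp_all

text \<open>In this and the next two identities \<open>x\<close>, \<open>x'\<close>,
  \<open>d\<close>, \<open>v\<close>, \<open>w\<close> model x_i, x_{i+1}, pd_i, v_i, v_{i+2};
  \<open>y\<close> models a monomial and \<open>s\<close> a commutation sign. Here x^2 = 0 removes
  the \<open>w\<close> summand from both \<open>v * x\<close> and \<open>x * v\<close>, so only the
  Clifford relation between \<open>d\<close> and \<open>x\<close> matters.\<close>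

lemma supercommutator_delete:
  fixes x x' d v w y s :: "'a::ring_1"
  assumes s: "s = 1 \<or> s = - 1" and v: "v = d + x * x' * w" and x: "x * x = 0"
    and "x' * x = - (x * x')" "w * x = - (x * w)" "d * x = 1 - x * d"
    and d: "d * y = s * (y * d)" and y: "x * y = s * (y * x)"
  shows "v * (x * y) + s * (x * y * v) = y"
proof -
  have "x * x' * w * x = - (x * (x' * x) * w)"
    using assms(5) by (simp add: mult.assoc)
  also have "\<dots> = x * x * x' * w"
    using assms(4) by (simp add: mult.assoc)
  finally have vx: "v * x = 1 - x * d"
    using assms(6) x by (simp add: v distrib_right)
  have xv: "x * v = x * d"
    using x by (simp add: v distrib_left mult.assoc[symmetric])
  have "s * (x * y * v) = y * (x * v)"
    using s y by (auto simp: mult.assoc)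
  also have "\<dots> = s * (x * y * d)"
    using s y by (auto simp: xv mult.assoc[symmetric])
  also have "\<dots> = x * d * y"
    using s d by (auto simp: mult.assoc)
  finally have "s * (x * y * v) = x * d * y" .
  moreover have "v * (x * y) = y - x * d * y"
    by (simp add: mult.assoc[symmetric] vx left_diff_distrib)
  ultimately show ?thesis by simp
qed

text \<open>The summand \<open>d\<close> supercommutes with \<open>y\<close>, and the even factor
  \<open>x * x'\<close> commutes with it, so only the bracket of \<open>w\<close> with
  \<open>y\<close> is left.\<close>

lemma supercommutator_skip:
  fixes x x' d v w y s :: "'a::ring_1"
  assumes s: "s = 1 \<or> s = - 1" and v: "v = d + x * x' * w"
    and d: "d * y = s * (y * d)" and y: "x * y = s * (y * x)" "x' * y = s * (y * x')"
  shows "v * y - s * (y * v) = x * x' * (w * y - s * (y * w))"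
proof -
  have "y * (x * x' * w) = s * (x * y * x' * w)"
    using s y(1) by (auto simp: mult.assoc[symmetric])
  also have "\<dots> = x * x' * y * w"
    using s y(2) by (auto simp: mult.assoc)
  finally have "y * (x * x' * w) = x * x' * y * w" .
  then show ?thesis
    using s d by (auto simp: v distrib_left distrib_right right_diff_distrib mult.assoc)
qed

text \<open>The monomial already contains \<open>x'\<close>, so the summand
  \<open>x * x' * w\<close> dies by x'^2 = 0 on either side, while \<open>d\<close> supercommutes
  with the whole monomial.\<close>

lemma supercommutator_zero:
  fixes x x' d v w y s :: "'a::ring_1"
  assumes s: "s = 1 \<or> s = - 1" and v: "v = d + x * x' * w" and x': "x' * x' = 0"
    and w: "x' * w = - (w * x')"
    and d: "d * (x' * y) = s * (x' * y * d)" and y: "x * (x' * y) = s * (x' * y * x)"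
    and y': "x' * y = - s * (y * x')"
  shows "v * (x' * y) - s * (x' * y * v) = 0"
proof -
  have w': "w * x' = - (x' * w)" using w by simp
  have "x * x' * w * (x' * y) = - (x * (x' * x') * w * y)"
    by (simp add: mult.assoc) (simp add: w' mult.assoc[symmetric])
  then have 1: "x * x' * w * (x' * y) = 0" by (simp add: x')
  have "y * x' = - s * (x' * y)"
    using s y' by auto
  then have 3: "x' * y * x' = 0"
    using x' by (simp add: mult.assoc[of x' y x']) (metis mult.assoc mult_minus_left mult_minus_right
        mult_zero_left s mult_1_left neg_0_equal_iff_equal)
  have "x' * y * (x * x' * w) = s * (x * (x' * y * x') * w)"
    using s y by (auto simp: mult.assoc[symmetric])
  then have 2: "x' * y * (x * x' * w) = 0" by (simp add: 3)
  show ?thesis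
    using d 1 2 by (simp add: v distrib_left distrib_right)
qed

lemma sign_cases: "(-1) ^ k = (1::'a::ring_1) \<or> (-1) ^ k = (- 1 :: 'a)"
  by (cases "even k") simp_all

lemma scomm_v_mon_delete:
  assumes T: "finite T" "\<And>j. j \<in> T \<Longrightarrow> i < j" and n: "i < n"
  shows "scomm (v i) (mon (insert i T) n) = (mon T n :: 'k::field endo)"
proof -
  have i: "i \<notin> T" using T(2) by blast
  let ?s = "(-1) ^ Suc (card T) :: 'k endo"
  have "v i * (xop i * mon T n) + ?s * (xop i * mon T n * v i) = mon T n"
  proof (rule supercommutator_delete[OF sign_cases v_rec xop_sq])
    show "xop (i + 1) * xop i = - (xop i * xop (i + 1) :: 'k endo)"
      by (rule xop_anticommute) simp
    show "v (i + 2) * xop i = - (xop i * v (i + 2) :: 'k endo)"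
      using v_xop[of i "i + 2", where ?'a = 'k] by (simp only: minus_minus)
    show "pd i * xop i = (1 - xop i * pd i :: 'k endo)"
      by (simp add: pd_xop)
  qed (use pd_mon xop_mon T(1) i n in blast)+
  moreover have "scomm (v i) (mon (insert i T) n) =
      v i * mon (insert i T) n - (-1) ^ Suc (Suc (card T)) * (mon (insert i T) n * v i :: 'k endo)"
    using T(1) i scomm_v_mon[of "insert i T" i n] by simp
  ultimately show ?thesis
    using mon_insert[OF T, where ?'a = 'k] by simp
qed

lemma scomm_v_mon_skip:
  assumes T: "finite T" "\<And>j. j \<in> T \<Longrightarrow> i + 2 \<le> j" and n: "i + 2 \<le> n"
  shows "scomm (v i) (mon T n) = xop i * xop (i + 1) * scomm (v (i + 2)) (mon T n :: 'k::field endo)"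
proof -
  have "i \<notin> T" "i + 1 \<notin> T" using T(2)[of i] T(2)[of "i + 1"] by auto
  then show ?thesis
    unfolding scomm_v_mon[OF T(1)] using T n
    by (intro supercommutator_skip[OF sign_cases v_rec] pd_mon xop_mon) auto
qed

lemma scomm_v_mon_zero:
  assumes T: "finite T" "\<And>j. j \<in> T \<Longrightarrow> i + 2 \<le> j" and n: "i + 2 \<le> n"
  shows "scomm (v i) (mon (insert (i + 1) T) n) = (0 :: 'k::field endo)"
proof -
  have i: "i \<notin> insert (i + 1) T" "i + 1 \<notin> T" using T(2)[of i] T(2)[of "i + 1"] by auto
  have fin: "finite (insert (i + 1) T)" using T by simp
  have mon: "mon (insert (i + 1) T) n = (xop (i + 1) * mon T n :: 'k endo)"
    using T by (intro mon_insert) force+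
  have card: "card (insert (i + 1) T) = Suc (card T)"
    using T i by simp
  have in': "i < n" using n by simp
  show ?thesis
    unfolding scomm_v_mon[OF fin] unfolding mon card
  proof (rule supercommutator_zero[OF sign_cases v_rec xop_sq])
    show "xop (i + 1) * v (i + 2) = - (v (i + 2) * xop (i + 1) :: 'k endo)"
      by (rule v_xop) simp
    show "pd i * (xop (i + 1) * mon T n) = (-1) ^ Suc (Suc (card T)) * (xop (i + 1) * mon T n * pd i :: 'k endo)"
      using pd_mon[OF fin i(1) in', where ?'a = 'k] by (simp only: mon card)
    show "xop i * (xop (i + 1) * mon T n) = (-1) ^ Suc (Suc (card T)) * (xop (i + 1) * mon T n * xop i :: 'k endo)"
      using xop_mon[OF fin i(1) in', where ?'a = 'k] by (simp only: mon card)
    show "xop (i + 1) * mon T n = - ((-1) ^ Suc (Suc (card T))) * (mon T n * xop (i + 1) :: 'k endo)"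
      using xop_mon[OF T(1) i(2), of n] n by simp
  qed
qed

lemma pd_sq: "pd i * pd i = 0"
  by (rule endo_eqI, rule grassmann_eqI) (simp add: gcoeff_pd)

text \<open>In the square of pd_n + x_n x_{n+1} v_{n+2} both pure terms vanish, the second because
  x_n occurs twice. The mixed terms cancel except where pd_n hits x_n.\<close>

lemma v_sq: "v n * v n = xop (n + 1) * (v (n + 2) :: 'k::field endo)"
proof -
  let ?x = "xop n :: 'k endo" and ?x' = "xop (n + 1) :: 'k endo"
    and ?w = "v (n + 2) :: 'k endo" and ?d = "pd n :: 'k endo"
  have dw: "?d * ?w = - (?w * ?d)" and xw: "?x * ?w = - (?w * ?x)"
    by (simp_all add: v_pd v_xop)
  have "?d * (?x * ?x' * ?w) = ?d * ?x * ?x' * ?w" by (simp add: mult.assoc)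
  also have "\<dots> = ?x' * ?w - ?x * (?d * ?x') * ?w"
    by (simp add: pd_xop[of n n] left_diff_distrib mult.assoc)
  also have "\<dots> = ?x' * ?w + ?x * ?x' * (?d * ?w)"
    by (simp add: pd_xop[of n "Suc n"] mult.assoc)
  also have "\<dots> = ?x' * ?w - ?x * ?x' * ?w * ?d"
    by (simp only: dw) (simp add: mult.assoc)
  finally have 1: "?d * (?x * ?x' * ?w) = ?x' * ?w - ?x * ?x' * ?w * ?d" .
  have "?w * ?x = - (?x * ?w)" using xw by (simp only: minus_minus)
  then have "?x * ?x' * ?w * (?x * ?x' * ?w) = - (?x * (?x' * ?x) * ?w * ?x' * ?w)"
    by (simp only: mult.assoc) (simp add: mult.assoc[symmetric])
  also have "?x' * ?x = - (?x * ?x')" by (rule xop_anticommute) simp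
  also have "- (?x * - (?x * ?x') * ?w * ?x' * ?w) = 0"
    by (simp add: mult.assoc[symmetric] xop_sq)
  finally have 2: "?x * ?x' * ?w * (?x * ?x' * ?w) = 0" .
  have "v n * v n = ?d * ?d + ?d * (?x * ?x' * ?w) + ?x * ?x' * ?w * ?d + ?x * ?x' * ?w * (?x * ?x' * ?w)"
    by (subst (1 2) v_rec) (simp only: distrib_left distrib_right add_ac)
  then show ?thesis by (simp only: 1 2 pd_sq) simp
qed

lemma scomm_v_self: "scomm (v n) (v n) = 2 * (xop (n + 1) * (v (n + 2) :: 'k::field endo))"
proof -
  have "scomm (v n) (v n) = v n * v n + v n * (v n :: 'k endo)"
    using scomm_hom[OF v_op_space v_op_space] by simp
  then show ?thesis by (simp only: v_sq mult_2)
qed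

text \<open>The only surviving contribution is the derivative pd_{i+1} inside v_{i+1} hitting the
  letter x_{i+1} inside v_i.\<close>

lemma scomm_v_Suc: "scomm (v i) (v (i + 1)) = - (xop i * (v (i + 2) :: 'k::field endo))"
proof -
  let ?x = "xop i :: 'k endo" and ?x' = "xop (i + 1) :: 'k endo" and ?u = "v (i + 1) :: 'k endo"
    and ?w = "v (i + 2) :: 'k endo" and ?d = "pd i :: 'k endo" and ?d' = "pd (i + 1) :: 'k endo"
    and ?z = "xop (i + 2) * v (i + 3) :: 'k endo"
  have u: "?u = ?d' + ?x' * ?z"
    by (subst v_rec) (simp add: mult.assoc numeral_eq_Suc)
  have du: "?d * ?u = - (?u * ?d)" and xu: "?u * ?x = - (?x * ?u)"
    using v_xop[of i "i + 1", where ?'a = 'k] by (simp_all add: v_pd)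
  have x'w: "?x' * ?w = - (?w * ?x')" and d'w: "?d' * ?w = - (?w * ?d')"
    by (simp_all add: v_pd v_xop)
  have "?x' * ?z * ?x' = ?x' * ?x' * ?z"
  proof -
    have "?z * ?x' = ?x' * ?z"
    proof -
      have "?x' * v (i + 3) = - (v (i + 3) * ?x')" by (rule v_xop) simp
      then have "v (i + 3) * ?x' = - (?x' * v (i + 3))" by (simp only: minus_minus)
      then have "?z * ?x' = - (xop (i + 2) * ?x') * v (i + 3)" by (simp add: mult.assoc)
      also have "xop (i + 2) * ?x' = - (?x' * xop (i + 2))" by (rule xop_anticommute) simp
      finally show ?thesis by (simp add: mult.assoc)
    qed
    then show ?thesis by (simp only: mult.assoc)
  qed
  then have ux': "?u * ?x' = 1 - ?x' * ?d'"
    by (simp only: u distrib_right pd_xop xop_sq) simp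
  have x'u: "?x' * ?u = ?x' * ?d'"
    by (simp only: u distrib_left xop_sq mult.assoc[symmetric]) simp
  have "?x * ?x' * ?w * ?u = - (?x * ?w * (?x' * ?u))"
    by (simp only: mult.assoc[of ?x] x'w) (simp add: mult.assoc)
  also have "\<dots> = - (?x * (?w * ?x') * ?d')" by (simp only: x'u mult.assoc)
  also have "?w * ?x' = - (?x' * ?w)" using x'w by (simp only: minus_minus)
  also have "- (?x * - (?x' * ?w) * ?d') = ?x * ?x' * (?w * ?d')" by (simp add: mult.assoc)
  also have "?w * ?d' = - (?d' * ?w)" using d'w by (simp only: minus_minus)
  finally have 1: "?x * ?x' * ?w * ?u = - (?x * ?x' * ?d' * ?w)" by (simp add: mult.assoc)
  have "?u * (?x * ?x' * ?w) = ?u * ?x * ?x' * ?w" by (simp only: mult.assoc)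
  also have "\<dots> = - (?x * (?u * ?x') * ?w)" by (simp only: xu) (simp add: mult.assoc)
  also have "\<dots> = - (?x * ?w) + ?x * ?x' * ?d' * ?w"
    by (simp only: ux') (simp add: left_diff_distrib right_diff_distrib mult.assoc)
  finally have 2: "?u * (?x * ?x' * ?w) = - (?x * ?w) + ?x * ?x' * ?d' * ?w" .
  have "scomm (v i) ?u = v i * ?u + ?u * v i"
    using scomm_hom[OF v_op_space v_op_space, of i "i + 1"] by simp
  also have "\<dots> = ?d * ?u + ?x * ?x' * ?w * ?u + ?u * ?d + ?u * (?x * ?x' * ?w)"
    by (subst (1 2) v_rec[of i]) (simp only: distrib_left distrib_right add_ac)
  finally show ?thesis by (simp only: 1 2 du) simp
qed

text \<open>As long as i + 2 is at most k, \<open>scomm_v_mon_skip\<close> splits off x_i x_{i+1}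
  and continues with v_{i+2}. The descent ends at v_k, which deletes x_k, or at v_{k-1}, which gives
  zero; hence the dependence on parity.\<close>

lemma scomm_v_mon_insert:
  assumes T: "finite T" "\<And>j. j \<in> T \<Longrightarrow> k < j" and "i \<le> k" "k < n"
  shows "scomm (v i) (mon (insert k T) n) =
    (if even (k - i) then mon ({i..<k} \<union> T) n else 0 :: 'k::field endo)"
  using assms(3)
proof (induction "k - i" arbitrary: i rule: less_induct)
  case less
  consider "k = i" | "k = i + 1" | "i + 2 \<le> k" using less.prems by linarith
  then show ?case
  proof cases
    case 1
    then show ?thesis using scomm_v_mon_delete[of T i n] assms by simp
  next
    case 2
    then show ?thesis
      using scomm_v_mon_zero[of T i n, where ?'k = 'k] assms by (simp add: Suc_le_eq)
  next
    case 3
    have j: "i + 2 \<le> j" if "j \<in> insert k T" for j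
      using that T(2)[of j] 3 by auto
    have "scomm (v i) (mon (insert k T) n) =
        xop i * xop (i + 1) * scomm (v (i + 2)) (mon (insert k T) n :: 'k endo)"
      using T(1) 3 assms(4) j by (intro scomm_v_mon_skip) (simp, blast, linarith)
    also have "scomm (v (i + 2)) (mon (insert k T) n :: 'k endo) =
        (if even (k - (i + 2)) then mon ({i + 2..<k} \<union> T) n else 0)"
      using 3 by (intro less.hyps) auto
    moreover have "xop i * xop (i + 1) * mon ({i + 2..<k} \<union> T) n = (mon ({i..<k} \<union> T) n :: 'k endo)"
    proof -
      have "{i..<k} \<union> T = insert i (insert (i + 1) ({i + 2..<k} \<union> T))"
        using 3 by auto
      moreover have "i + 2 \<le> j" if "j \<in> {i + 2..<k} \<union> T" for j
        using that 3 j[of j] by auto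
      ultimately show ?thesis
        using T(1) mon_insert_Suc[of "{i + 2..<k} \<union> T" i n, where ?'a = 'k]
        by (metis finite_UnI finite_atLeastLessThan)
    qed
    ultimately show ?thesis using 3 by simp
  qed
qed

text \<open>The same descent without a letter to meet: it ends at [v_n, v_n] or at
  [v_{n-1}, v_n].\<close>

lemma scomm_v_v:
  assumes "i \<le> n"
  shows "scomm (v i) (v n) =
    (if even (n - i) then 2 * mon (insert (n + 1) {i..<n}) (n + 2) else - mon {i..<n} (n + 1) :: 'k::field endo)"
  using assms
proof (induction "n - i" arbitrary: i rule: less_induct)
  case less
  consider "n = i" | "n = i + 1" | "i + 2 \<le> n" using less.prems by linarith
  then show ?case
  proof cases
    case 1
    then show ?thesis
      using scomm_v_self[of n, where ?'k = 'k] mon_insert[of "{}" "n + 1" "n + 2", where ?'a = 'k]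
      by simp
  next
    case 2
    then show ?thesis
      using scomm_v_Suc[of i, where ?'k = 'k] mon_insert[of "{}" "i" "i + 2", where ?'a = 'k]
      by (simp add: atLeastLessThanSuc)
  next
    case 3
    have *: "xop i * xop (i + 1) * mon (T \<union> {i + 2..<n}) m = (mon (T \<union> {i..<n}) m :: 'k endo)"
      if "finite T" "\<And>j. j \<in> T \<Longrightarrow> n < j" for T m
    proof -
      have "T \<union> {i..<n} = insert i (insert (i + 1) (T \<union> {i + 2..<n}))"
        using 3 by auto
      moreover have "i + 2 \<le> j" if "j \<in> T \<union> {i + 2..<n}" for j
        using that 3 \<open>j \<in> T \<Longrightarrow> n < j\<close> by auto
      ultimately show ?thesis
        using that(1) mon_insert_Suc[of "T \<union> {i + 2..<n}" i m, where ?'a = 'k]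
        by (metis finite_UnI finite_atLeastLessThan)
    qed
    have "scomm (v i) (v n) = xop i * xop (i + 1) * scomm (v (i + 2)) (v n :: 'k endo)"
      using 3 scomm_v_mon_skip[of "{}" i n, where ?'k = 'k] by simp
    also have "scomm (v (i + 2)) (v n :: 'k endo) =
        (if even (n - (i + 2)) then 2 * mon (insert (n + 1) {i + 2..<n}) (n + 2) else - mon {i + 2..<n} (n + 1))"
      using 3 by (intro less.hyps) auto
    finally show ?thesis
      using 3 *[of "{n + 1}" "n + 2"] *[of "{}" "n + 1"]
      by (simp add: mult_2 distrib_left)
  qed
qed

text \<open>The letter x_0 does not occur in v_1 and is merely carried along. So the counter driven
  by v_1 starts at index 1.\<close>

lemma scomm_v1_insert0:
  assumes "finite T" "0 \<notin> T"
  shows "scomm (v 1) (mon (insert 0 T) n) = - (xop 0 * scomm (v 1) (mon T n :: 'k::field endo))"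
proof -
  have m: "mon (insert 0 T) n = (xop 0 * mon T n :: 'k endo)"
    using assms by (intro mon_insert) (auto intro: gr0I)
  have x: "v 1 * xop 0 = - (xop 0 * v 1 :: 'k endo)"
    using v_xop[of 0 1, where ?'a = 'k] by simp
  have "v 1 * (xop 0 * mon T n) = - (xop 0 * (v 1 * mon T n) :: 'k endo)"
    by (simp only: mult.assoc[symmetric] x) simp
  have "scomm (v 1) (mon (insert 0 T) n) =
      v 1 * mon (insert 0 T) n - (-1) ^ Suc (Suc (card T)) * (mon (insert 0 T) n * v 1 :: 'k endo)"
    using assms scomm_v_mon[of "insert 0 T" 1 n] by simp
  also have "\<dots> = - (xop 0 * (v 1 * mon T n - (-1) ^ Suc (card T) * (mon T n * v 1)))"
    unfolding m \<open>v 1 * (xop 0 * mon T n) = _\<close>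
    by (cases "even (card T)") (simp_all add: right_diff_distrib distrib_left mult.assoc)
  finally show ?thesis
    using assms by (simp only: scomm_v_mon)
qed

section \<open>The index sets of the monomial basis\<close>

fun jac :: "nat \<Rightarrow> nat" where
  "jac 0 = 1"
| "jac (Suc 0) = 1"
| "jac (Suc (Suc n)) = jac (Suc n) + 2 * jac n"

text \<open>Telescoping of a_{l+2} - a_l = a_l + a_{l+1}. For \<open>i\<close> equal to 0 or 1 it
  means that replacing x_k by x_i ... x_{k-1} lowers the total weight by 1, so ad v_i raises the
  degree by 1.\<close>

lemma sum_jac_interval: "i \<le> k \<Longrightarrow> even (k - i) \<Longrightarrow> sum jac {i..<k} + jac i = jac k"
proof (induction "k - i" arbitrary: k rule: less_induct)
  case less
  show ?case
  proof (cases "k = i")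
    case False
    then obtain l where l: "k = Suc (Suc l)" "i \<le> l"
      using less.prems by (metis Suc_diff_le Suc_leI diff_self_eq_0 even_Suc le_neq_implies_less
          not0_implies_Suc not_less_eq_eq le0 odd_one One_nat_def Suc_diff_Suc zero_less_diff)
    then have "sum jac {i..<l} + jac i = jac l"
      using less.prems by (intro less.hyps) auto
    then show ?thesis using l by simp
  qed simp
qed

lemma jac_le_one [simp]: "i \<le> 1 \<Longrightarrow> jac i = 1"
  by (cases i) auto

section \<open>Brackets of v_0 and v_1 with monomials that may contain x_0\<close>

lemma xop0_mon:
  assumes "finite T" "0 \<notin> T"
  shows "xop 0 * mon T n = mon (insert 0 T) n"
  using assms by (intro mon_insert[symmetric]) (auto intro: gr0I)

text \<open>\<open>P\<close> is empty, or it is {0} with \<open>i = 1\<close>, the letter that v_1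
  ignores. The sign is left open because only spans matter later.\<close>

lemma scomm_v_lower:
  assumes "i \<le> 1" "P \<subseteq> {..<i}" "finite T" "\<And>j. j \<in> T \<Longrightarrow> k < j" "i \<le> k" "k < n" "even (k - i)"
  shows "scomm (v i) (mon (P \<union> insert k T) n) = (mon (P \<union> {i..<k} \<union> T) n :: 'k::field endo) \<or>
    scomm (v i) (mon (P \<union> insert k T) n) = - (mon (P \<union> {i..<k} \<union> T) n :: 'k::field endo)"
proof (cases "P = {}")
  case True
  then show ?thesis
    using scomm_v_mon_insert[OF assms(3-6), where ?'k = 'k] assms(7) by simp
next
  case False
  then have P: "P = {0}" "i = 1"
    using assms(1,2) by (cases i; auto)+
  then have 0: "0 \<notin> insert k T" "0 \<notin> {i..<k} \<union> T" "finite ({i..<k} \<union> T)"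
    using assms by auto
  show ?thesis
    using scomm_v_mon_insert[OF assms(3-6), where ?'k = 'k] assms(7)
      scomm_v1_insert0[of "insert k T" n, where ?'k = 'k] 0 assms(3) xop0_mon[OF 0(3,2), of n, where ?'a = 'k]
    by (simp add: P insert_commute)
qed

lemma scomm_v_lower_zero:
  assumes "i \<le> 1" "P \<subseteq> {..<i}" "finite T" "\<And>j. j \<in> T \<Longrightarrow> k < j" "i \<le> k" "k < n" "odd (k - i)"
  shows "scomm (v i) (mon (P \<union> insert k T) n) = (0 :: 'k::field endo)"
proof (cases "P = {}")
  case True
  then show ?thesis
    using scomm_v_mon_insert[OF assms(3-6), where ?'k = 'k] assms(7) by simp
next
  case False
  then have P: "P = {0}" "i = 1"
    using assms(1,2) by (cases i; auto)+
  then show ?thesis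
    using scomm_v_mon_insert[OF assms(3-6), where ?'k = 'k] assms(3,5,7) assms(4)[of 0]
      scomm_v1_insert0[of "insert k T" n, where ?'k = 'k]
    by (auto simp: P insert_commute)
qed

lemma scomm_v_raise_even:
  assumes "i \<le> 1" "P \<subseteq> {..<i}" "i \<le> n" "even (n - i)"
  shows "scomm (v i) (mon P n) = (2 * mon (insert (n + 1) (P \<union> {i..<n})) (n + 2) :: 'k::field endo) \<or>
    scomm (v i) (mon P n) = - (2 * mon (insert (n + 1) (P \<union> {i..<n})) (n + 2) :: 'k::field endo)"
proof (cases "P = {}")
  case True
  then show ?thesis using scomm_v_v[OF assms(3), where ?'k = 'k] assms(4) by simp
next
  case False
  then have P: "P = {0}" "i = 1"
    using assms(1,2) by (cases i; auto)+
  have "xop 0 * mon (insert (n + 1) {i..<n}) (n + 2) = (mon (insert 0 (insert (n + 1) {i..<n})) (n + 2) :: 'k endo)"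
    by (rule xop0_mon) (simp_all add: P)
  then show ?thesis
    using scomm_v_v[OF assms(3), where ?'k = 'k] assms(4)
      scomm_v1_insert0[of "{}" n, where ?'k = 'k]
    by (simp add: P mult_2 distrib_left insert_commute)
qed

lemma scomm_v_raise_odd:
  assumes "i \<le> 1" "P \<subseteq> {..<i}" "i \<le> n" "odd (n - i)"
  shows "scomm (v i) (mon P n) = (mon (P \<union> {i..<n}) (n + 1) :: 'k::field endo) \<or>
    scomm (v i) (mon P n) = - (mon (P \<union> {i..<n}) (n + 1) :: 'k::field endo)"
proof (cases "P = {}")
  case True
  then show ?thesis using scomm_v_v[OF assms(3), where ?'k = 'k] assms(4) by simp
next
  case False
  then have P: "P = {0}" "i = 1"
    using assms(1,2) by (cases i; auto)+
  have "xop 0 * mon {i..<n} (n + 1) = (mon (insert 0 {i..<n}) (n + 1) :: 'k endo)"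
    by (rule xop0_mon) (simp_all add: P)
  then show ?thesis
    using scomm_v_v[OF assms(3), where ?'k = 'k] assms(4)
      scomm_v1_insert0[of "{}" n, where ?'k = 'k]
    by (simp add: P)
qed

text \<open>A pair \<open>(T, m)\<close> stands for the monomial \<open>x\<^sub>T v\<^sub>m\<close>.  The monomials of \<open>top_idx\<close> contain \<open>x\<^bsub>m-1\<^esub>\<close>; they
  arise from \<open>[v\<^sub>k, v\<^sub>k] = 2 x\<^bsub>k+1\<^esub> v\<^bsub>k+2\<^esub>\<close>, hence only in characteristic other than 2.  Their family has
  one gap: \<open>x\<^sub>0 x\<^sub>2 v\<^sub>3\<close> is not generated.  In characteristic 2, \<open>square_idx\<close> lists the squares
  \<open>v\<^sub>p\<^sup>2 = x\<^bsub>p+1\<^esub> v\<^bsub>p+2\<^esub>\<close>.\<close>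

definition base_idx :: "(nat set \<times> nat) set" where
  "base_idx = {(T, m). T \<subseteq> {..<m - 1}}"

definition top_idx :: "(nat set \<times> nat) set" where
  "top_idx = {(insert (p + 1) S, p + 2) | p S. S \<subseteq> {..<p} \<and> (p = 1 \<longrightarrow> S = {})}"

definition square_idx :: "(nat set \<times> nat) set" where
  "square_idx = {({p + 1}, p + 2) | p. True}"

text \<open>The flag \<open>c\<close> stands for characteristic 2.\<close>

definition lie_idx :: "bool \<Rightarrow> (nat set \<times> nat) set" where
  "lie_idx c = base_idx \<union> (if c then {} else top_idx)"

definition idx :: "alg_type \<Rightarrow> bool \<Rightarrow> (nat set \<times> nat) set" where
  "idx t c = lie_idx c \<union> (if t = Bracket then {} else square_idx)"

text \<open>Written additively, because the difference of weights would be truncated in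
  \<open>nat\<close>.\<close>

definition deg_idx :: "(nat set \<times> nat) set \<Rightarrow> nat \<Rightarrow> (nat set \<times> nat) set" where
  "deg_idx I n = {(T, m) \<in> I. n + sum jac T = jac m}"

definition mons :: "(nat set \<times> nat) set \<Rightarrow> nat \<Rightarrow> 'k::field endo set" where
  "mons I n = (\<lambda>(T, m). mon T m) ` deg_idx I n"

lemma idx_subset: "(T, m) \<in> idx t c \<Longrightarrow> T \<subseteq> {..<m}"
  by (fastforce simp: idx_def lie_idx_def base_idx_def top_idx_def square_idx_def split: if_splits)

lemma monsI: "(T, m) \<in> I \<Longrightarrow> n + sum jac T = jac m \<Longrightarrow> mon T m \<in> mons I n"
  by (force simp: mons_def deg_idx_def)

lemma two_mult: "2 * x = endo_scale 2 (x :: 'k::field endo)"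
  using endo.scale_left_distrib[of 1 1 x] by (simp add: mult_2)

lemma lie_idx_cases:
  assumes "(T, m) \<in> lie_idx c"
  obtains "T \<subseteq> {..<m - 1}" | p S where "\<not> c" "m = p + 2" "T = insert (p + 1) S" "S \<subseteq> {..<p}" "p = 1 \<longrightarrow> S = {}"
  using assms by (auto simp: lie_idx_def base_idx_def top_idx_def split: if_splits)

lemma lie_idx_base: "T \<subseteq> {..<m - 1} \<Longrightarrow> (T, m) \<in> lie_idx c"
  by (simp add: lie_idx_def base_idx_def)

lemma lie_idx_top: "\<not> c \<Longrightarrow> S \<subseteq> {..<p} \<Longrightarrow> p = 1 \<longrightarrow> S = {} \<Longrightarrow> (insert (p + 1) S, p + 2) \<in> lie_idx c"
  by (auto simp: lie_idx_def top_idx_def)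

text \<open>The counter rules must not leave the index family: deleting the top letter has to land
  in \<open>base_idx\<close>, and the gap x_0 x_2 v_3 must never be hit.\<close>

lemma scomm_v_mons:
  fixes c :: bool
  assumes c: "c \<longleftrightarrow> (2 :: 'k::field) = 0" and i: "i \<le> 1"
    and b: "b \<in> mons (lie_idx c) n"
  shows "scomm (v i) b \<in> endo.span (mons (lie_idx c) (n + 1) :: 'k endo set)"
proof -
  let ?C = "endo.span (mons (lie_idx c) (n + 1) :: 'k endo set)"
  obtain T m where b: "b = mon T m" "(T, m) \<in> lie_idx c" "n + sum jac T = jac m"
    using b by (auto simp: mons_def deg_idx_def)
  have C: "mon T m \<in> ?C" if "(T, m) \<in> lie_idx c" "n + 1 + sum jac T = jac m" for T m
    using monsI[OF that] by (rule endo.span_base)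
  have fin: "finite T" using b(2) idx_subset[of T m Bracket c]
    by (simp add: idx_def finite_subset)
  define P where "P = T \<inter> {..<i}"
  have P: "P \<subseteq> {..<i}" "finite P" by (auto simp: P_def)
  define T0 where "T0 = T - {..<i}"
  have T: "T = P \<union> T0" "finite T0" "\<And>j. j \<in> T0 \<Longrightarrow> i \<le> j" using fin by (auto simp: P_def T0_def)
  have sumT: "sum jac T = sum jac P + sum jac T0"
    unfolding T(1) by (rule sum.union_disjoint) (use P T in \<open>auto simp: T0_def\<close>)
  show ?thesis
  proof (cases "T0 = {}")
    case False
    define k where "k = Min T0"
    define T1 where "T1 = T0 - {k}"
    have k: "k \<in> T0" "\<And>j. j \<in> T0 \<Longrightarrow> k \<le> j" using False T(2) by (simp_all add: k_def)
    have T1: "T0 = insert k T1" "finite T1" "\<And>j. j \<in> T1 \<Longrightarrow> k < j" "k \<notin> T1"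
      using k T(2) by (auto simp: T1_def order.order_iff_strict)
    have ik: "i \<le> k" using k T(3) by blast
    have km: "k < m" using b(2) idx_subset[of T m Bracket c] k(1) T(1) by (auto simp: idx_def)
    show ?thesis
    proof (cases "even (k - i)")
      case True
      have "(P \<union> {i..<k} \<union> T1, m) \<in> lie_idx c"
        using b(2)
      proof (cases rule: lie_idx_cases)
        case 1
        then have "P \<union> {i..<k} \<union> T1 \<subseteq> {..<m - 1}"
          unfolding T(1) T1(1) by auto
        then show ?thesis by (rule lie_idx_base)
      next
        case (2 p S)
        show ?thesis
        \<comment> \<open>If the least letter seen by v_i is the top one, its deletion turns a top
          monomial into a base monomial.\<close>
        proof (cases "k = p + 1")
          case True
          have "j < p + 2" if "j \<in> T1" for j
            using that idx_subset[of T m Bracket c] b(2) 2(2) unfolding T(1) T1(1) by (auto simp: idx_def)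
          then have "T1 = {}" using T1(3) True by force
          then have "P \<union> {i..<k} \<union> T1 \<subseteq> {..<m - 1}"
            using P(1) ik True 2(2) by auto
          then show ?thesis by (rule lie_idx_base)
        next
          case False
          then have kS: "k \<in> S" using 2(3) T(1) T1(1) by auto
          have "p + 1 \<in> T1" using 2(3) False T(1) T1(1) P(1) i by auto
          then have "P \<union> {i..<k} \<union> T1 = insert (p + 1) (P \<union> {i..<k} \<union> (T1 - {p + 1}))"
            by auto
          moreover have "P \<union> {i..<k} \<union> (T1 - {p + 1}) \<subseteq> {..<p}"
          proof -
            have "p + 1 \<notin> P" using P(1) i by auto
            moreover have "P \<union> T1 \<subseteq> T" by (subst T(1)) (auto simp: T1(1))
            ultimately have "P \<union> (T1 - {p + 1}) \<subseteq> S" unfolding 2(3) by auto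
            then show ?thesis using 2(4) kS by auto
          qed
          \<comment> \<open>Since \<open>k\<close> lies in \<open>S\<close>, the condition on
            \<open>p = 1\<close> rules that value out, and the gap is avoided.\<close>
          ultimately show ?thesis
            using 2(1,2,5) kS lie_idx_top[of c "P \<union> {i..<k} \<union> (T1 - {p + 1})" p] by auto
        qed
      qed
      moreover have "n + 1 + sum jac (P \<union> {i..<k} \<union> T1) = jac m"
      proof -
        have "sum jac (P \<union> {i..<k} \<union> T1) = sum jac P + sum jac {i..<k} + sum jac T1"
        proof -
          have "(P \<union> {i..<k}) \<inter> T1 = {}" "P \<inter> {i..<k} = {}"
            using T1(3) P ik by fastforce+
          then show ?thesis using P(2) T1(2) by (simp add: sum.union_disjoint)
        qed
        moreover have "sum jac {i..<k} + jac i = jac k"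
          by (rule sum_jac_interval[OF ik True])
        ultimately show ?thesis using b(3) sumT T1 i by simp
      qed
      ultimately have "mon (P \<union> {i..<k} \<union> T1) m \<in> ?C" by (rule C)
      then show ?thesis
        using scomm_v_lower[OF i P(1) T1(2,3) ik km True, where ?'k = 'k] unfolding b(1) T(1) T1(1)
        by (auto intro: endo.span_neg)
    next
      case False
      then show ?thesis
        using scomm_v_lower_zero[OF i P(1) T1(2,3) ik km False, where ?'k = 'k] unfolding b(1) T(1) T1(1)
        by (simp add: endo.span_zero)
    qed
  next
    case True
    then have TP: "T = P" using T by simp
    show ?thesis
    proof (cases "i \<le> m")
      case False
      \<comment> \<open>Only [v_1, v_0] falls outside the formulas for i at most m; both factors are
        odd, so it equals [v_0, v_1].\<close>
      then have "i = 1" "m = 0" using i by auto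
      then have T0: "T = {}" "n = 1"
        using b(2,3) idx_subset[of T m Bracket c] by (auto simp: idx_def)
      have "scomm (v 1) (v 0) = (scomm (v 0) (v 1) :: 'k endo)"
      proof -
        have "scomm (v 1) (v 0) = v 1 * v 0 + v 0 * (v 1 :: 'k endo)"
          "scomm (v 0) (v 1) = v 0 * v 1 + v 1 * (v 0 :: 'k endo)"
          by (subst scomm_hom[OF v_op_space v_op_space]; simp)+
        then show ?thesis by (simp only: add.commute)
      qed
      also have "\<dots> = - mon {0} 2"
        using scomm_v_v[of 0 1, where ?'k = 'k] by (simp add: numeral_2_eq_2)
      finally have "scomm (v i) b = - (mon {0} 2 :: 'k endo)"
        using b T0 \<open>i = 1\<close> \<open>m = 0\<close> by simp
      moreover have "mon {0} 2 \<in> ?C"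
        by (rule C[OF lie_idx_base]) (simp_all add: T0 numeral_2_eq_2)
      ultimately show ?thesis by (simp add: endo.span_neg)
    next
      case im: True
      \<comment> \<open>This excludes x_0 v_1, whose bracket with v_1 would be a multiple of the gap
        x_0 x_2 v_3.\<close>
      have m: "P = {} \<or> 2 \<le> m"
        using b(2) unfolding TP
      proof (cases rule: lie_idx_cases)
        case 1
        then show ?thesis by auto
      qed simp
      have Pi: "sum jac (P \<union> {i..<m}) = sum jac P + sum jac {i..<m}"
        by (rule sum.union_disjoint) (use P in auto)
      show ?thesis
      proof (cases "even (m - i)")
        case True
        have "2 * mon (insert (m + 1) (P \<union> {i..<m})) (m + 2) \<in> ?C"
        proof (cases c)
          case True
          then show ?thesis using c by (simp add: two_mult endo.span_zero)
        next
          case False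
          have "sum jac {i..<m} + jac i = jac m"
            by (rule sum_jac_interval[OF im True])
          moreover have "m = 1 \<Longrightarrow> i = 1" using i True by (cases i) auto
          then have "P \<union> {i..<m} \<subseteq> {..<m}" "m = 1 \<longrightarrow> P \<union> {i..<m} = {}"
            using P(1) im m by auto
          moreover from this have "sum jac (insert (m + 1) (P \<union> {i..<m})) = jac (m + 1) + sum jac (P \<union> {i..<m})"
            using P(2) by (intro sum.insert) auto
          ultimately have "mon (insert (m + 1) (P \<union> {i..<m})) (m + 2) \<in> ?C"
            using b(3) i Pi TP False by (intro C lie_idx_top) simp_all
          then show ?thesis by (simp add: two_mult endo.span_scale)
        qed
        then show ?thesis
          using scomm_v_raise_even[OF i P(1) im True, where ?'k = 'k] unfolding b(1) TP
          by (auto intro: endo.span_neg)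
      next
        case False
        have "sum jac {i..<m + 1} + jac i = jac (m + 1)"
          using im False by (intro sum_jac_interval) auto
        then have "mon (P \<union> {i..<m}) (m + 1) \<in> ?C"
          using b(3) i P m im Pi TP
          by (intro C lie_idx_base) auto
        then show ?thesis
          using scomm_v_raise_odd[OF i P(1) im False, where ?'k = 'k] unfolding b(1) TP
          by (auto intro: endo.span_neg)
      qed
    qed
  qed
qed

section \<open>Reaching every basis monomial from the preceding degree\<close>

lemma LEAST_split:
  fixes S :: "nat set"
  assumes "finite S" and k: "k = (LEAST j. j \<notin> S)"
  shows "S = {..<k} \<union> (S \<inter> {k<..})" "k \<notin> S"
proof -
  obtain j where "j \<notin> S" using assms(1) infinite_UNIV_nat by (metis ex_new_if_finite)
  then show "k \<notin> S" unfolding k by (rule LeastI)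
  moreover have "j \<in> S" if "j < k" for j
    using not_less_Least[of j "\<lambda>j. j \<notin> S"] that k by blast
  ultimately show "S = {..<k} \<union> (S \<inter> {k<..})"
    by (auto simp: set_eq_iff) (metis linorder_neqE_nat)
qed

text \<open>The preimage of \<open>x\<^sub>T v\<^sub>m\<close> under \<open>v\<^sub>0\<close> or \<open>v\<^sub>1\<close> is found by running the counter backwards: the
  least \<open>k \<notin> T\<close> is inserted and the smaller indices are removed (index \<open>0\<close> is kept for \<open>v\<^sub>1\<close>).\<close>

lemma mons_reach:
  fixes c :: bool and n :: nat
  defines "D \<equiv> endo.span {scomm (v i) b | i b. i \<le> 1 \<and> b \<in> mons (lie_idx c) n} :: 'k::field endo set"
  assumes c: "c \<longleftrightarrow> (2 :: 'k::field) = 0" and n: "n \<ge> 1"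
    and a: "a \<in> mons (lie_idx c) (n + 1)"
  shows "a \<in> D"
proof -
  obtain T m where a: "a = mon T m" "(T, m) \<in> lie_idx c" "n + 1 + sum jac T = jac m"
    using a by (auto simp: mons_def deg_idx_def)
  have D: "scomm (v i) (mon T m) \<in> D" if "i \<le> 1" "(T, m) \<in> lie_idx c" "n + sum jac T = jac m" for T m i
    unfolding D_def using monsI[OF that(2,3)] that(1) by (intro endo.span_base) blast
  have D_neg: "x \<in> D" if "y \<in> D" "y = x \<or> y = - x" for x y
    using that endo.span_neg[of y] unfolding D_def by auto
  have lower: "mon T m \<in> D"
    if T: "T = {..<k} \<union> U" "finite U" "\<And>j. j \<in> U \<Longrightarrow> k < j" and km: "k < m"
      and idx: "\<And>P. P \<subseteq> {..<k} \<Longrightarrow> (P \<union> insert k U, m) \<in> lie_idx c"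
    for k U
  proof -
    \<comment> \<open>The parity of \<open>k\<close> chooses between v_0 and v_1: only the one with
      index of the same parity deletes x_k.\<close>
    define i where "i = k mod 2"
    have i: "i \<le> 1" "i \<le> k" "even (k - i)"
      using div_mult_mod_eq[of k 2] by (auto simp: i_def minus_mod_eq_div_mult[symmetric])
    have T': "T = {..<i} \<union> {i..<k} \<union> U" using T(1) i(2) by auto
    have *: "{..<i} \<inter> {i..<k} = {}" "({..<i} \<union> {i..<k}) \<inter> U = {}" "{..<i} \<inter> insert k U = {}" "k \<notin> U"
      using T(3) i(2) by fastforce+
    have "sum jac {i..<k} + jac i = jac k" by (rule sum_jac_interval) fact+
    then have "n + sum jac ({..<i} \<union> insert k U) = jac m"
      using a(3) T(2) * i(1) unfolding T' by (simp add: sum.union_disjoint)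
    then have "scomm (v i) (mon ({..<i} \<union> insert k U) m) \<in> D"
      using i by (intro D idx) auto
    then show ?thesis
      by (rule D_neg) (use scomm_v_lower[OF i(1) order_refl T(2,3) i(2) km i(3)] T' in simp)
  qed
  show ?thesis
    using a(2)
  proof (cases rule: lie_idx_cases)
    case 1
    have fin: "finite T" using 1 finite_subset by blast
    define k where "k = (LEAST j. j \<notin> T)"
    note split = LEAST_split[OF fin k_def]
    show ?thesis
    proof (cases "k < m - 1")
      case True
      have "mon T m \<in> D"
      proof (rule lower[OF split(1)])
        show "(P \<union> insert k (T \<inter> {k<..}), m) \<in> lie_idx c" if "P \<subseteq> {..<k}" for P
          using that True 1 by (intro lie_idx_base) force
      qed (use fin True in auto)
      then show ?thesis by (simp add: a(1))
    next
      case False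
      \<comment> \<open>A full counter is the result of a carry: it comes from v_{m-1}, multiplied
        by x_0 when v_1 is the operator used.\<close>
      then have T: "T = {..<m - 1}" using 1 split(1) by auto
      \<comment> \<open>For these \<open>m\<close> the monomial would be v_m, of degree 1, but the
        degree here is at least 2.\<close>
      have "m \<noteq> 0" "m \<noteq> 1" using a(3) n T by auto
      then obtain l where m: "m = l + 2" by (metis add_2_eq_Suc' not0_implies_Suc One_nat_def)
      define i where "i = l mod 2"
      have i: "i \<le> 1" "i \<le> l" "even (l - i)"
        using div_mult_mod_eq[of l 2] by (auto simp: i_def minus_mod_eq_div_mult[symmetric])
      have T': "T = {..<i} \<union> {i..<l + 1}" using T i(2) m by auto
      have "sum jac {i..<l} + jac i = jac l" by (rule sum_jac_interval) fact+
      moreover have "sum jac T = sum jac {..<i} + sum jac {i..<l + 1}"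
        unfolding T' by (rule sum.union_disjoint) auto
      ultimately have "n + sum jac {..<i} = jac (l + 1)"
        using a(3) i by (simp add: m)
      moreover have "({..<i}, l + 1) \<in> lie_idx c"
        using i by (intro lie_idx_base) auto
      ultimately have "scomm (v i) (mon {..<i} (l + 1)) \<in> D"
        using i by (intro D) auto
      then show ?thesis
        by (rule D_neg)
          (use scomm_v_raise_odd[OF i(1) order_refl, of "l + 1"] i T' in \<open>simp add: a(1) m\<close>)
    qed
  next
    case (2 p S)
    have fin: "finite S" using 2 finite_subset by blast
    have two: "x \<in> D" if "2 * x \<in> D" for x
    proof -
      have "endo_scale (1 / 2) (2 * x) \<in> D"
        using that unfolding D_def by (rule endo.span_scale)
      then show ?thesis using 2(1) c by (simp add: two_mult)
    qed
    define k where "k = (LEAST j. j \<notin> S)"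
    note split = LEAST_split[OF fin k_def]
    show ?thesis
    proof (cases "k < p \<and> p \<noteq> 1")
      case True
      have "mon T m \<in> D"
      proof (rule lower)
        show "T = {..<k} \<union> insert (p + 1) (S \<inter> {k<..})" using split(1) 2(3) by auto
        show "(P \<union> insert k (insert (p + 1) (S \<inter> {k<..})), m) \<in> lie_idx c" if "P \<subseteq> {..<k}" for P
        proof -
          have "P \<union> insert k (S \<inter> {k<..}) \<subseteq> {..<p}"
            using True that 2(4) by force
          then show ?thesis
            using lie_idx_top[OF 2(1), of "P \<union> insert k (S \<inter> {k<..})" p] True 2(2)
            by (simp add: insert_commute)
        qed
      qed (use fin True 2 in auto)
      then show ?thesis by (simp add: a(1))
    next
      case False
      define i where "i = p mod 2"
      \<comment> \<open>For \<open>p = 1\<close> the set {..<i} would be {0} and the preimage x_0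
        v_1, which is no basis monomial. There \<open>S = {}\<close>, and the preimage is v_1
        itself.\<close>
      define P where "P = (if p = 1 then {} else {..<i})"
      have i: "i \<le> 1" "i \<le> p" "even (p - i)" "p = 1 \<Longrightarrow> i = 1" "i = 1 \<Longrightarrow> odd p"
        using div_mult_mod_eq[of p 2] by (auto simp: i_def minus_mod_eq_div_mult[symmetric] odd_iff_mod_2_eq_one)
      have P: "P \<subseteq> {..<i}" "finite P" by (simp_all add: P_def)
      have S: "S = P \<union> {i..<p}"
      proof (cases "p = 1")
        case True
        then show ?thesis using 2(5) i(4) by (simp add: P_def)
      next
        case p: False
        then have "{..<p} \<subseteq> {..<k}" using False by auto
        then have "{..<p} \<subseteq> S" by (subst split(1)) (rule le_supI1)
        then have "S = {..<p}" using 2(4) by simp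
        then show ?thesis using p i(2) by (auto simp: P_def)
      qed
      have "sum jac {i..<p} + jac i = jac p" by (rule sum_jac_interval) fact+
      moreover have "sum jac S = sum jac P + sum jac {i..<p}"
        unfolding S by (rule sum.union_disjoint) (use P in auto)
      moreover have "sum jac T = jac (p + 1) + sum jac S"
        unfolding 2(3) using fin 2(4) by (subst sum.insert) auto
      ultimately have "n + sum jac P = jac p"
        using a(3) i by (simp add: 2(2))
      moreover have "(P, p) \<in> lie_idx c"
        using i by (intro lie_idx_base) (auto simp: P_def; presburger)
      ultimately have "scomm (v i) (mon P p) \<in> D"
        using i by (intro D) auto
      then have "2 * mon T m \<in> D"
        by (rule D_neg) (use scomm_v_raise_even[OF i(1) P(1) i(2,3)] in \<open>simp add: 2 S\<close>)
      then show ?thesis unfolding a(1) by (rule two)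
    qed
  qed
qed

section \<open>Counting basis monomials by degree\<close>

lemma jac_Suc: "jac (Suc m) + (if even m then 1 else 0) = 2 * jac m + (if even m then 0 else 1)"
  by (induction m rule: jac.induct) auto

text \<open>By \<open>jac_Suc\<close> the weights double up to an error of 1, so the sum of the
  first m weights is a_m or a_m - 1. This is why subset sums leave no holes and hardly
  overlap.\<close>

lemma sum_jac_lessThan: "sum jac {..<m} + (if even m then 1 else 0) = jac m"
proof (induction m)
  case (Suc m)
  then show ?case using jac_Suc[of m] by (auto split: if_splits)
qed simp

lemma jac_pos: "0 < jac m"
  by (induction m rule: jac.induct) auto

lemma jac_mono: "m \<le> n \<Longrightarrow> jac m \<le> jac n"
proof (rule lift_Suc_mono_le[of jac])
  show "jac m \<le> jac (Suc m)" for m by (cases m) auto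
qed

lemma jac_strict: "1 \<le> m \<Longrightarrow> m < n \<Longrightarrow> jac m < jac n"
proof -
  assume "1 \<le> m" "m < n"
  then have "jac m < jac (Suc m)" using jac_pos[of "m - 1"] by (cases m) auto
  also have "jac (Suc m) \<le> jac n" using \<open>m < n\<close> by (intro jac_mono) simp
  finally show ?thesis .
qed

lemma jac_ge: "m \<le> jac m"
proof (induction m)
  case (Suc m)
  then show ?case using jac_strict[of m "Suc m"] by (cases m) auto
qed simp

section \<open>Subset sums of Jacobsthal numbers\<close>

definition rep :: "nat \<Rightarrow> nat \<Rightarrow> nat" where
  "rep m s = card {T. T \<subseteq> {..<m} \<and> sum jac T = s}"

lemma finite_rep: "finite {T. T \<subseteq> {..<m} \<and> P T}" for m :: nat
  by (rule finite_subset[of _ "Pow {..<m}"]) auto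

lemma rep_0: "rep 0 s = (if s = 0 then 1 else 0)"
proof -
  have "{T. T \<subseteq> {..<0} \<and> sum jac T = s} = (if s = 0 then {{}} else {})" by auto
  then show ?thesis by (simp add: rep_def)
qed

lemma rep_Suc: "rep (Suc m) s = rep m s + (if jac m \<le> s then rep m (s - jac m) else 0)"
proof -
  let ?A = "{T. T \<subseteq> {..<m} \<and> sum jac T = s}" and ?B = "{T. T \<subseteq> {..<m} \<and> jac m + sum jac T = s}"
  have *: "sum jac (insert m T) = jac m + sum jac T" if "T \<subseteq> {..<m}" for T
    using that by (subst sum.insert) (auto intro: finite_subset)
  have "{T. T \<subseteq> {..<Suc m} \<and> sum jac T = s} = ?A \<union> insert m ` ?B"
  proof (intro equalityI subsetI)
    fix T assume T: "T \<in> {T. T \<subseteq> {..<Suc m} \<and> sum jac T = s}"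
    show "T \<in> ?A \<union> insert m ` ?B"
    proof (cases "m \<in> T")
      case True
      then have "T = insert m (T - {m})" "T - {m} \<subseteq> {..<m}" using T by auto
      then show ?thesis using T *[of "T - {m}"] by (metis (mono_tags, lifting) UnI2 image_eqI mem_Collect_eq)
    next
      case False
      then show ?thesis using T by (auto simp: less_Suc_eq)
    qed
  qed (use * in auto)
  moreover have "card (insert m ` ?B) = card ?B"
  proof (rule card_image, rule inj_onI)
    fix S T assume "S \<in> ?B" "T \<in> ?B" "insert m S = insert m T"
    moreover from this have "m \<notin> S" "m \<notin> T" by auto
    ultimately show "S = T" by (simp add: insert_ident)
  qed
  moreover have "?A \<inter> insert m ` ?B = {}" by auto
  ultimately have "rep (Suc m) s = rep m s + card ?B"
    by (simp add: rep_def card_Un_disjoint finite_rep)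
  moreover have "?B = (if jac m \<le> s then {T. T \<subseteq> {..<m} \<and> sum jac T = s - jac m} else {})"
    by auto
  ultimately show ?thesis by (simp add: rep_def)
qed

text \<open>Let s_m be the sum of the first m weights. Sums without a_m fill the range from 0 to
  s_m, sums with it the range from a_m to a_m + s_m. These ranges are adjacent or share the single
  point a_m = s_m, which is the maximum of the first and the minimum of the second. The induction
  therefore has to carry along that both extremes are represented exactly once.\<close>

lemma rep_bounds:
  "(s \<le> sum jac {..<m} \<longrightarrow> 1 \<le> rep m s \<and> rep m s \<le> 2) \<and> (sum jac {..<m} < s \<longrightarrow> rep m s = 0) \<and>
    rep m 0 = 1 \<and> rep m (sum jac {..<m}) = 1"
proof (induction m arbitrary: s)
  case (Suc m)
  have *: "sum jac {..<m} \<le> jac m" "jac m \<le> sum jac {..<m} + 1"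
    using sum_jac_lessThan[of m] by (auto split: if_splits)
  have 1: "rep (Suc m) 0 = 1" using Suc jac_pos[of m] by (simp add: rep_Suc)
  have 2: "rep (Suc m) (sum jac {..<Suc m}) = 1" using Suc jac_pos[of m] by (simp add: rep_Suc)
  have 3: "rep (Suc m) s = 0" if "sum jac {..<Suc m} < s"
    using Suc[of s] Suc[of "s - jac m"] that by (simp add: rep_Suc)
  have 4: "1 \<le> rep (Suc m) s \<and> rep (Suc m) s \<le> 2" if s: "s \<le> sum jac {..<Suc m}"
  proof (cases "s < jac m")
    case True
    then show ?thesis using Suc[of s] * by (simp add: rep_Suc)
  next
    case False
    then have "s - jac m \<le> sum jac {..<m}" using s by simp
    moreover have "sum jac {..<m} < s \<or> s = jac m \<and> s = sum jac {..<m}" using False * by linarith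
    ultimately show ?thesis using Suc[of s] Suc[of "s - jac m"] False by (auto simp: rep_Suc)
  qed
  show ?case using 1 2 3 4 by blast
qed (auto simp: rep_0)

lemma rep_pos: "s \<le> sum jac {..<m} \<Longrightarrow> 1 \<le> rep m s"
  and rep_le_2: "rep m s \<le> 2"
  and rep_eq_0: "sum jac {..<m} < s \<Longrightarrow> rep m s = 0"
  and rep_zero: "rep m 0 = 1"
  and rep_max: "rep m (sum jac {..<m}) = 1"
  using rep_bounds[of s m] by (auto simp: leI)

section \<open>Counting the monomials with a fixed pivot element\<close>

lemma card_levels:
  assumes "finite K" "\<And>m. finite (X m)" "\<And>m. m \<notin> K \<Longrightarrow> X m = {}"
  shows "finite {(f T m, g m) | T m. T \<in> X m}"
    "inj g \<Longrightarrow> (\<And>m. inj_on (\<lambda>T. f T m) (X m)) \<Longrightarrow>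
     card {(f T m, g m) | T m. T \<in> X m} = (\<Sum>m\<in>K. card (X m))"
proof -
  have eq: "{(f T m, g m) | T m. T \<in> X m} = (\<lambda>(m, T). (f T m, g m)) ` Sigma K X"
    using assms(3) by force
  show "finite {(f T m, g m) | T m. T \<in> X m}"
    unfolding eq using assms(1,2) by simp
  assume inj: "inj g" "\<And>m. inj_on (\<lambda>T. f T m) (X m)"
  have "inj_on (\<lambda>(m, T). (f T m, g m)) (Sigma K X)"
    using injD[OF inj(1)] inj_onD[OF inj(2)] by (intro inj_onI) (clarsimp, metis)
  then show "card {(f T m, g m) | T m. T \<in> X m} = (\<Sum>m\<in>K. card (X m))"
    unfolding eq using assms(1,2) by (simp add: card_image)
qed

text \<open>The number of base monomials x_T v_m of degree \<open>n\<close>. At \<open>m = 0\<close>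
  the truncated \<open>m - 1\<close> admits only \<open>T = {}\<close>, in agreement with
  \<open>base_idx\<close>.\<close>

definition base_level :: "nat \<Rightarrow> nat \<Rightarrow> nat" where
  "base_level n m = (if n \<le> jac m then rep (m - 1) (jac m - n) else 0)"

text \<open>The monomial x_S x_{p+1} v_{p+2} has degree a_{p+2} - a_{p+1} minus the weight of S, and
  that difference is 2 a_p. The case \<open>p = 1\<close> encodes the gap: only x_2 v_3, of degree
  2, remains.\<close>

definition top_level :: "nat \<Rightarrow> nat \<Rightarrow> nat" where
  "top_level n p = (if p = 1 then (if n = 2 then 1 else 0)
     else if n \<le> 2 * jac p then rep p (2 * jac p - n) else 0)"

lemma finite_sets_eq_empty: "finite A \<Longrightarrow> card A = 0 \<Longrightarrow> A = {}"
  by simp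

lemma card_base:
  assumes "finite K" "\<And>m. m \<notin> K \<Longrightarrow> base_level n m = 0"
  shows "finite (deg_idx base_idx n)" "card (deg_idx base_idx n) = (\<Sum>m\<in>K. base_level n m)"
proof -
  let ?X = "\<lambda>m. {T. T \<subseteq> {..<m - 1} \<and> n + sum jac T = jac m}"
  have card: "card (?X m) = base_level n m" for m
  proof (cases "n \<le> jac m")
    case True
    then have "n + sum jac T = jac m \<longleftrightarrow> sum jac T = jac m - n" for T by auto
    then show ?thesis using True by (simp add: base_level_def rep_def)
  next
    case False
    then have "?X m = {}" by auto
    then show ?thesis using False by (simp only: base_level_def card.empty if_False)
  qed
  have eq: "deg_idx base_idx n = {(T, id m) | T m. T \<in> ?X m}"
    by (auto simp: deg_idx_def base_idx_def)
  have "?X m = {}" if "m \<notin> K" for m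
    using assms(2)[OF that] card[of m] by (intro finite_sets_eq_empty finite_rep) simp
  note * = card_levels[where K = K and X = ?X and f = "\<lambda>T m. T" and g = id, OF assms(1) finite_rep this]
  show "finite (deg_idx base_idx n)" unfolding eq by (rule *(1))
  show "card (deg_idx base_idx n) = (\<Sum>m\<in>K. base_level n m)"
    unfolding eq card[symmetric] by (intro *(2) inj_on_id inj_on_id2)
qed

lemma card_top:
  assumes "finite K" "\<And>p. p \<notin> K \<Longrightarrow> top_level n p = 0"
  shows "finite (deg_idx top_idx n)" "card (deg_idx top_idx n) = (\<Sum>p\<in>K. top_level n p)"
proof -
  let ?X = "\<lambda>p. {S. S \<subseteq> {..<p} \<and> (p = 1 \<longrightarrow> S = {}) \<and> n + sum jac S = 2 * jac p}"
  have card: "card (?X p) = top_level n p" for p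
  proof (cases "p = 1")
    case True
    then have "?X p = (if n = 2 then {{}} else {})" by auto
    then show ?thesis using True by (simp only: top_level_def) simp
  next
    case p: False
    show ?thesis
    proof (cases "n \<le> 2 * jac p")
      case True
      then have "n + sum jac T = 2 * jac p \<longleftrightarrow> sum jac T = 2 * jac p - n" for T by auto
      then show ?thesis using True p by (simp add: top_level_def rep_def)
    next
      case False
      then have "?X p = {}" by auto
      then show ?thesis using False p by (simp only: top_level_def card.empty if_False)
    qed
  qed
  have eq: "deg_idx top_idx n = {(insert (p + 1) S, p + 2) | S p. S \<in> ?X p}"
  proof -
    have *: "sum jac (insert (Suc p) S) = jac (Suc p) + sum jac S" if "S \<subseteq> {..<p}" for S p
      using that by (subst sum.insert) (auto intro: finite_subset)
    show ?thesis
      by (fastforce simp: deg_idx_def top_idx_def *)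
  qed
  have "?X p = {}" if "p \<notin> K" for p
    using assms(2)[OF that] card[of p] by (intro finite_sets_eq_empty finite_rep) simp
  note * = card_levels[where K = K and X = ?X and f = "\<lambda>S p. insert (p + 1) S" and g = "\<lambda>p. p + 2", OF assms(1) finite_rep this]
  have inj: "inj_on (\<lambda>S. insert (p + 1) S) (?X p)" for p
  proof (rule inj_onI)
    fix S T assume "S \<in> ?X p" "T \<in> ?X p" "insert (p + 1) S = insert (p + 1) T"
    moreover from this have "p + 1 \<notin> S" "p + 1 \<notin> T" by auto
    ultimately show "S = T" by (simp add: insert_ident)
  qed
  show "finite (deg_idx top_idx n)" unfolding eq by (rule *(1))
  have "inj (\<lambda>p :: nat. p + 2)" by (simp add: inj_def)
  then show "card (deg_idx top_idx n) = (\<Sum>p\<in>K. top_level n p)"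
    unfolding eq card[symmetric] by (intro *(2) inj)
qed

text \<open>The least degree belongs to T = {0, ..., m - 2}, the greatest to the empty set. Hence
  adjacent levels m - 1 and m share at most the degree a_{m-1}.\<close>

lemma base_level_ne_0: "base_level n m \<noteq> 0 \<Longrightarrow> 1 \<le> m \<Longrightarrow> jac (m - 1) + (if even m then 1 else 0) \<le> n \<and> n \<le> jac m"
proof -
  assume "base_level n m \<noteq> 0" "1 \<le> m"
  then obtain k where m: "m = Suc k" by (cases m) auto
  have "n \<le> jac m" "rep k (jac m - n) \<noteq> 0"
    using \<open>base_level n m \<noteq> 0\<close> by (auto simp: base_level_def m split: if_splits)
  moreover from this have "jac m - n \<le> sum jac {..<k}"
    using rep_eq_0[of k "jac m - n"] not_le by blast
  ultimately have "n \<le> jac m" "jac m - n \<le> sum jac {..<k}" by simp_all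
  then show ?thesis
    using jac_Suc[of k] sum_jac_lessThan[of k] by (auto simp: m split: if_splits)
qed

lemma base_level_le_2: "base_level n m \<le> 2"
  by (simp add: base_level_def rep_le_2)

lemma top_level_le_2: "top_level n p \<le> 2"
  by (simp add: top_level_def rep_le_2)

lemma base_level_pos:
  "jac m < n \<Longrightarrow> n \<le> jac (Suc m) \<Longrightarrow> 1 \<le> base_level n (Suc m)"
  using jac_Suc[of m] sum_jac_lessThan[of m]
    rep_pos[of "jac (Suc m) - n" m]
  by (auto simp: base_level_def split: if_splits)

lemma top_level_ne_0: "top_level n p \<noteq> 0 \<Longrightarrow> jac p + (if even p then 1 else 0) \<le> n \<and> n \<le> 2 * jac p"
proof (cases "p = 1")
  case False
  assume "top_level n p \<noteq> 0"
  then have "n \<le> 2 * jac p" "rep p (2 * jac p - n) \<noteq> 0"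
    using False by (auto simp: top_level_def split: if_splits)
  moreover from this have "2 * jac p - n \<le> sum jac {..<p}"
    using rep_eq_0[of p "2 * jac p - n"] not_le by blast
  ultimately show ?thesis
    using sum_jac_lessThan[of p] by (auto split: if_splits)
qed (auto simp: top_level_def split: if_splits)

lemma top_level_pos:
  "jac p + (if even p then 1 else 0) \<le> n \<Longrightarrow> n \<le> 2 * jac p \<Longrightarrow> p \<noteq> 1 \<Longrightarrow> 1 \<le> top_level n p"
  using rep_pos[of "2 * jac p - n" p] sum_jac_lessThan[of p]
  by (auto simp: top_level_def split: if_splits)

section \<open>Counting degree by degree between consecutive Jacobsthal numbers\<close>

lemma degree_interval:
  assumes "2 \<le> n"
  obtains m where "1 \<le> m" "jac m < n" "n \<le> jac (Suc m)"
proof -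
  define l where "l = (LEAST l. n \<le> jac l)"
  have "n \<le> jac l" unfolding l_def by (rule LeastI[of _ n]) (rule jac_ge)
  moreover have "jac k < n" if "k < l" for k
    using not_less_Least[of k "\<lambda>l. n \<le> jac l"] that by (simp add: l_def)
  moreover have "2 \<le> l"
    using \<open>n \<le> jac l\<close> assms by (cases l rule: jac.cases) auto
  ultimately show ?thesis
    using that[of "l - 1"] by (cases l) auto
qed

text \<open>Apart from level m + 1 only the least degree of level m + 2 can fall into the interval;
  it equals a_{m+1} exactly for odd m.\<close>

lemma card_base_interval:
  assumes m: "1 \<le> m" "jac m < n" "n \<le> jac (Suc m)"
  shows "finite (deg_idx base_idx n)"
    "card (deg_idx base_idx n) = base_level n (Suc m) + (if n = jac (Suc m) \<and> odd m then 1 else 0)"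
proof -
  have 0: "base_level n l = 0" if "l \<notin> {Suc m, Suc (Suc m)}" for l
  proof (rule ccontr)
    assume nz: "base_level n l \<noteq> 0"
    then have "n \<le> jac l" by (auto simp: base_level_def split: if_splits)
    then have "\<not> l \<le> m" using m(2) jac_mono[of l m] by linarith
    then have "Suc (Suc m) < l" using that by auto
    then have "jac (Suc m) < jac (l - 1)" by (intro jac_strict) auto
    moreover have "jac (l - 1) \<le> n" using base_level_ne_0[OF nz] \<open>\<not> l \<le> m\<close> by auto
    ultimately show False using m(3) by simp
  qed
  have 1: "base_level n (Suc (Suc m)) = (if n = jac (Suc m) \<and> odd m then 1 else 0)"
  proof (cases "n = jac (Suc m) \<and> odd m")
    case True
    then have "jac (Suc (Suc m)) - n = sum jac {..<Suc m}"
      using jac_Suc[of "Suc m"] sum_jac_lessThan[of "Suc m"] by auto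
    then show ?thesis using True jac_mono[of "Suc m" "Suc (Suc m)"] rep_max[of "Suc m"]
      by (simp add: base_level_def del: jac.simps sum.lessThan_Suc)
  next
    case False
    then show ?thesis
      using base_level_ne_0[of n "Suc (Suc m)"] m(3) by (cases "odd m") auto
  qed
  show "finite (deg_idx base_idx n)"
    using card_base(1)[of "{Suc m, Suc (Suc m)}" n] 0 by blast
  show "card (deg_idx base_idx n) = base_level n (Suc m) + (if n = jac (Suc m) \<and> odd m then 1 else 0)"
    using card_base(2)[of "{Suc m, Suc (Suc m)}" n] 0 1 by simp
qed

lemma card_base_one:
  "finite (deg_idx base_idx 1)" "card (deg_idx base_idx 1) = 2"
proof -
  have 0: "base_level 1 l = 0" if "l \<notin> {0, 1}" for l
  proof (rule ccontr)
    assume nz: "base_level 1 l \<noteq> 0"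
    have "2 \<le> l" using that by (cases l rule: jac.cases) auto
    then have "jac 1 + (if even l then 1 else 0) \<le> 1"
      using base_level_ne_0[OF nz] jac_mono[of 1 "l - 1"] by linarith
    moreover have "3 \<le> l \<Longrightarrow> jac 2 \<le> 1"
      using base_level_ne_0[OF nz] jac_mono[of 2 "l - 1"] by linarith
    ultimately show False
      using \<open>2 \<le> l\<close> by (cases "l = 2") (auto simp: numeral_2_eq_2)
  qed
  show "finite (deg_idx base_idx 1)" "card (deg_idx base_idx 1) = 2"
    using card_base[of "{0, 1}" 1] 0 by (auto simp: base_level_def rep_zero)
qed

lemma card_base_interval_cases:
  assumes m: "1 \<le> m" "jac m < n" "n \<le> jac (Suc m)"
  shows "card (deg_idx base_idx n) \<in> {1, 2}"
    "n = jac (Suc m) \<Longrightarrow> card (deg_idx base_idx n) = (if even m then 1 else 2)"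
    "n = jac m + 1 \<Longrightarrow> odd m \<Longrightarrow> card (deg_idx base_idx n) = 1"
proof -
  note card = card_base_interval(2)[OF m]
  have 1: "base_level n (Suc m) = 1" if "n = jac (Suc m)"
    using that by (simp add: base_level_def rep_zero)
  then show "n = jac (Suc m) \<Longrightarrow> card (deg_idx base_idx n) = (if even m then 1 else 2)"
    using card by simp
  show "card (deg_idx base_idx n) \<in> {1, 2}"
    using card 1 base_level_pos[OF m(2,3)] base_level_le_2[of n "Suc m"] by auto
  assume n: "n = jac m + 1" "odd m"
  have "jac (Suc m) - n = sum jac {..<m}" "n < jac (Suc m)"
    using n jac_Suc[of m] sum_jac_lessThan[of m] jac_pos[of m] by auto
  then show "card (deg_idx base_idx n) = 1"
    using card rep_max[of m] by (simp add: base_level_def)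
qed

text \<open>Level p reaches from about a_p to about a_{p+1}. So besides p = m only two end points
  can fall into the interval: the least degree of p = m + 1, for even m, and the greatest degree 2
  a_{m-1} = a_m + 1 of p = m - 1, for odd m.\<close>

lemma card_top_interval:
  assumes m: "1 \<le> m" "jac m < n" "n \<le> jac (Suc m)"
  shows "finite (deg_idx top_idx n)"
    "card (deg_idx top_idx n) = top_level n m + (if n = jac (Suc m) \<and> even m then 1 else 0)
      + (if n = jac m + 1 \<and> odd m then 1 else 0)"
proof -
  let ?K = "{m - 1, m, Suc m}"
  have 0: "top_level n p = 0" if "p \<notin> ?K" for p
  proof (rule ccontr)
    assume "top_level n p \<noteq> 0"
    note * = top_level_ne_0[OF this]
    have "p \<noteq> m - 1" "p \<noteq> m" "p \<noteq> Suc m" using that by auto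
    then consider "Suc m < p" | "p + 1 < m" by linarith
    then show False
    proof cases
      case 1
      then have "jac (Suc m) < jac p" by (intro jac_strict) auto
      then show False using * m(3) by linarith
    next
      case 2
      then have "jac (Suc p) < jac m" by (intro jac_strict) auto
      then show False using * m(2) jac_Suc[of p] by (auto split: if_splits)
    qed
  qed
  have 1: "top_level n (Suc m) = (if n = jac (Suc m) \<and> even m then 1 else 0)"
  proof (cases "n = jac (Suc m) \<and> even m")
    case True
    then have "2 * jac (Suc m) - n = sum jac {..<Suc m}"
      using sum_jac_lessThan[of "Suc m"] by auto
    then show ?thesis using True m(1) rep_max[of "Suc m"]
      by (simp add: top_level_def del: jac.simps sum.lessThan_Suc)
  next
    case False
    then show ?thesis
      using top_level_ne_0[of n "Suc m"] m(3) by (cases "even m") auto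
  qed
  have 2: "top_level n (m - 1) = (if n = jac m + 1 \<and> odd m then 1 else 0)"
  proof -
    obtain k where k: "m = Suc k" using m(1) by (cases m) auto
    show ?thesis
    proof (cases "n = jac m + 1 \<and> odd m")
      case True
      then have "2 * jac k = n" "k \<noteq> 1"
        using jac_Suc[of k] by (auto simp: k)
      then show ?thesis using True by (simp add: k top_level_def rep_zero)
    next
      case False
      then show ?thesis
        using top_level_ne_0[of n k] m(2) jac_Suc[of k] by (auto simp: k split: if_splits)
    qed
  qed
  show "finite (deg_idx top_idx n)" using card_top(1)[of ?K n] 0 by blast
  have "m - 1 \<noteq> m" "m - 1 \<noteq> Suc m" "m \<noteq> Suc m" using m(1) by auto
  then have "(\<Sum>p\<in>?K. top_level n p) = top_level n (m - 1) + top_level n m + top_level n (Suc m)"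
    by simp
  then show "card (deg_idx top_idx n) = top_level n m + (if n = jac (Suc m) \<and> even m then 1 else 0)
      + (if n = jac m + 1 \<and> odd m then 1 else 0)"
    using card_top(2)[of ?K n] 0 1 2 by simp
qed

lemma card_top_one: "finite (deg_idx top_idx 1)" "card (deg_idx top_idx 1) = 0"
proof -
  have 0: "top_level 1 p = 0" if "p \<notin> {}" for p
  proof (rule ccontr)
    assume nz: "top_level 1 p \<noteq> 0"
    then have "p \<noteq> 1" "jac p \<le> 1" "odd p"
      using top_level_ne_0[OF nz] jac_pos[of p] by (auto simp: top_level_def split: if_splits)
    then show False using jac_strict[of 1 p] by (cases p rule: jac.cases) auto
  qed
  show "finite (deg_idx top_idx 1)" "card (deg_idx top_idx 1) = 0"
    using card_top[of "{}" 1] 0 by auto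
qed

lemma top_level_interval:
  assumes m: "1 \<le> m" "jac m < n" "n \<le> jac (Suc m)"
  shows "n = jac (Suc m) \<Longrightarrow> odd m \<Longrightarrow> top_level n m = 0"
    "n < jac (Suc m) \<or> even m \<Longrightarrow> 1 \<le> top_level n m"
proof -
  show "top_level n m = 0" if "n = jac (Suc m)" "odd m"
    using that top_level_ne_0[of n m] jac_Suc[of m] by auto
  assume *: "n < jac (Suc m) \<or> even m"
  show "1 \<le> top_level n m"
  proof (cases "m = 1")
    case True
    then have "n = 2" using m * by auto
    then show ?thesis using True by (simp add: top_level_def)
  next
    case False
    then show ?thesis
      using m(2,3) * jac_Suc[of m] by (intro top_level_pos) (auto split: if_splits)
  qed
qed

text \<open>The sequence a_p is injective apart from a_0 = a_1, so only degree 2 contains two of the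
  squares v_p^2.\<close>

lemma card_square:
  shows "finite (deg_idx square_idx n)" "card (deg_idx square_idx n) \<le> (if n = 2 then 2 else 1)"
    "n = 2 \<Longrightarrow> card (deg_idx square_idx n) = 2"
proof -
  have eq: "deg_idx square_idx n = (\<lambda>p. ({p + 1}, p + 2)) ` {p. n = 2 * jac p}"
    by (auto simp: deg_idx_def square_idx_def)
  have card: "card (deg_idx square_idx n) = card {p. n = 2 * jac p}"
    unfolding eq by (rule card_image) (auto simp: inj_on_def)
  have fin: "finite {p. n = 2 * jac p}"
    by (rule finite_subset[of _ "{..n}"]) (use jac_ge in \<open>auto intro: le_trans[OF jac_ge]\<close>)
  then show "finite (deg_idx square_idx n)" by (simp add: eq)
  have two: "{p. 2 = 2 * jac p} = {0, 1}"
  proof -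
    have "p < 2" if "jac p = 1" for p using jac_strict[of 1 p] that by (cases "p < 2") auto
    then show ?thesis by (force simp: less_2_cases_iff)
  qed
  show n2: "card (deg_idx square_idx n) = 2" if "n = 2"
    unfolding card unfolding that two by simp
  show "card (deg_idx square_idx n) \<le> (if n = 2 then 2 else 1)"
  proof (cases "n = 2")
    case False
    have "p = q" if "n = 2 * jac p" "n = 2 * jac q" for p q
    proof -
      have "p \<noteq> 0" "q \<noteq> 0" using that(1)[symmetric] that(2)[symmetric] False by (metis jac.simps(1) mult.right_neutral)+
      then have "1 \<le> p" "1 \<le> q" by simp_all
      then show ?thesis using that jac_strict[of p q] jac_strict[of q p] by linarith
    qed
    then have "card {p. n = 2 * jac p} \<le> 1"
      unfolding One_nat_def card_le_Suc0_iff_eq[OF fin] by blast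
    then show ?thesis using False card by simp
  qed (use n2 in simp)
qed

lemma base_top_disjoint: "deg_idx base_idx n \<inter> deg_idx top_idx n = {}"
  by (auto simp: deg_idx_def base_idx_def top_idx_def)

lemma base_square_disjoint: "deg_idx base_idx n \<inter> deg_idx square_idx n = {}"
  by (auto simp: deg_idx_def base_idx_def square_idx_def)

lemma deg_idx_Un: "deg_idx (A \<union> B) n = deg_idx A n \<union> deg_idx B n"
  by (auto simp: deg_idx_def)

lemma card_base_all: "n \<ge> 1 \<Longrightarrow> finite (deg_idx base_idx n) \<and> card (deg_idx base_idx n) \<in> {1, 2}"
  using card_base_one card_base_interval(1) card_base_interval_cases(1) degree_interval[of n]
  by (cases "n = 1") (simp, metis Suc_1 Suc_leI le_neq_implies_less One_nat_def)

lemma card_idx_not_2: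
  assumes "n \<ge> 1"
  shows "finite (deg_idx (lie_idx False) n)" "card (deg_idx (lie_idx False) n) \<in> {2, 3, 4}"
    "card (deg_idx (lie_idx False) 5) = 4" "card (deg_idx (lie_idx False) 1) = 2"
proof -
  have fin: "finite (deg_idx top_idx n)" if "n \<ge> 1" for n
  proof (cases "n = 1")
    case False
    then have "2 \<le> n" using that by simp
    then show ?thesis using degree_interval card_top_interval(1) by metis
  qed (use card_top_one in simp)
  have card: "card (deg_idx (lie_idx False) n) = card (deg_idx base_idx n) + card (deg_idx top_idx n)"
    if "n \<ge> 1" for n
    using card_base_all[OF that] fin[OF that] base_top_disjoint[of n]
    by (simp add: lie_idx_def deg_idx_Un card_Un_disjoint)
  show "finite (deg_idx (lie_idx False) n)"
    using card_base_all[OF assms] fin[OF assms] by (simp add: lie_idx_def deg_idx_Un)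
  show one: "card (deg_idx (lie_idx False) 1) = 2"
    using card[of 1] card_base_one card_top_one by simp
  show "card (deg_idx (lie_idx False) n) \<in> {2, 3, 4}"
  proof (cases "n = 1")
    case False
    then obtain m where m: "1 \<le> m" "jac m < n" "n \<le> jac (Suc m)"
      using degree_interval[of n] assms by auto
    note base = card_base_interval_cases[OF m]
    note top = card_top_interval(2)[OF m]
    note lev = top_level_interval[OF m] top_level_le_2[of n m]
    have ne: "n = jac (Suc m) \<Longrightarrow> odd m \<Longrightarrow> n \<noteq> jac m + 1"
      using jac_Suc[of m] jac_pos[of m] by auto
    \<comment> \<open>A surplus top monomial only meets degrees with a single base monomial, and the
      right end point with odd \<open>m\<close> has two base monomials but no top ones. So the total
      stays between 2 and 4.\<close>
    consider "n = jac (Suc m)" "even m" | "n = jac (Suc m)" "odd m"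
      | "n < jac (Suc m)" "n = jac m + 1" "odd m"
      | "n < jac (Suc m)" "\<not> (n = jac m + 1 \<and> odd m)"
      using m(3) by linarith
    then show ?thesis
      using base top lev ne card[OF assms] by cases auto
  qed (use one in simp)
  \<comment> \<open>The value 4 is attained in degree 5, by v_3, x_0 x_3 v_4, x_1 x_3 v_4 and x_0
    x_1 x_2 x_4 v_5.\<close>
  have 5: "jac (Suc 2) = 5" "jac 2 < 5" by (simp_all add: numeral_2_eq_2)
  have "card (deg_idx base_idx 5) = 1"
    using card_base_interval_cases(2)[of 2 5] 5 by simp
  moreover have "top_level 5 2 = 2"
    by (simp add: top_level_def numeral_2_eq_2 rep_Suc rep_0)
  then have "card (deg_idx top_idx 5) = 3"
    using card_top_interval(2)[of 2 5] 5 by simp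
  ultimately show "card (deg_idx (lie_idx False) 5) = 4" using card[of 5] by simp
qed

lemma card_base_two: "card (deg_idx base_idx 2) = 1"
  using card_base_interval_cases(3)[of 1 2] by (simp add: numeral_2_eq_2)

lemma card_idx_square:
  assumes "n \<ge> 1"
  shows "finite (deg_idx (base_idx \<union> square_idx) n)" "card (deg_idx (base_idx \<union> square_idx) n) \<in> {1, 2, 3}"
    "card (deg_idx (base_idx \<union> square_idx) 2) = 3"
proof -
  have card: "card (deg_idx (base_idx \<union> square_idx) n) = card (deg_idx base_idx n) + card (deg_idx square_idx n)"
    if "n \<ge> 1" for n
    using card_base_all[OF that] card_square(1) base_square_disjoint[of n]
    by (simp add: deg_idx_Un card_Un_disjoint)
  show "finite (deg_idx (base_idx \<union> square_idx) n)"
    using card_base_all[OF assms] card_square(1) by (simp add: deg_idx_Un)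
  \<comment> \<open>The three monomials are x_0 v_2 and the squares v_0^2 = x_1 v_2, v_1^2 = x_2
    v_3.\<close>
  show *: "card (deg_idx (base_idx \<union> square_idx) 2) = 3"
    using card[of 2] card_base_two card_square(3)[of 2] by simp
  show "card (deg_idx (base_idx \<union> square_idx) n) \<in> {1, 2, 3}"
    using card[OF assms] card_base_all[OF assms] card_square(2)[of n] * by (cases "n = 2") auto
qed

section \<open>Linear independence and closure under the supercommutator\<close>

lemma app_sum: "app (sum f F) g = (\<Sum>x\<in>F. app (f x) g)"
  by (induction F rule: infinite_finite_induct) auto

lemma gcoeff_sum: "gcoeff (sum f F) A = (\<Sum>x\<in>F. gcoeff (f x) A)"
  by (induction F rule: infinite_finite_induct) auto

lemma gcoeff_xmon_one:
  "finite T \<Longrightarrow> gcoeff (app (xmon T) 1 :: 'k::field grassmann) A = (if A = T then 1 else 0)"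
proof (induction T arbitrary: A rule: finite_linorder_min_induct)
  case (insert i T)
  have i: "i \<notin> T" using insert.hyps(2) by blast
  have x: "xmon (insert i T) = xop i * (xmon T :: 'k endo)"
    using insert.hyps by (intro xmon_insert) auto
  show ?case
  proof (cases "finite A")
    case True
    have *: "{b \<in> insert i T. b < i} = {}" using insert.hyps(2) by force
    have **: "insert i T - {i} = T" using i by blast
    have coeff: "gcoeff (app (xmon (insert i T)) 1 :: 'k grassmann) A =
        (if i \<in> A then (-1) ^ card {b \<in> A. b < i} * (if A - {i} = T then 1 else 0) else 0)"
      by (simp only: x app_simps app_lmul gcoeff_gvar_mult[OF True] insert.IH)
    show ?thesis
    proof (cases "A = insert i T")
      case True
      show ?thesis unfolding coeff unfolding True * ** by simp
    next
      case False
      then have "\<not> (i \<in> A \<and> A - {i} = T)" by blast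
      then show ?thesis unfolding coeff using False by auto
    qed
  next
    case False
    then show ?thesis using insert.hyps(1) by (auto simp: gcoeff_infinite)
  qed
qed (simp add: one_grassmann.rep_eq)

lemma gcoeff_mon_gvar:
  assumes "finite T" "j \<le> m"
  shows "gcoeff (app (mon T m) (gvar j) :: 'k::field grassmann) A = (if j = m \<and> A = T then 1 else 0)"
  using assms by (auto simp: mon_def v_gvar gcoeff_xmon_one)

text \<open>Take the least pivot index m0 with a nonzero coefficient and evaluate at x_{m0}. Pivot
  elements of larger index kill this letter and v_{m0} sends it to 1, so the distinct Grassmann
  monomials x_T with their coefficients are left.\<close>

lemma mon_combination_zero:
  fixes u :: "nat set \<times> nat \<Rightarrow> 'k::field"
  assumes F: "finite F" "\<And>T m. (T, m) \<in> F \<Longrightarrow> finite T"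
    and sum: "(\<Sum>(T, m)\<in>F. endo_scale (u (T, m)) (mon T m)) = 0" and p: "p \<in> F"
  shows "u p = 0"
proof (rule ccontr)
  assume "u p \<noteq> 0"
  define m0 where "m0 = (LEAST m. \<exists>T. (T, m) \<in> F \<and> u (T, m) \<noteq> 0)"
  have "\<exists>T. (T, snd p) \<in> F \<and> u (T, snd p) \<noteq> 0"
    using p \<open>u p \<noteq> 0\<close> by (intro exI[of _ "fst p"]) simp
  then have "\<exists>T. (T, m0) \<in> F \<and> u (T, m0) \<noteq> 0"
    unfolding m0_def by (rule LeastI)
  then obtain T0 where T0: "(T0, m0) \<in> F" "u (T0, m0) \<noteq> 0" by blast
  have least: "u (T, m) = 0" if "(T, m) \<in> F" "m < m0" for T m
    using not_less_Least[of m "\<lambda>m. \<exists>T. (T, m) \<in> F \<and> u (T, m) \<noteq> 0"] that m0_def by blast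
  have "0 = gcoeff (app (\<Sum>(T, m)\<in>F. endo_scale (u (T, m)) (mon T m)) (gvar m0)) T0"
    by (simp add: sum)
  also have "\<dots> = (\<Sum>q\<in>F. u q * gcoeff (app (mon (fst q) (snd q)) (gvar m0)) T0)"
    by (simp add: app_sum gcoeff_sum case_prod_beta)
  also have "\<dots> = (\<Sum>q\<in>F. if q = (T0, m0) then u q else 0)"
  proof (rule sum.cong[OF refl])
    fix q assume q: "q \<in> F"
    show "u q * gcoeff (app (mon (fst q) (snd q)) (gvar m0)) T0 = (if q = (T0, m0) then u q else 0)"
    proof (cases "m0 \<le> snd q")
      case True
      then show ?thesis
        using q F(2)[of "fst q" "snd q"]
        by (auto simp: gcoeff_mon_gvar prod_eq_iff)
    next
      case False
      then show ?thesis using least[of "fst q" "snd q"] q by auto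
    qed
  qed
  also have "\<dots> = u (T0, m0)" using F(1) T0(1) by simp
  finally show False using T0(2) by simp
qed

lemma inj_on_mon:
  assumes I: "\<And>T m. (T, m) \<in> I \<Longrightarrow> finite T"
  shows "inj_on (\<lambda>(T, m). mon T m :: 'k::field endo) I"
proof (rule inj_onI, rule ccontr)
  fix p q assume pq: "p \<in> I" "q \<in> I" "p \<noteq> q"
    "(\<lambda>(T, m). mon T m :: 'k endo) p = (\<lambda>(T, m). mon T m) q"
  let ?u = "\<lambda>r. if r = p then 1 else -1 :: 'k"
  have "?u p = 0"
  proof (rule mon_combination_zero[of "{p, q}" ?u p])
    show "(\<Sum>(T, m)\<in>{p, q}. endo_scale (?u (T, m)) (mon T m)) = 0"
      using pq(3,4) by (simp add: case_prod_beta endo.scale_minus_left)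
  qed (use pq(1,2) I in blast)+
  then show False by simp
qed

lemma independent_mon:
  assumes I: "\<And>T m. (T, m) \<in> I \<Longrightarrow> finite T"
  shows "endo.independent ((\<lambda>(T, m). mon T m :: 'k::field endo) ` I)"
proof
  let ?f = "\<lambda>(T, m). mon T m :: 'k endo"
  assume "endo.dependent (?f ` I)"
  then obtain t u where t: "finite t" "t \<subseteq> ?f ` I" "(\<Sum>x\<in>t. endo_scale (u x) x) = 0"
    and u: "\<exists>x\<in>t. u x \<noteq> 0"
    unfolding endo.dependent_explicit by blast
  obtain F where F: "F \<subseteq> I" "finite F" "t = ?f ` F"
    using finite_subset_image[OF t(1,2)] by blast
  have inj: "inj_on ?f F" by (rule inj_on_subset[OF inj_on_mon[OF I] F(1)])
  have "(\<Sum>x\<in>t. endo_scale (u x) x) = (\<Sum>p\<in>F. endo_scale (u (?f p)) (?f p))"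
    unfolding F(3) by (subst sum.reindex[OF inj]) simp
  then have "(\<Sum>(T, m)\<in>F. endo_scale (u (?f (T, m))) (mon T m)) = 0"
    using t(3) by (simp add: case_prod_beta)
  then have "(\<lambda>p. u (?f p)) p = 0" if "p \<in> F" for p
    using F(1) I by (intro mon_combination_zero[OF F(2) _ _ that]) blast+
  then show False using u F(3) by blast
qed

lemma (in vector_space) span_Int_disjoint:
  assumes "independent Z" "A \<subseteq> Z" "B \<subseteq> Z" "A \<inter> B = {}"
  shows "span A \<inter> span B = {0}"
proof (intro equalityI subsetI)
  fix x assume "x \<in> span A \<inter> span B"
  then have x: "x \<in> span A" "x \<in> span B" by auto
  have "representation A x b = 0" for b
    using representation_extend[OF assms(1) x(1) assms(2)] representation_extend[OF assms(1) x(2) assms(3)]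
      representation_ne_zero[of A x b] representation_ne_zero[of B x b] assms(4) by (metis disjoint_iff)
  then have "x = 0"
    using sum_nonzero_representation_eq[OF independent_mono[OF assms(1,2)] x(1)] by simp
  then show "x \<in> {0}" by simp
qed (simp add: span_zero)

section \<open>Bilinearity, parity and Jacobi identity of the supercommutator\<close>

lemma endo_scale_mult [simp]:
  "endo_scale c x * y = endo_scale c (x * y)" "x * endo_scale c y = endo_scale c (x * y)"
  by (rule endo_eqI; simp add: app_linear)+

lemma op_part_linear:
  "op_part d (a + b) = op_part d a + op_part d b" "op_part d (endo_scale c a) = endo_scale c (op_part d a)"
  by (simp_all add: op_part_def algebra_simps endo.scale_right_distrib)

lemma scomm_linear:
  "scomm (a + a') b = scomm a b + scomm a' b" "scomm a (b + b') = scomm a b + scomm a b'"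
  "scomm (endo_scale c a) b = endo_scale c (scomm a b)" "scomm a (endo_scale c b) = endo_scale c (scomm a b)"
  by (simp_all add: scomm_def op_part_linear algebra_simps endo.scale_right_distrib endo.scale_right_diff_distrib)

lemma scomm_zero: "scomm 0 b = 0" "scomm a 0 = 0"
  using scomm_linear(3)[of 0 0 b] scomm_linear(4)[of a 0 0] by simp_all

lemma scomm_span:
  assumes S: "endo.subspace S" and AB: "\<And>a b. a \<in> A \<Longrightarrow> b \<in> B \<Longrightarrow> scomm a b \<in> S"
    and a: "a \<in> endo.span A" and b: "b \<in> endo.span B"
  shows "scomm a b \<in> S"
proof -
  have *: "scomm a b \<in> S" if "a \<in> A" for a
    using b
  proof (induction rule: endo.span_induct_alt)
    case (step c x y)
    then show ?case
      using AB[OF that] S by (simp add: scomm_linear endo.subspace_add endo.subspace_scale)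
  qed (simp add: scomm_zero endo.subspace_0[OF S])
  show ?thesis
    using a
  proof (induction rule: endo.span_induct_alt)
    case (step c x y)
    then show ?case
      using * S by (simp add: scomm_linear endo.subspace_add endo.subspace_scale)
  qed (simp add: scomm_zero endo.subspace_0[OF S])
qed

lemma op_space_scomm:
  assumes "a \<in> op_space d" "b \<in> op_space e"
  shows "scomm a b \<in> op_space (d + e)"
proof -
  have ab: "a * b \<in> op_space (d + e)" and ba: "b * a \<in> op_space (d + e)"
    using op_space_mult[OF assms] op_space_mult[OF assms(2,1)] by (simp_all add: add.commute)
  then show ?thesis
    using endo.subspace_add[OF subspace_op_space ab ba] endo.subspace_diff[OF subspace_op_space ab ba]
    by (cases "even (d * e)") (simp_all add: scomm_hom[OF assms])
qed

lemma super_jacobi: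
  assumes a: "a \<in> op_space d" and b: "b \<in> op_space e" and c: "c \<in> op_space f"
  shows "scomm (scomm a b) c = scomm a (scomm b c) - (-1) ^ (d * e) * scomm b (scomm a c)"
  unfolding scomm_hom[OF op_space_scomm[OF a b] c] scomm_hom[OF a op_space_scomm[OF b c]]
    scomm_hom[OF b op_space_scomm[OF a c]]
  unfolding scomm_hom[OF a b] scomm_hom[OF a c] scomm_hom[OF b c]
  by (cases "even d"; cases "even e"; cases "even f") (simp_all add: algebra_simps)

lemma scomm_antisym:
  assumes a: "a \<in> op_space d" and b: "b \<in> op_space e"
  shows "scomm a b = scomm b a \<or> scomm a b = - scomm b a"
  by (cases "even d"; cases "even e") (simp_all add: scomm_hom[OF a b] scomm_hom[OF b a])

text \<open>For odd v the two mixed terms of the double bracket cancel, so (ad v)^2 = ad(v^2) in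
  every characteristic. This reduces brackets with squares to brackets with pivot elements.\<close>

lemma scomm_v_sq:
  assumes b: "b \<in> op_space e"
  shows "scomm (v k * v k) b = scomm (v k) (scomm (v k) b)"
  unfolding scomm_hom[OF op_space_mult[OF v_op_space v_op_space] b]
    scomm_hom[OF v_op_space op_space_scomm[OF v_op_space b]]
  unfolding scomm_hom[OF v_op_space b]
  by (cases "even e") (simp_all add: algebra_simps)

text \<open>\<open>piece t n\<close> is the candidate for the component of degree \<open>n\<close>,
  and \<open>tail t k\<close> below is the candidate for the \<open>k\<close>-th term of the lower
  central series.\<close>

definition piece :: "alg_type \<Rightarrow> nat \<Rightarrow> 'k::field endo set" where
  "piece t n = endo.span (mons (idx t ((2 :: 'k) = 0)) n)"

definition tail :: "alg_type \<Rightarrow> nat \<Rightarrow> 'k::field endo set" where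
  "tail t k = endo.span (\<Union>n\<in>{k..}. mons (idx t ((2 :: 'k) = 0)) n)"

lemma idx_Bracket [simp]: "idx Bracket c = lie_idx c"
  by (simp add: idx_def)

lemma finite_idx: "(T, m) \<in> idx t c \<Longrightarrow> finite T"
  by (rule finite_subset[OF idx_subset finite_lessThan])

lemma jac_odd: "odd (jac m)"
  by (induction m rule: jac.induct) auto

lemma sum_jac_parity: "finite T \<Longrightarrow> even (sum jac T) \<longleftrightarrow> even (card T)"
  by (induction T rule: finite_induct) (auto simp: jac_odd)

text \<open>All a_m are odd, so modulo 2 the weight counts the odd factors: the parity of the degree
  is the superparity.\<close>

lemma mons_op_space:
  assumes "b \<in> mons (idx t c) n"
  shows "b \<in> op_space n"
proof -
  obtain T m where b: "b = mon T m" "(T, m) \<in> idx t c" "n + sum jac T = jac m"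
    using assms by (auto simp: mons_def deg_idx_def)
  have fin: "finite T" using b(2) by (rule finite_idx)
  have "even (Suc (card T)) = even n"
    using jac_odd[of m] sum_jac_parity[OF fin] unfolding b(3)[symmetric] by auto
  then show ?thesis
    using op_space_cong'[OF mon_op_space[OF fin]] b(1) by blast
qed

lemma subspace_piece: "endo.subspace (piece t n)"
  by (simp add: piece_def)

lemma piece_op_space: "x \<in> piece t n \<Longrightarrow> x \<in> op_space n"
  unfolding piece_def
  by (rule subsetD[OF endo.span_minimal[OF subsetI[OF mons_op_space] subspace_op_space]])

lemma mons_lie_subset: "mons (lie_idx c) n \<subseteq> mons (idx t c) n"
  by (auto simp: mons_def deg_idx_def idx_def)

lemma piece_Bracket_subset: "piece Bracket n \<subseteq> piece t n"
  unfolding piece_def idx_Bracket by (intro endo.span_mono mons_lie_subset)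

lemma v_piece: "v k \<in> piece t (jac k)"
proof -
  have "(mon {} k :: 'a endo) \<in> mons (lie_idx ((2 :: 'a) = 0)) (jac k)"
    by (intro monsI lie_idx_base) simp_all
  then have "(v k :: 'a endo) \<in> piece Bracket (jac k)"
    by (simp add: piece_def endo.span_base)
  then show ?thesis using piece_Bracket_subset by blast
qed

lemma mons_one: "mons (lie_idx c) 1 = {v 0, v 1}"
proof -
  have "{({}, 0), ({}, 1)} \<subseteq> deg_idx (lie_idx c) 1"
    by (auto simp: deg_idx_def lie_idx_base)
  moreover have "finite (deg_idx (lie_idx c) 1)" "card (deg_idx (lie_idx c) 1) = 2"
    using card_base_one card_idx_not_2(1,4)[of 1] by (cases c; simp add: lie_idx_def)+
  ultimately have "deg_idx (lie_idx c) 1 = {({}, 0), ({}, 1)}"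
    by (intro card_subset_eq[symmetric]) auto
  then show ?thesis by (simp add: mons_def)
qed

lemma piece_one: "piece Bracket 1 = endo.span {v 0, v 1}"
  by (simp only: piece_def idx_Bracket mons_one)

lemma scomm_v_piece: "i \<le> 1 \<Longrightarrow> b \<in> piece Bracket n \<Longrightarrow> scomm (v i) b \<in> piece Bracket (n + 1)"
proof (rule scomm_span[OF subspace_piece])
  show "v i \<in> endo.span {v i}" by (simp add: endo.span_base)
  show "b \<in> piece Bracket n \<Longrightarrow> b \<in> endo.span (mons (lie_idx ((2 :: 'a) = 0)) n)" by (simp add: piece_def)
  show "scomm a b \<in> piece Bracket (n + 1)"
    if "i \<le> 1" "a \<in> {v i}" "b \<in> mons (lie_idx ((2 :: 'a) = 0)) n" for a b :: "'a endo"
    using that scomm_v_mons[of "(2 :: 'a) = 0" i b n] by (simp add: piece_def)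
qed

lemma piece_Suc_span:
  "n \<ge> 1 \<Longrightarrow> piece Bracket (n + 1) \<subseteq>
    (endo.span {scomm (v i) b | i b. i \<le> 1 \<and> b \<in> mons (lie_idx ((2 :: 'k) = 0)) n} :: 'k::field endo set)"
  unfolding piece_def idx_Bracket
  by (rule endo.span_minimal) (use mons_reach[OF refl, of n, where ?'k = 'k] in auto)

text \<open>Induction on the degree of the first factor. By reachability it is a combination of
  [v_i, z] with z of lower degree, and super Jacobi turns [[v_i, z], y] into brackets with v_i and
  with z only.\<close>

lemma scomm_piece_Bracket:
  "m \<ge> 1 \<Longrightarrow> n \<ge> 1 \<Longrightarrow> a \<in> piece Bracket m \<Longrightarrow> b \<in> piece Bracket n \<Longrightarrow> scomm a b \<in> (piece Bracket (m + n) :: 'k::field endo set)"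
proof (induction m arbitrary: a b n rule: nat_induct_at_least[of 1])
  case base
  show ?case
  proof (rule scomm_span[OF subspace_piece])
    show "a \<in> endo.span {v 0, v 1}" using base.prems(2) by (simp only: piece_one)
    show "b \<in> endo.span (piece Bracket n)" using base.prems(3) by (rule endo.span_base)
    show "scomm x y \<in> piece Bracket (1 + n)"
      if "x \<in> {v 0, v 1}" "y \<in> piece Bracket n" for x y :: "'k endo"
      using that scomm_v_piece[of 0 y n] scomm_v_piece[of 1 y n] by auto
  qed
next
  case (Suc m)
  let ?A = "{scomm (v i) b | i b. i \<le> 1 \<and> b \<in> mons (lie_idx ((2 :: 'k) = 0)) m} :: 'k endo set"
  show ?case
  proof (rule scomm_span[OF subspace_piece])
    show "a \<in> endo.span ?A" using piece_Suc_span[OF Suc.hyps] Suc.prems(2) by auto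
    show "b \<in> endo.span (piece Bracket n)" using Suc.prems(3) by (rule endo.span_base)
    fix x y assume "x \<in> ?A" and y: "y \<in> (piece Bracket n :: 'k endo set)"
    then obtain i z where x: "x = scomm (v i) z" "i \<le> 1" and z: "z \<in> piece Bracket m"
      by (auto simp: piece_def intro: endo.span_base)
    have "scomm z y \<in> piece Bracket (m + n)"
      by (rule Suc.IH[OF Suc.prems(1) z y])
    then have 1: "scomm (v i) (scomm z y) \<in> piece Bracket (m + n + 1)"
      by (rule scomm_v_piece[OF x(2)])
    have "scomm z (scomm (v i) y) \<in> piece Bracket (m + (n + 1))"
      by (rule Suc.IH[OF _ z scomm_v_piece[OF x(2) y]]) simp
    then have 2: "scomm z (scomm (v i) y) \<in> piece Bracket (m + n + 1)" by (simp only: add.assoc)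
    have "scomm x y = scomm (v i) (scomm z y) - (-1) ^ (1 * m) * scomm z (scomm (v i) y)"
      unfolding x(1) by (rule super_jacobi[OF v_op_space piece_op_space[OF z] piece_op_space[OF y]])
    then show "scomm x y \<in> piece Bracket (Suc m + n)"
      using endo.subspace_diff[OF subspace_piece 1 2] endo.subspace_add[OF subspace_piece 1 2]
      by (cases "even m") simp_all
  qed
qed

lemma mons_idx_cases:
  assumes "b \<in> mons (idx t c) n"
  obtains "b \<in> mons (lie_idx c) n" | k where "t \<noteq> Bracket" "n = 2 * jac k" "b = v k * v k"
proof -
  obtain T m where b: "b = mon T m" "(T, m) \<in> idx t c" "n + sum jac T = jac m"
    using assms by (auto simp: mons_def deg_idx_def)
  consider "(T, m) \<in> lie_idx c" | k where "t \<noteq> Bracket" "T = {k + 1}" "m = k + 2"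
    using b(2) by (auto simp: idx_def square_idx_def split: if_splits)
  then show ?thesis
  proof cases
    case 1
    then show ?thesis using that(1) b monsI by blast
  next
    case (2 k)
    have "b = v k * v k"
      using mon_insert[of "{}" "k + 1" "k + 2", where ?'a = 'a] by (simp add: b(1) 2 v_sq)
    then show ?thesis using that(2)[of k] 2 b(3) by simp
  qed
qed

text \<open>Bracketing with v_k^2 is bracketing twice with v_k. So all brackets of basis elements
  land in the part spanned by \<open>lie_idx\<close>, even if both arguments are squares.\<close>

lemma scomm_piece:
  assumes mn: "m \<ge> 1" "n \<ge> 1" and a: "a \<in> piece t m" and b: "b \<in> piece t n"
  shows "scomm a b \<in> (piece t (m + n) :: 'k::field endo set)"
proof -
  let ?c = "(2 :: 'k) = 0"
  \<comment> \<open>The hypothesis concerns [v_k, y] and not y, so that it also covers a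
    \<open>y\<close> that is itself a square and need not lie in
    \<open>piece Bracket\<close>.\<close>
  have square: "scomm (v k * v k) y \<in> piece Bracket (2 * jac k + n)"
    if "y \<in> op_space n" "scomm (v k) y \<in> piece Bracket (jac k + n)" for y :: "'k endo" and k n
    using scomm_piece_Bracket[OF _ _ v_piece[of k] that(2)] jac_pos[of k]
    unfolding scomm_v_sq[OF that(1)] by (simp add: mult_2 add.assoc)
  have lie: "scomm x y \<in> piece Bracket (m + n)"
    if x: "m \<ge> 1" "x \<in> piece Bracket m" and n: "n \<ge> 1" and y: "y \<in> mons (idx t ?c) n" for x y :: "'k endo" and m n
    using y
  proof (cases rule: mons_idx_cases)
    case 1
    then have "y \<in> piece Bracket n" by (simp add: piece_def endo.span_base)
    then show ?thesis by (rule scomm_piece_Bracket[OF x(1) n x(2)])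
  next
    case (2 k)
    have "scomm y x \<in> piece Bracket (m + n)"
      unfolding 2 using square[OF piece_op_space[OF x(2)] scomm_piece_Bracket[OF _ x(1) v_piece x(2)], of k]
        jac_pos[of k] by (simp add: add.commute Suc_le_eq)
    then show ?thesis
      using scomm_antisym[OF piece_op_space[OF x(2)] mons_op_space[OF y]] endo.subspace_neg[OF subspace_piece]
      by metis
  qed
  have 2: "scomm x y \<in> piece Bracket (m + n)"
    if x: "x \<in> mons (idx t ?c) m" and y: "y \<in> mons (idx t ?c) n" for x y :: "'k endo"
    using x
  proof (cases rule: mons_idx_cases)
    case 1
    then have "x \<in> piece Bracket m" by (simp add: piece_def endo.span_base)
    then show ?thesis by (rule lie[OF mn(1) _ mn(2) y])
  next
    case (2 k)
    then show ?thesis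
      unfolding 2 by (intro square lie v_piece mons_op_space[OF y]) (use jac_pos[of k] mn y in \<open>simp_all add: Suc_le_eq\<close>)
  qed
  show ?thesis
    by (rule scomm_span[OF subspace_piece _ a[unfolded piece_def] b[unfolded piece_def]])
      (use 2 piece_Bracket_subset in blast)
qed

section \<open>Components, generated algebra and lower central series\<close>

lemma neg_char_2: "(2 :: 'k::field) = 0 \<Longrightarrow> - x = (x :: 'k endo)"
  using two_mult[of x] by (simp add: mult_2 minus_unique)

lemma scomm_char_2:
  assumes "(2 :: 'k::field) = 0" "a \<in> op_space d" "b \<in> op_space e"
  shows "scomm a b = a * b + b * (a :: 'k endo)"
  using scomm_hom[OF assms(2,3)] neg_char_2[OF assms(1), of "b * a"]
  by (cases "even (d * e)") auto

text \<open>The least letter x_k can be moved, up to sign, across the remaining letters and v_m,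
  since k < m; in the square it meets its second copy.\<close>

lemma mon_sq:
  assumes "T \<subseteq> {..<m}" "T \<noteq> {}"
  shows "mon T m * mon T m = (0 :: 'k::field endo)"
proof -
  have fin: "finite T" using assms(1) finite_subset by blast
  define k where "k = Min T"
  define U where "U = T - {k}"
  have k: "k \<in> T" "\<And>j. j \<in> T \<Longrightarrow> k \<le> j" using fin assms(2) by (simp_all add: k_def)
  have U: "finite U" "k \<notin> U" "\<And>j. j \<in> U \<Longrightarrow> k < j" "T = insert k U"
    using k fin by (auto simp: U_def order.order_iff_strict)
  have km: "k < m" using k(1) assms(1) by auto
  have T: "mon T m = (xop k * mon U m :: 'k endo)"
    unfolding U(4) using U(1,3) by (rule mon_insert)
  have "xop k * mon U m = (mon U m * xop k :: 'k endo) \<or> xop k * mon U m = - (mon U m * xop k :: 'k endo)"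
    using xop_mon[OF U(1,2) km, where ?'a = 'k] by (cases "even (card U)") simp_all
  then have "xop k * mon U m * (xop k * mon U m) = mon U m * xop k * (xop k * mon U m :: 'k endo) \<or>
      xop k * mon U m * (xop k * mon U m) = - (mon U m * xop k) * (xop k * mon U m :: 'k endo)"
    by (elim disjE; metis)
  moreover have "mon U m * xop k * (xop k * mon U m) = mon U m * (xop k * xop k) * (mon U m :: 'k endo)"
    by (simp only: mult.assoc)
  ultimately show ?thesis by (auto simp: T xop_sq)
qed

text \<open>Polarization: the square of a combination consists of squares of the generators and of
  the mixed sums b b' + b' b, which are brackets in characteristic 2.\<close>

lemma square_span:
  fixes S :: "'k::field endo set"
  assumes S: "endo.subspace S" and sq: "\<And>b. b \<in> A \<Longrightarrow> b * b \<in> S"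
    and mixed: "\<And>b b'. b \<in> A \<Longrightarrow> b' \<in> A \<Longrightarrow> b * b' + b' * b \<in> S" and a: "a \<in> endo.span A"
  shows "a * a \<in> S"
proof -
  have *: "b * y + y * b \<in> S" if "b \<in> A" "y \<in> endo.span A" for b y
    using that(2)
  proof (induction rule: endo.span_induct_alt)
    case (step c x y)
    have "b * (endo_scale c x + y) + (endo_scale c x + y) * b =
        endo_scale c (b * x + x * b) + (b * y + y * b)"
      by (simp add: algebra_simps endo.scale_right_distrib)
    then show ?case
      using mixed[OF that(1) step.hyps(1)] step.IH S by (simp add: endo.subspace_add endo.subspace_scale)
  qed (simp add: endo.subspace_0[OF S])
  have "a \<in> endo.span A \<and> a * a \<in> S"
    using a
  proof (induction rule: endo.span_induct_alt)
    case (step c x y)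
    have "(endo_scale c x + y) * (endo_scale c x + y) =
        endo_scale (c * c) (x * x) + endo_scale c (x * y + y * x) + y * y"
      by (simp add: algebra_simps endo.scale_right_distrib)
    moreover have "endo_scale (c * c) (x * x) + endo_scale c (x * y + y * x) + y * y \<in> S"
    proof -
      have "x * y + y * x \<in> S" "y * y \<in> S"
        using *[OF step.hyps(1)] step.IH by simp_all
      then show ?thesis
        using endo.subspace_add[OF S endo.subspace_add[OF S endo.subspace_scale[OF S sq[OF step.hyps(1)]]
            endo.subspace_scale[OF S]]] by blast
    qed
    ultimately show ?case
      using step by (simp add: endo.span_add endo.span_scale endo.span_base)
  qed (simp add: endo.subspace_0[OF S] endo.span_zero)
  then show ?thesis by simp
qed

text \<open>Only T = {} gives a nonzero square, namely the element of \<open>square_idx\<close> for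
  v_m. No parity is required of \<open>b\<close>, which is why both square-closed types share one
  basis.\<close>

lemma mons_square:
  assumes c: "(2 :: 'k::field) = 0" and t: "t \<noteq> Bracket"
    and b: "b \<in> mons (idx t ((2 :: 'k) = 0)) n"
  shows "b * b \<in> (piece t (2 * n) :: 'k endo set)"
proof -
  obtain T m where b: "b = mon T m" "(T, m) \<in> idx t ((2 :: 'k) = 0)" "n + sum jac T = jac m"
    using b by (auto simp: mons_def deg_idx_def)
  show ?thesis
  proof (cases "T = {}")
    case True
    have "(mon {m + 1} (m + 2) :: 'k endo) \<in> mons (idx t ((2 :: 'k) = 0)) (2 * n)"
      using t b(3) True by (intro monsI) (auto simp: idx_def square_idx_def)
    moreover have "b * b = mon {m + 1} (m + 2)"
      using mon_insert[of "{}" "m + 1" "m + 2", where ?'a = 'k] by (simp add: b(1) True v_sq)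
    ultimately show ?thesis by (simp add: piece_def endo.span_base)
  next
    case False
    then show ?thesis
      using mon_sq[OF idx_subset[OF b(2)], where ?'k = 'k] b(1) by (simp add: piece_def endo.span_zero)
  qed
qed

lemma subspace_tail: "endo.subspace (tail t k)"
  by (simp add: tail_def)

lemma mons_tail: "k \<le> n \<Longrightarrow> b \<in> mons (idx t ((2 :: 'k::field) = 0)) n \<Longrightarrow> b \<in> (tail t k :: 'k endo set)"
  unfolding tail_def by (intro endo.span_base) auto

lemma piece_tail: "k \<le> n \<Longrightarrow> piece t n \<subseteq> (tail t k :: 'k::field endo set)"
  unfolding piece_def by (rule endo.span_minimal) (use mons_tail subspace_tail in blast)+

lemma tail_antimono: "k \<le> l \<Longrightarrow> tail t l \<subseteq> tail t k"
  unfolding tail_def by (rule endo.span_mono) force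

lemma tail_minimal:
  assumes "endo.subspace S" "\<And>n. k \<le> n \<Longrightarrow> piece t n \<subseteq> S"
  shows "tail t k \<subseteq> (S :: 'k::field endo set)"
  unfolding tail_def
proof (rule endo.span_minimal[OF _ assms(1)])
  show "(\<Union>n\<in>{k..}. mons (idx t ((2 :: 'k) = 0)) n) \<subseteq> S"
    using assms(2) by (auto simp: piece_def intro: endo.span_base)
qed

lemma tail_eq: "tail t k = endo.span (\<Union>n\<in>{k..}. piece t n)"
proof (rule antisym)
  show "tail t k \<subseteq> endo.span (\<Union>n\<in>{k..}. piece t n)"
    by (rule tail_minimal) (auto intro: endo.span_base)
  show "endo.span (\<Union>n\<in>{k..}. piece t n) \<subseteq> tail t k"
    by (rule endo.span_minimal[OF _ subspace_tail]) (use piece_tail in fastforce)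
qed

lemma scomm_mons:
  assumes "m \<ge> 1" "n \<ge> 1" "a \<in> mons (idx t ((2 :: 'k::field) = 0)) m" "b \<in> mons (idx t ((2 :: 'k) = 0)) n"
  shows "scomm a b \<in> (piece t (m + n) :: 'k endo set)"
  using assms by (intro scomm_piece) (simp_all add: piece_def endo.span_base)

lemma scomm_tail:
  assumes "j \<ge> 1" "k \<ge> 1" "a \<in> tail t j" "b \<in> tail t k"
  shows "scomm a b \<in> (tail t (j + k) :: 'k::field endo set)"
proof (rule scomm_span[OF subspace_tail _ assms(3,4)[unfolded tail_def]])
  fix x y :: "'k endo"
  assume "x \<in> (\<Union>n\<in>{j..}. mons (idx t ((2 :: 'k) = 0)) n)" "y \<in> (\<Union>n\<in>{k..}. mons (idx t ((2 :: 'k) = 0)) n)"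
  then obtain m n where mn: "j \<le> m" "k \<le> n" and xy: "x \<in> mons (idx t ((2 :: 'k) = 0)) m" "y \<in> mons (idx t ((2 :: 'k) = 0)) n"
    by auto
  have "scomm x y \<in> piece t (m + n)"
    using assms(1,2) mn xy by (intro scomm_mons) auto
  then show "scomm x y \<in> tail t (j + k)"
    using piece_tail[of "j + k" "m + n" t] mn by auto
qed

lemma square_tail:
  assumes c: "(2 :: 'k::field) = 0" and t: "t \<noteq> Bracket" and k: "k \<ge> 1" and a: "a \<in> tail t k"
  shows "a * a \<in> (tail t (2 * k) :: 'k endo set)"
proof (rule square_span[OF subspace_tail _ _ a[unfolded tail_def]])
  let ?M = "mons (idx t ((2 :: 'k) = 0)) :: nat \<Rightarrow> 'k endo set"
  fix b assume "b \<in> (\<Union>n\<in>{k..}. ?M n)"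
  then obtain n where b: "k \<le> n" "b \<in> ?M n" by auto
  then show "b * b \<in> tail t (2 * k)"
    using mons_square[OF c t b(2)] piece_tail[of "2 * k" "2 * n" t] by auto
  fix b' assume "b' \<in> (\<Union>n\<in>{k..}. ?M n)"
  then obtain n' where b': "k \<le> n'" "b' \<in> ?M n'" by auto
  have "b * b' + b' * b = scomm b b'"
    by (rule scomm_char_2[OF c mons_op_space[OF b(2)] mons_op_space[OF b'(2)], symmetric])
  moreover have "scomm b b' \<in> piece t (n + n')"
    using b b' k by (intro scomm_mons) auto
  ultimately show "b * b' + b' * b \<in> tail t (2 * k)"
    using piece_tail[of "2 * k" "n + n'" t] b b' by auto
qed

lemma square_piece:
  assumes c: "(2 :: 'k::field) = 0" and t: "t \<noteq> Bracket" and n: "n \<ge> 1" and a: "a \<in> piece t n"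
  shows "a * a \<in> (piece t (2 * n) :: 'k endo set)"
proof (rule square_span[OF subspace_piece _ _ a[unfolded piece_def]])
  let ?M = "mons (idx t ((2 :: 'k) = 0)) :: nat \<Rightarrow> 'k endo set"
  fix b assume b: "b \<in> ?M n"
  then show "b * b \<in> piece t (2 * n)" by (rule mons_square[OF c t])
  fix b' assume b': "b' \<in> ?M n"
  have "b * b' + b' * b = scomm b b'"
    by (rule scomm_char_2[OF c mons_op_space[OF b] mons_op_space[OF b'], symmetric])
  then show "b * b' + b' * b \<in> piece t (2 * n)"
    using scomm_mons[OF n n b b'] by (simp add: mult_2)
qed

lemma monomial_piece:
  assumes H: "t = Bracket \<or> (2 :: 'k::field) = 0" and a: "monomial t n (a :: 'k endo)"
  shows "n \<ge> 1 \<and> a \<in> piece t n"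
  using a
proof (induction rule: monomial.induct)
  case 1
  then show ?case using v_piece[of 0 t] by simp
next
  case 2
  then show ?case using v_piece[of 1 t] by simp
next
  case (3 m a n b)
  then show ?case by (simp add: scomm_piece)
next
  case (4 m a)
  then have "t \<noteq> Bracket" by (auto simp: squarable_def)
  then show ?case using 4 H square_piece[of t m a] by (simp add: power2_eq_square)
qed

text \<open>Up to sign [v_k, [v_k, v_{k+1}]] is v_{k+2}, and signs vanish in characteristic 2. It
  matters that v_k itself is a monomial and not just a combination of monomials, because
  \<open>monomial\<close> squares only monomials.\<close>

lemma monomial_v:
  assumes c: "(2 :: 'k::field) = 0"
  shows "monomial t (jac k) (v k :: 'k endo)"
proof (induction k rule: jac.induct)
  case (3 k)
  have "scomm (v k) (v (k + 1)) = (- mon {k} (k + 2) :: 'k endo)"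
    using scomm_v_Suc[of k, where ?'k = 'k] mon_insert[of "{}" k "k + 2", where ?'a = 'k] by simp
  then have "scomm (v k) (v (k + 1)) = (mon {k} (k + 2) :: 'k endo)"
    by (simp add: neg_char_2[OF c])
  then have "scomm (v k) (scomm (v k) (v (k + 1))) = (v (k + 2) :: 'k endo)"
    using scomm_v_mon_delete[of "{}" k "k + 2", where ?'k = 'k] by simp
  moreover have "monomial t (jac k + (jac k + jac (Suc k))) (scomm (v k) (scomm (v k) (v (Suc k))) :: 'k endo)"
    by (intro monomial.intros 3)
  ultimately show ?case by (simp add: mult_2 add_ac)
qed (use monomial.intros(1,2) in simp_all)

lemma piece_Bracket_component:
  "n \<ge> 1 \<Longrightarrow> piece Bracket n \<subseteq> (component t n :: 'k::field endo set)"
proof (induction n rule: nat_induct_at_least[of 1])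
  case base
  show ?case
    unfolding piece_one component_def
    by (rule endo.span_mono) (use monomial.intros(1,2) in auto)
next
  case (Suc n)
  have "scomm (v i) b \<in> component t (Suc n)" if i: "i \<le> 1" and b: "b \<in> mons (lie_idx ((2 :: 'k) = 0)) n" for i and b :: "'k endo"
  proof (rule scomm_span)
    show "endo.subspace (component t (Suc n) :: 'k endo set)" by (simp add: component_def)
    show "v i \<in> endo.span {v i}" by (simp add: endo.span_base)
    have "b \<in> piece Bracket n" using b by (simp add: piece_def endo.span_base)
    then show "b \<in> endo.span {a. monomial t n a}" using Suc.IH by (auto simp: component_def)
    have "monomial t 1 (v i)" using i monomial.intros(1,2) by (cases i) auto
    then show "scomm a b \<in> component t (Suc n)" if "a \<in> {v i}" "b \<in> {a. monomial t n a}" for a b :: "'k endo"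
      using that monomial.intros(3)[of t 1 "v i" n b] by (auto simp: component_def intro: endo.span_base)
  qed
  then have "endo.span {scomm (v i) b | i b. i \<le> 1 \<and> b \<in> mons (lie_idx ((2 :: 'k) = 0)) n}
      \<subseteq> (component t (Suc n) :: 'k endo set)"
    by (intro endo.span_minimal) (auto simp: component_def)
  then show ?case using piece_Suc_span[OF Suc.hyps, where ?'k = 'k] by simp
qed

lemma component_eq:
  assumes H: "t = Bracket \<or> (2 :: 'k::field) = 0" and n: "n \<ge> 1"
  shows "component t n = (piece t n :: 'k endo set)"
proof (rule antisym)
  show "component t n \<subseteq> (piece t n :: 'k endo set)"
    unfolding component_def
    by (rule endo.span_minimal[OF _ subspace_piece]) (use monomial_piece[OF H] in blast)
  have "b \<in> component t n" if "b \<in> mons (idx t ((2 :: 'k) = 0)) n" for b :: "'k endo"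
    using that
  proof (cases rule: mons_idx_cases)
    case 1
    then have "b \<in> piece Bracket n" by (simp add: piece_def endo.span_base)
    then show ?thesis using piece_Bracket_component[OF n] by blast
  next
    case (2 k)
    then have "(2 :: 'k) = 0" using H by simp
    moreover have "squarable t (v k :: 'k endo)"
      using 2(1) v_op_space by (cases t) (auto simp: squarable_def)
    ultimately have "monomial t n b"
      using monomial.intros(4)[OF monomial_v, of t k] by (simp add: 2 power2_eq_square)
    then show ?thesis by (simp add: component_def endo.span_base)
  qed
  then show "piece t n \<subseteq> (component t n :: 'k endo set)"
    unfolding piece_def by (intro endo.span_minimal) (auto simp: component_def)
qed

text \<open>The tail is graded because its basis is homogeneous, and it is closed because degrees
  add. Conversely every closed graded subspace containing the generators contains all monomials,
  hence all components.\<close>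

lemma generated_eq:
  assumes H: "t = Bracket \<or> (2 :: 'k::field) = 0"
  shows "generated t = (tail t 1 :: 'k endo set)"
proof (rule antisym)
  have "op_part d a \<in> tail t 1" if "a \<in> tail t 1" for d and a :: "'k endo"
    using that unfolding tail_def
  proof (induction rule: endo.span_induct_alt)
    case base
    show ?case using op_part_linear(2)[of d 0 "0 :: 'k endo"] by (simp add: endo.span_zero)
  next
    case (step c x y)
    then obtain n where "x \<in> mons (idx t ((2 :: 'k) = 0)) n" by auto
    then have "op_part d x = x \<or> op_part d x = 0"
      using op_part_hom[OF mons_op_space] by metis
    then have "op_part d x \<in> endo.span (\<Union>n\<in>{1..}. mons (idx t ((2 :: 'k) = 0)) n)"
      using endo.span_base[OF step.hyps(1)] endo.span_zero by metis
    then show ?case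
      using step.IH by (simp add: op_part_linear endo.span_add endo.span_scale)
  qed
  then have "graded_subspace (tail t 1 :: 'k endo set)"
    by (simp add: graded_subspace_def subspace_tail)
  moreover have "closed_under t (tail t 1 :: 'k endo set)"
    unfolding closed_under_def
  proof (intro conjI ballI impI)
    show "scomm a b \<in> tail t 1" if "a \<in> tail t 1" "b \<in> tail t 1" for a b :: "'k endo"
      using scomm_tail[OF order_refl order_refl that] tail_antimono[of 1 "1 + 1" t] by auto
    show "a\<^sup>2 \<in> tail t 1" if "a \<in> tail t 1" "squarable t a" for a :: "'k endo"
    proof -
      have "t \<noteq> Bracket" using that(2) by (auto simp: squarable_def)
      then show ?thesis
        using square_tail[OF _ _ order_refl that(1)] H tail_antimono[of 1 "2 * 1" t]
        by (auto simp: power2_eq_square)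
    qed
  qed
  moreover have "v 0 \<in> (tail t 1 :: 'k endo set)" "v 1 \<in> (tail t 1 :: 'k endo set)"
    using v_piece[of 0 t] v_piece[of 1 t] piece_tail[of 1 1 t] by auto
  ultimately show "generated t \<subseteq> (tail t 1 :: 'k endo set)"
    unfolding generated_def by blast
  have mem: "a \<in> S" if "monomial t n a" "v 0 \<in> S" "v 1 \<in> S" "closed_under t S" for n a and S :: "'k endo set"
    using that(1) by (induction) (use that(2-) in \<open>auto simp: closed_under_def\<close>)
  have "piece t n \<subseteq> S" if "n \<ge> 1" "graded_subspace S" "v 0 \<in> S" "v 1 \<in> S" "closed_under t S" for n and S :: "'k endo set"
    unfolding component_eq[OF H that(1), symmetric] component_def
    using mem[OF _ that(3-5)] that(2) by (intro endo.span_minimal) (auto simp: graded_subspace_def)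
  then show "tail t 1 \<subseteq> (generated t :: 'k endo set)"
    unfolding generated_def by (intro Inter_greatest tail_minimal) (auto simp: graded_subspace_def)
qed

text \<open>One inclusion holds because degrees add. For the other, a basis monomial of degree at
  least n is a combination of [v_i, b] with b of degree at least n - 1, or it is v_k^2 with 2 a_k at
  least n, and then v_k already lies in the term with index n/2 rounded up.\<close>

lemma lower_central_eq:
  assumes H: "t = Bracket \<or> (2 :: 'k::field) = 0" and n: "n \<ge> 1"
  shows "lower_central t n = (tail t n :: 'k endo set)"
  using n
proof (induction n rule: less_induct)
  case (less n)
  show ?case
  proof (cases "n = 1")
    case True
    then show ?thesis by (simp add: lower_central.simps generated_eq[OF H])
  next
    case False
    then have n: "n \<ge> 2" using less.prems by simp
    define h where "h = (n + 1) div 2"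
    have h: "1 \<le> h" "h < n" "n \<le> 2 * h" using n by (auto simp: h_def)
    define G :: "'k endo set" where "G = {scomm a b | a b. a \<in> tail t 1 \<and> b \<in> tail t (n - 1)} \<union>
       (if t = Bracket then {} else {a\<^sup>2 | a. a \<in> tail t h \<and> a \<in> op_space 1}) \<union>
       (if t = Bracket_Squares then {a\<^sup>2 | a. a \<in> tail t h \<and> a \<in> op_space 0} else {})"
    have IH: "lower_central t (n - 1) = (tail t (n - 1) :: 'k endo set)"
      "lower_central t h = (tail t h :: 'k endo set)"
      using n h by (intro less.IH; simp)+
    have lc: "lower_central t n = endo.span G"
      using n by (subst lower_central.simps) (simp only: h_def[symmetric] IH generated_eq[OF H] G_def, simp)
    have sq: "a\<^sup>2 \<in> tail t n" if "t \<noteq> Bracket" "a \<in> tail t h" for a :: "'k endo"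
      using square_tail[OF _ that(1) h(1) that(2)] that(1) H tail_antimono[OF h(3), of t]
      by (auto simp: power2_eq_square)
    have br: "scomm a b \<in> tail t n" if "a \<in> tail t 1" "b \<in> tail t (n - 1)" for a b :: "'k endo"
      using scomm_tail[OF order_refl _ that] n by simp
    have "G \<subseteq> tail t n"
      using sq br by (auto simp: G_def split: if_splits)
    then have "endo.span G \<subseteq> tail t n" by (rule endo.span_minimal[OF _ subspace_tail])
    moreover have "tail t n \<subseteq> endo.span G"
    proof (rule tail_minimal)
      fix m assume m: "n \<le> m"
      have v1: "v i \<in> (tail t 1 :: 'k endo set)" if "i \<le> 1" for i
        using v_piece[of i t] that piece_tail[of 1 1 t] by auto
      have lie: "piece Bracket m \<subseteq> endo.span G"
      proof -
        have "{scomm (v i) b | i b. i \<le> 1 \<and> b \<in> mons (lie_idx ((2 :: 'k) = 0)) (m - 1)} \<subseteq> G"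
          using v1 mons_tail[of "n - 1" "m - 1" _ t] mons_lie_subset[of "(2 :: 'k) = 0" "m - 1" t] m
          unfolding G_def by fastforce
        then have "endo.span {scomm (v i) b | i b. i \<le> 1 \<and> b \<in> mons (lie_idx ((2 :: 'k) = 0)) (m - 1)} \<subseteq> endo.span G"
          by (rule endo.span_mono)
        note G = this
        have m1: "1 \<le> m - 1" "m - 1 + 1 = m" using m n by auto
        show ?thesis
          using order.trans[OF piece_Suc_span[OF m1(1)] G] unfolding m1(2) .
      qed
      have "b \<in> endo.span G" if "b \<in> mons (idx t ((2 :: 'k) = 0)) m" for b :: "'k endo"
        using that
      proof (cases rule: mons_idx_cases)
        case 1
        then have "b \<in> piece Bracket m" by (simp add: piece_def endo.span_base)
        then show ?thesis using lie by blast
      next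
        case (2 k)
        have "h \<le> jac k" using 2(2) m by (simp add: h_def)
        then have "v k \<in> (tail t h :: 'k endo set)" using v_piece[of k t] piece_tail[of h "jac k" t] by auto
        then have "b \<in> G" using 2 v_op_space by (auto simp: G_def power2_eq_square)
        then show ?thesis by (rule endo.span_base)
      qed
      then show "piece t m \<subseteq> endo.span G"
        unfolding piece_def by (intro endo.span_minimal) auto
    qed simp
    ultimately show ?thesis using lc by simp
  qed
qed

text \<open>Send each b in B to an element of span C congruent to b modulo W, and extend linearly.
  The map changes vectors of span B only by elements of W, so its kernel there lies in the
  intersection with W, which is zero.\<close>

lemma (in vector_space) independent_complement_le:
  assumes B: "independent B" "span B \<inter> W = {0}" "B \<subseteq> U" and W: "subspace W"
    and C: "span (C \<union> W) = U" "finite C"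
  shows "finite B \<and> card B \<le> card C"
proof -
  have "\<exists>y\<in>span C. y - b \<in> W" if "b \<in> B" for b
  proof -
    have "b \<in> span (C \<union> W)" using that B(3) C(1) by blast
    then obtain y w where "y \<in> span C" "w \<in> span W" "b = y + w" by (auto simp: span_Un)
    moreover from this have "w \<in> W" using W by (metis span_eq_iff)
    ultimately show ?thesis using subspace_neg[OF W] by (intro bexI[of _ y]) auto
  qed
  then obtain f where f: "\<And>b. b \<in> B \<Longrightarrow> f b \<in> span C" "\<And>b. b \<in> B \<Longrightarrow> f b - b \<in> W" by metis
  interpret vector_space_pair scale scale by unfold_locales
  obtain g where g: "Vector_Spaces.linear scale scale g" "\<And>b. b \<in> B \<Longrightarrow> g b = f b"
    using linear_independent_extend[OF B(1), of f] by auto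
  interpret g: Vector_Spaces.linear scale scale g by (rule g(1))
  have diff: "g x - x \<in> W" if "x \<in> span B" for x
    using that
  proof (induction rule: span_induct_alt)
    case (step c x y)
    have "g (scale c x + y) - (scale c x + y) = scale c (g x - x) + (g y - y)"
      by (simp add: g.add g.scale algebra_simps)
    moreover have "g x - x \<in> W"
      using f(2)[OF step.hyps(1)] g(2)[OF step.hyps(1)] by simp
    ultimately show ?case
      using step.IH by (simp only: subspace_add[OF W] subspace_scale[OF W])
  qed (simp add: g.zero subspace_0[OF W])
  have inj: "inj_on g (span B)"
  proof (subst g.inj_on_iff_eq_0[OF subspace_span], intro ballI impI)
    fix x assume x: "x \<in> span B" "g x = 0"
    then have "- x \<in> W" using diff[OF x(1)] by simp
    then have "x \<in> W" using subspace_neg[OF W] by fastforce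
    then show "x = 0" using x(1) B(2) by blast
  qed
  have "independent (g ` B)"
    by (rule linear_independent_injective_image[OF g(1) B(1) inj])
  moreover have "g ` B \<subseteq> span C" using g(2) f(1) by auto
  ultimately have "finite (g ` B) \<and> card (g ` B) \<le> card C"
    using independent_span_bound[OF C(2)] by blast
  moreover have "inj_on g B" using inj span_superset inj_on_subset by blast
  ultimately show ?thesis by (metis card_image finite_imageD)
qed

text \<open>Comparing cardinalities in both directions frees the value from the choice made by
  \<open>SOME\<close>.\<close>

lemma quotient_dim_eq:
  assumes W: "endo.subspace W" and C: "quotient_basis U W C" "finite C"
  shows "quotient_dim U W = card C"
proof -
  have le: "finite B \<and> card B \<le> card D" if "quotient_basis U W B" "quotient_basis U W D" "finite D" for B D
  proof -
    have "B \<subseteq> U" using that(1) endo.span_superset[of "B \<union> W"] by (auto simp: quotient_basis_def)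
    then show ?thesis
      using that W by (intro endo.independent_complement_le) (auto simp: quotient_basis_def)
  qed
  define B where "B = (SOME B. quotient_basis U W B)"
  have B: "quotient_basis U W B" unfolding B_def using C(1) by (rule someI)
  have "card B = card C" using le[OF B C] le[OF C(1) B] by simp
  moreover have "quotient_dim U W = card B"
    using C(1) by (auto simp: quotient_dim_def B_def)
  ultimately show ?thesis by simp
qed

section \<open>Gradation, quotient dimensions and width\<close>

lemma mons_union: "(\<Union>n\<in>N. mons I n) = (\<lambda>(T, m). mon T m) ` (\<Union>n\<in>N. deg_idx I n)"
  by (auto simp: mons_def)

text \<open>An index pair has at most one degree, so disjoint sets of degrees select disjoint parts
  of one independent family.\<close>

lemma span_mons_disjoint:
  assumes "M \<inter> N = {}"
  shows "endo.span (\<Union>n\<in>M. mons (idx t c) n) \<inter> endo.span (\<Union>n\<in>N. mons (idx t c) n) = {0 :: 'k::field endo}"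
proof (rule endo.span_Int_disjoint)
  let ?f = "\<lambda>(T, m). mon T m :: 'k endo"
  show "endo.independent (?f ` idx t c)"
    by (rule independent_mon) (rule finite_idx)
  have sub: "(\<Union>n\<in>N. deg_idx (idx t c) n) \<subseteq> idx t c" for N
    by (auto simp: deg_idx_def)
  show "(\<Union>n\<in>M. mons (idx t c) n) \<subseteq> ?f ` idx t c" "(\<Union>n\<in>N. mons (idx t c) n) \<subseteq> ?f ` idx t c"
    unfolding mons_union by (intro image_mono sub)+
  have "(\<Union>n\<in>M. deg_idx (idx t c) n) \<inter> (\<Union>n\<in>N. deg_idx (idx t c) n) = {}"
    using assms by (auto simp: deg_idx_def) (metis add_right_cancel disjoint_iff)
  moreover have "inj_on ?f (idx t c)" by (rule inj_on_mon) (rule finite_idx)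
  ultimately show "(\<Union>n\<in>M. mons (idx t c) n) \<inter> (\<Union>n\<in>N. mons (idx t c) n) = ({} :: 'k endo set)"
    unfolding mons_union using inj_on_image_Int[of ?f "idx t c", OF _ sub sub] by (metis image_empty)
qed

lemma card_mons: "card (mons (idx t c) n :: 'k::field endo set) = card (deg_idx (idx t c) n)"
  unfolding mons_def
  by (rule card_image, rule inj_on_mon) (auto simp: deg_idx_def intro: finite_idx)

lemma independent_mons: "endo.independent (mons (idx t c) n :: 'k::field endo set)"
  unfolding mons_def
  by (rule independent_mon) (auto simp: deg_idx_def intro: finite_idx)

lemma dim_piece: "endo.dim (piece t n :: 'k::field endo set) = card (deg_idx (idx t ((2 :: 'k) = 0)) n)"
  unfolding piece_def
  by (subst endo.dim_span_eq_card_independent[OF independent_mons]) (rule card_mons)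

lemma idx_cases:
  assumes "c \<or> t = Bracket"
  shows "idx t c = (if \<not> c then lie_idx False else if t = Bracket then base_idx else base_idx \<union> square_idx)"
  using assms by (auto simp: idx_def lie_idx_def)

lemma finite_deg_idx:
  assumes "c \<or> t = Bracket" "n \<ge> 1"
  shows "finite (deg_idx (idx t c) n)"
  unfolding idx_cases[OF assms(1)]
  using card_idx_not_2(1)[OF assms(2)] card_base_all[OF assms(2)] card_idx_square(1)[OF assms(2)] by simp

lemma quotient_dim_tail:
  assumes H: "t = Bracket \<or> (2 :: 'k::field) = 0" and n: "n \<ge> 1"
  shows "quotient_dim (tail t n) (tail t (n + 1) :: 'k endo set) = endo.dim (piece t n :: 'k endo set)"
proof -
  let ?M = "mons (idx t ((2 :: 'k) = 0)) :: nat \<Rightarrow> 'k endo set"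
  have "finite (?M n)"
    unfolding mons_def using H n by (intro finite_imageI finite_deg_idx) auto
  moreover have "quotient_basis (tail t n) (tail t (n + 1)) (?M n)"
    unfolding quotient_basis_def
  proof (intro conjI independent_mons)
    show "endo.span (?M n) \<inter> tail t (n + 1) = {0}"
      using span_mons_disjoint[of "{n}" "{n + 1..}" t "(2 :: 'k) = 0"] by (simp add: tail_def)
    show "endo.span (?M n \<union> tail t (n + 1)) = tail t n"
    proof (rule antisym)
      show "endo.span (?M n \<union> tail t (n + 1)) \<subseteq> tail t n"
        using mons_tail[of n n _ t] tail_antimono[of n "n + 1" t]
        by (intro endo.span_minimal subspace_tail) auto
      show "tail t n \<subseteq> endo.span (?M n \<union> tail t (n + 1))"
      proof (rule tail_minimal)
        fix m assume "n \<le> m"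
        then consider "m = n" | "n + 1 \<le> m" by linarith
        then show "piece t m \<subseteq> endo.span (?M n \<union> tail t (n + 1))"
        proof cases
          case 1
          then show ?thesis unfolding piece_def by (intro endo.span_mono) auto
        next
          case 2
          then show ?thesis
            using piece_tail[of "n + 1" m t] endo.span_superset[of "?M n \<union> tail t (n + 1)"] by blast
        qed
      qed simp
    qed
  qed
  ultimately have "quotient_dim (tail t n) (tail t (n + 1) :: 'k endo set) = card (?M n)"
    by (intro quotient_dim_eq subspace_tail)
  then show ?thesis by (simp add: card_mons dim_piece)
qed

lemma gradation_piece:
  assumes H: "t = Bracket \<or> (2 :: 'k::field) = 0"
  shows "gradation t (generated t) (component t :: nat \<Rightarrow> 'k endo set)"
  unfolding gradation_def
proof (intro conjI allI impI ballI)
  note comp = component_eq[OF H]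
  show "endo.subspace (component t n :: 'k endo set)" for n by (simp add: component_def)
  show "generated t = endo.span (\<Union>n\<in>{1..}. component t n :: 'k endo set)"
    by (simp add: generated_eq[OF H] tail_eq comp)
  show "component t n \<inter> endo.span (\<Union>m\<in>{1..} - {n}. component t m) = {0 :: 'k endo}" if n: "1 \<le> n" for n
  proof -
    let ?M = "mons (idx t ((2 :: 'k) = 0)) :: nat \<Rightarrow> 'k endo set"
    have "endo.span (\<Union>m\<in>{1..} - {n}. component t m) \<subseteq> endo.span (\<Union>m\<in>{1..} - {n}. ?M m)"
    proof (rule endo.span_minimal)
      show "(\<Union>m\<in>{1..} - {n}. component t m) \<subseteq> endo.span (\<Union>m\<in>{1..} - {n}. ?M m)"
      proof (rule UN_least)
        fix m assume m: "m \<in> {1..} - {n}"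
        then have "component t m = endo.span (?M m)" by (simp add: comp piece_def)
        also have "\<dots> \<subseteq> endo.span (\<Union>m\<in>{1..} - {n}. ?M m)"
          using m by (intro endo.span_mono) blast
        finally show "component t m \<subseteq> endo.span (\<Union>m\<in>{1..} - {n}. ?M m)" .
      qed
    qed simp
    moreover have "component t n = endo.span (\<Union>m\<in>{n}. ?M m)"
      using comp[OF n] by (simp add: piece_def)
    moreover have "endo.span (\<Union>m\<in>{n}. ?M m) \<inter> endo.span (\<Union>m\<in>{1..} - {n}. ?M m) = {0}"
      by (rule span_mons_disjoint) auto
    ultimately show ?thesis
      using endo.span_zero[of "\<Union>m\<in>{1..} - {n}. component t m"] endo.span_zero[of "\<Union>m\<in>{n}. ?M m"] by blast
  qed
  show "scomm a b \<in> component t (m + n)" if "1 \<le> m" "1 \<le> n" "a \<in> component t m" "b \<in> component t n"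
    for m n and a b :: "'k endo"
    using that scomm_piece[of m n a t b] by (simp add: comp)
  show "a\<^sup>2 \<in> component t (2 * m)" if "1 \<le> m" "a \<in> component t m" "squarable t a" for m and a :: "'k endo"
  proof -
    have "t \<noteq> Bracket" using that(3) by (auto simp: squarable_def)
    then show ?thesis
      using that square_piece[of t m a] H by (simp add: comp power2_eq_square)
  qed
qed

lemma of_width_component:
  assumes H: "t = Bracket \<or> (2 :: 'k::field) = 0"
    and le: "\<And>n. n \<ge> 1 \<Longrightarrow> card (deg_idx (idx t ((2 :: 'k) = 0)) n) \<le> d"
    and N: "N \<ge> 1" "card (deg_idx (idx t ((2 :: 'k) = 0)) N) = d"
  shows "of_width d (component t :: nat \<Rightarrow> 'k endo set)"
  unfolding of_width_def width_at_most_def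
proof (intro conjI allI impI)
  fix n :: nat assume n: "1 \<le> n"
  have "finite (mons (idx t ((2 :: 'k) = 0)) n :: 'k endo set)"
    unfolding mons_def using H n by (intro finite_imageI finite_deg_idx) auto
  then show "\<exists>B. finite B \<and> component t n \<subseteq> (endo.span B :: 'k endo set)"
    unfolding component_eq[OF H n] piece_def by blast
  show "endo.dim (component t n :: 'k endo set) \<le> d"
    unfolding component_eq[OF H n] dim_piece by (rule le[OF n])
next
  fix d' assume "\<forall>n\<ge>1. (\<exists>B. finite B \<and> component t n \<subseteq> (endo.span B :: 'k endo set)) \<and> endo.dim (component t n :: 'k endo set) \<le> d'"
  then have "endo.dim (component t N :: 'k endo set) \<le> d'" using N(1) by blast
  then show "d \<le> d'" unfolding component_eq[OF H N(1)] dim_piece N(2) .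
qed

lemma two_eq_0_iff: "(2 :: 'k::field) = 0 \<longleftrightarrow> CHAR('k) = 2"
proof
  assume "(2 :: 'k) = 0"
  then have "CHAR('k) dvd 2"
    using of_nat_eq_0_iff_char_dvd[of 2, where ?'a = 'k] by simp
  moreover have "CHAR('k) \<noteq> 1"
    by simp
  ultimately show "CHAR('k) = 2"
    using dvd_imp_le[of "CHAR('k)" 2] dvd_0_left_iff[of "2 :: nat"] by (metis le_neq_implies_less less_2_cases
        zero_neq_numeral zero_less_numeral One_nat_def)
next
  assume "CHAR('k) = 2"
  then show "(2 :: 'k) = 0"
    using of_nat_CHAR[where ?'a = 'k] by simp
qed

theorem theorem11p1:
  fixes t :: alg_type
    and R :: "'k::field endo set"
    and Rn :: "nat \<Rightarrow> 'k endo set"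
    and RL :: "nat \<Rightarrow> 'k endo set"
    and a :: "nat \<Rightarrow> nat"
  assumes "CHAR('k) \<noteq> 2 \<Longrightarrow> t = Bracket"
    and "R = generated t"
    and "Rn = component t"
    and "RL = lower_central t"
    and "a = (\<lambda>n. endo.dim (Rn n))"
  shows "gradation t R Rn \<and>
    (\<forall>n\<ge>1. a n = quotient_dim (RL n) (RL (n + 1))) \<and>
    (CHAR('k) \<noteq> 2 \<and> t = Bracket \<longrightarrow>
       (\<forall>n\<ge>1. a n \<in> {2, 3, 4}) \<and> of_width 4 Rn) \<and>
    (CHAR('k) = 2 \<and> t = Bracket \<longrightarrow>
       (\<forall>n\<ge>1. a n \<in> {1, 2}) \<and> of_width 2 Rn) \<and>
    (CHAR('k) = 2 \<and> t \<in> {Bracket_Odd_Squares, Bracket_Squares} \<longrightarrow>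
       (\<forall>n\<ge>1. a n \<in> {1, 2, 3}) \<and> of_width 3 Rn)"
proof -
  have H: "t = Bracket \<or> (2 :: 'k) = 0"
    using assms(1) by (auto simp: two_eq_0_iff)
  let ?I = "idx t ((2 :: 'k) = 0)"
  have a: "a n = card (deg_idx ?I n)" if "n \<ge> 1" for n
    by (simp add: assms(3,5) component_eq[OF H that] dim_piece)
  have quotient: "a n = quotient_dim (RL n) (RL (n + 1))" if "n \<ge> 1" for n
    using that quotient_dim_tail[OF H that]
    by (simp add: assms(3-5) component_eq[OF H] lower_central_eq[OF H])
  have width: "of_width d Rn" if "\<forall>n\<ge>1. a n \<in> {..d}" "N \<ge> 1" "a N = d" for d N
    unfolding assms(3) using that a by (intro of_width_component[OF H, of d N]) auto
  have 1: "(\<forall>n\<ge>1. a n \<in> {2, 3, 4}) \<and> of_width 4 Rn" if "CHAR('k) \<noteq> 2 \<and> t = Bracket"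
  proof -
    have I: "?I = lie_idx False" using that by (simp add: two_eq_0_iff)
    have "\<forall>n\<ge>1. a n \<in> {2, 3, 4}" using a card_idx_not_2(2) unfolding I by simp
    moreover have "a 5 = 4" using a[of 5] card_idx_not_2(3)[of 1] unfolding I by simp
    ultimately show ?thesis by (intro conjI width[of 4 5]) auto
  qed
  have 2: "(\<forall>n\<ge>1. a n \<in> {1, 2}) \<and> of_width 2 Rn" if "CHAR('k) = 2 \<and> t = Bracket"
  proof -
    have I: "?I = base_idx" using that by (simp add: two_eq_0_iff lie_idx_def)
    have "\<forall>n\<ge>1. a n \<in> {1, 2}" using a card_base_all unfolding I by simp
    moreover have "a 1 = 2" using a[of 1] card_base_one(2) unfolding I by simp
    ultimately show ?thesis by (intro conjI width[of 2 1]) auto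
  qed
  have 3: "(\<forall>n\<ge>1. a n \<in> {1, 2, 3}) \<and> of_width 3 Rn"
    if "CHAR('k) = 2 \<and> t \<in> {Bracket_Odd_Squares, Bracket_Squares}"
  proof -
    have I: "?I = base_idx \<union> square_idx" using that by (auto simp: two_eq_0_iff idx_def lie_idx_def)
    have "\<forall>n\<ge>1. a n \<in> {1, 2, 3}" using a card_idx_square(2) unfolding I by simp
    moreover have "a 2 = 3" using a[of 2] card_idx_square(3)[of 1] unfolding I by simp
    ultimately show ?thesis by (intro conjI width[of 3 2]) auto
  qed
  have "gradation t R Rn" unfolding assms(2,3) by (rule gradation_piece[OF H])
  then show ?thesis using quotient 1 2 3 by blast
qed

end
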